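(* Let $\kappa$ be a fixed complex number, $N$ a fixed non-negative integer, $0<\delta\le\pi$ fixed, and $\nu=z-\kappa$. Then $$H_\nu^{(1)}(z)=-\frac{2}{3\pi}\sum_{n=0}^{N-1}6^{\frac{n+1}{3}}B_n(\kappa)e^{\frac{2(n+1)\pi i}{3}}\sin\left(\frac{(n+1)\pi}{3}\right)\frac{\Gamma\left(\frac{n+1}{3}\right)}{z^{\frac{n+1}{3}}}+\mathcal O_{\kappa,N,\delta}\left(\frac{1}{|z|^{\frac{N+1}{3}}}\right)$$ as $z\to\infty$ in the sector $-\pi+\delta\le\arg z\le2\pi-\delta$, and $$H_\nu^{(2)}(z)=-\frac{2}{3\pi}\sum_{n=0}^{N-1}6^{\frac{n+1}{3}}B_n(\kappa)e^{-\frac{2(n+1)\pi i}{3}}\sin\left(\frac{(n+1)\pi}{3}\right)\frac{\Gamma\left(\frac{n+1}{3}\right)}{z^{\frac{n+1}{3}}}+\mathcal O_{\kappa,N,\delta}\left(\frac{1}{|z|^{\frac{N+1}{3}}}\right)$$ as $z\to\infty$ in the sector $-2\pi+\delta\le\arg z\le\pi-\delta$.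
   Context: $H_\nu^{(1)},H_\nu^{(2)}$ are the Hankel functions of complex order $\nu$; $z$ is regarded as a point of the Riemann surface of the logarithm, functions being analytic continuations in $z$ of their principal branches, and $z^{k/3}=|z|^{k/3}e^{ik(\arg z)/3}$. The polynomials $B_n(\kappa)$ are $$B_n(\kappa)=\frac{1}{n!}\left[\frac{d^n}{dt^n}\left(e^{\kappa t}\left(\frac16\frac{t^3}{\sinh t-t}\right)^{\frac{n+1}{3}}\right)\right]_{t=0},$$ the power being the branch equal to $1$ at $t=0$. Subscripts on $\mathcal O$ indicate the dependence of the implied constant. Empty sums are zero. *)

theory Defs
  imports "HOL-Analysis.Analysis" "HOL-Library.Landau_Symbols"
begin

text \<open>
  A point \<open>z\<close> of the Riemann surface of the logarithm is represented by its logarithm, a complex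
  number \<open>w = ln |z| + \<i> arg z\<close> with \<open>arg z\<close> unrestricted: the underlying complex number is
  \<open>exp w\<close>, and \<open>arg z = Im w\<close>. Analytic continuation in \<open>z\<close> means analyticity in \<open>w\<close>, and the
  principal branch is the restriction to \<open>w = Ln z\<close>, i.e. \<open>-\<pi> < Im w \<le> \<pi>\<close>.
\<close>

definition surf_proj :: "complex \<Rightarrow> complex" where
  "surf_proj w = exp w"

definition surf_arg :: "complex \<Rightarrow> real" where
  "surf_arg w = Im w"

definition surf_powr :: "complex \<Rightarrow> complex \<Rightarrow> complex" where
  "surf_powr w a = exp (a * w)"

definition sector_at_infinity :: "real \<Rightarrow> real \<Rightarrow> complex filter" where
  "sector_at_infinity \<alpha> \<beta> =
     inf (filtercomap (\<lambda>w. norm (surf_proj w)) at_top)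
         (principal {w. \<alpha> \<le> surf_arg w \<and> surf_arg w \<le> \<beta>})"

text \<open>
  In the power series of the Bessel function, \<open>(z/2)\<^sup>\<nu>\<close> is \<open>z\<^sup>\<nu> / 2\<^sup>\<nu>\<close> with \<open>z\<^sup>\<nu>\<close> taken on the
  surface. The reciprocal Gamma function is entire, so every order is allowed.
\<close>

definition bessel_J :: "complex \<Rightarrow> complex \<Rightarrow> complex" where
  "bessel_J \<nu> w = surf_powr w \<nu> / 2 powr \<nu> *
     (\<Sum>k. (-1) ^ k * rGamma (\<nu> + of_nat k + 1) / fact k * (surf_proj w / 2) ^ (2 * k))"

definition bessel_Y :: "complex \<Rightarrow> complex \<Rightarrow> complex" where
  "bessel_Y \<nu> w =
     (let Y = (\<lambda>\<mu>. (bessel_J \<mu> w * cos (of_real pi * \<mu>) - bessel_J (- \<mu>) w)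
                      / sin (of_real pi * \<mu>))
      in if \<nu> \<in> \<int> then Lim (at \<nu>) Y else Y \<nu>)"

definition hankel_H1 :: "complex \<Rightarrow> complex \<Rightarrow> complex" where
  "hankel_H1 \<nu> w = bessel_J \<nu> w + \<i> * bessel_Y \<nu> w"

definition hankel_H2 :: "complex \<Rightarrow> complex \<Rightarrow> complex" where
  "hankel_H2 \<nu> w = bessel_J \<nu> w - \<i> * bessel_Y \<nu> w"

text \<open>
  The singularity of \<open>t\<^sup>3 / (6 (sinh t - t))\<close> at \<open>0\<close> is removable with value \<open>1\<close>; hence the
  principal power below is, near \<open>t = 0\<close>, the analytic branch with value \<open>1\<close> at \<open>t = 0\<close>.
\<close>

definition B_base :: "complex \<Rightarrow> complex" where
  "B_base t = (if t = 0 then 1 else 1 / 6 * (t ^ 3 / (sinh t - t)))"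

definition B_poly :: "nat \<Rightarrow> complex \<Rightarrow> complex" where
  "B_poly n \<kappa> =
     1 / fact n * (deriv ^^ n) (\<lambda>t. exp (\<kappa> * t) * B_base t powr (of_nat (n + 1) / 3)) 0"

end

theory Submission
  imports Defs "HOL-Complex_Analysis.Complex_Analysis" "HOL-Real_Asymp.Real_Asymp"
begin

text \<open>With \<open>z = exp w\<close> and \<open>\<nu> = z - \<kappa>\<close>, the Schlaefli integral of \<open>H\<^sup>(\<^sup>1\<^sup>)\<close> is
  \<open>(1 / (pi \<i>)) \<integral> exp (z (sinh t - t) + \<kappa> t) dt\<close> from \<open>- \<infinity>\<close> to \<open>\<infinity> + pi \<i>\<close>. Its phase \<open>sinh t - t\<close> has a double
  saddle point at \<open>t = 0\<close>, which cuts the contour into two arms. The substitution \<open>t \<mapsto> - t\<close> turns the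
  right arm for \<open>(\<kappa>, w)\<close> into the left arm for \<open>(- \<kappa>, w - \<i> pi)\<close>, so a single function has to be expanded,
  namely the left arm, on \<open>\<bar>arg z\<bar> < 2 pi\<close>.

  The integral representation comes out of the power series: expanding one of the two exponential
  factors of \<open>exp (z sinh t)\<close> and integrating term by term gives incomplete Gamma functions, whose
  limits at infinity are the Gamma factors of the two Bessel series, while the contributions of
  \<open>t = 0\<close> to the two arms cancel. Orders in \<open>\<int>\<close> follow by continuity.

  Near \<open>t = 0\<close> put \<open>\<sigma>\<^sup>3 = 6 (sinh t - t)\<close>; then \<open>exp (\<kappa> t) = (\<Sum>n<N. B\<^sub>n(\<kappa>) \<sigma>\<^sup>n \<sigma>') + O(\<sigma>\<^sup>N)\<close> by Lagrange inversion,
  and each term integrates to an incomplete Gamma function. The rest of the arm is exponentially small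
  along a path of descent, which runs along the negative axis, a diagonal, or the imaginary axis,
  depending on \<open>arg z\<close>.\<close>


section \<open>The lower incomplete Gamma function\<close>

text \<open>The saddle is of third order, so the natural scale of \<open>t\<close> is |z|^(-1/3),
  and a term with \<open>\<sigma>\<close> to the power n times its derivative contributes
  z^(-(n+1)/3). Adding the two arms turns each power into \<open>E ^ 3 - E\<close> with E = exp
  (\<i> (n+1) pi / 3) for the first Hankel function; this is E^2 times a sine, the source of the
  trigonometric factors of the theorem. The sectors of the theorem are where the arguments of both
  arms, arg z and arg z shifted by pi, stay away from 2 pi in modulus. The obstacle is uniformity of
  descent in the phase \<theta> = arg z. On the negative axis the real part is -cos \<theta> (sinh x
  - x), which dies at \<theta> = pi/2. On the imaginary axis it is sin \<theta> (y - sin y), which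
  dies at \<theta> = pi. The diagonal path bridges the phases between, and its range must overhang
  both critical phases by a fixed amount so that the three ranges overlap. Orders vary with z and
  may hit integers, so the integral representation is proved for every complex order.\<close>

text \<open>\<open>igam s y\<close> is \<open>\<gamma>(s, exp y)\<close>, continued in \<open>s\<close> to everything but the nonpositive integers.\<close>

definition gser :: "complex \<Rightarrow> complex \<Rightarrow> complex" where
  "gser s x = (\<Sum>j. x ^ j / (fact j * (s + of_nat j)))"

definition igam :: "complex \<Rightarrow> complex \<Rightarrow> complex" where
  "igam s y = exp (s * y) * gser s (- exp y)"

text \<open>A uniform distance from the poles lets the exponential series dominate all sums with
  denominators \<open>s + of_nat j\<close>.\<close>

lemma nonpos_Ints_separated:
  assumes "(s :: complex) \<notin> \<int>\<^sub>\<le>\<^sub>0"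
  obtains d where "d > 0" "\<And>j. d \<le> norm (s + of_nat j)"
proof -
  obtain d where "d > 0" and d: "\<And>x. x \<in> \<int>\<^sub>\<le>\<^sub>0 \<Longrightarrow> d \<le> dist s x"
    using separate_point_closed[OF closed_nonpos_Ints assms] by blast
  show ?thesis
  proof
    show "d > 0" by fact
    fix j show "d \<le> norm (s + of_nat j)"
      using d[of "- of_nat j"] by (simp add: dist_norm)
  qed
qed

lemma norm_igam_term_le:
  fixes x s :: complex
  assumes "d > 0" "d \<le> norm (s + of_nat j)"
  shows "norm (x ^ j / (fact j * (s + of_nat j))) \<le> norm x ^ j /\<^sub>R fact j / d"
proof -
  have "norm (x ^ j / (fact j * (s + of_nat j))) = norm x ^ j / fact j / norm (s + of_nat j)"
    by (simp add: norm_divide norm_mult norm_power)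
  also have "\<dots> \<le> norm x ^ j / fact j / d"
    using assms by (intro divide_left_mono) (auto intro!: mult_pos_pos)
  finally show ?thesis by (simp add: divide_inverse mult_ac)
qed

lemma igam_term_bounds:
  fixes x s :: complex
  assumes "d > 0" "\<And>j. d \<le> norm (s + of_nat j)"
  shows "summable (\<lambda>j. norm (x ^ j / (fact j * (s + of_nat j))))"
    and "norm (\<Sum>j. x ^ j / (fact j * (s + of_nat j))) \<le> exp (norm x) / d"
proof -
  have s: "(\<lambda>j. norm x ^ j /\<^sub>R fact j / d) sums (exp (norm x) / d)"
    by (intro sums_divide exp_converges)
  show 1: "summable (\<lambda>j. norm (x ^ j / (fact j * (s + of_nat j))))"
    by (rule summable_comparison_test'[OF sums_summable[OF s]])
       (use norm_igam_term_le[OF assms] in auto)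
  have "norm (\<Sum>j. x ^ j / (fact j * (s + of_nat j))) \<le> (\<Sum>j. norm (x ^ j / (fact j * (s + of_nat j))))"
    by (rule summable_norm[OF 1])
  also have "\<dots> \<le> (\<Sum>j. norm x ^ j /\<^sub>R fact j / d)"
    by (intro suminf_le norm_igam_term_le assms 1 sums_summable[OF s])
  also have "\<dots> = exp (norm x) / d" using s by (simp add: sums_iff)
  finally show "norm (\<Sum>j. x ^ j / (fact j * (s + of_nat j))) \<le> exp (norm x) / d" .
qed

lemma igam_term_summable:
  fixes x s :: complex
  assumes "s \<notin> \<int>\<^sub>\<le>\<^sub>0"
  shows "summable (\<lambda>j. x ^ j / (fact j * (s + of_nat j)))"
  using nonpos_Ints_separated[OF assms] igam_term_bounds(1) summable_norm_cancel by metis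

text \<open>Multiplying the n-th coefficient by \<open>s + n\<close> cancels the denominator and
  leaves the exponential series. The equation is kept at the level of \<open>gser\<close> because
  the primitive at the saddle uses it at \<open>x = 0\<close>, where \<open>x\<close> has no
  logarithm.\<close>

lemma gser_ode:
  assumes s: "s \<notin> \<int>\<^sub>\<le>\<^sub>0"
  obtains D where "(gser s has_field_derivative D) (at x)" "x * D + s * gser s x = exp x"
proof -
  define c where "c = (\<lambda>j. 1 / (fact j * (s + of_nat j)))"
  have gser: "gser s = (\<lambda>x. \<Sum>j. c j * x ^ j)"
    by (simp add: gser_def c_def fun_eq_iff)
  have sm: "summable (\<lambda>j. c j * x ^ j)" for x
    using igam_term_summable[OF s] by (simp add: c_def)
  define D where "D = (\<Sum>j. diffs c j * x ^ j)"
  have D: "(gser s has_field_derivative D) (at x)"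
    unfolding gser D_def by (rule termdiffs_strong_converges_everywhere[OF sm])
  have "(\<lambda>n. of_nat n * c n * x ^ (n - Suc 0)) sums D"
    unfolding D_def by (rule diffs_equiv[OF termdiff_converges_all[OF sm]])
  from sums_mult[OF this, of x] have 1: "(\<lambda>n. of_nat n * c n * x ^ n) sums (x * D)"
    by (rule sums_cong[THEN iffD1, rotated]) (auto simp: power_eq_if)
  have 2: "(\<lambda>n. s * (c n * x ^ n)) sums (s * gser s x)"
    unfolding gser by (intro sums_mult summable_sums sm)
  have ne: "s + of_nat n \<noteq> 0" for n
    using s by (metis add_eq_0_iff2 minus_of_nat_in_nonpos_Ints)
  have "of_nat n * c n * x ^ n + s * (c n * x ^ n) = x ^ n /\<^sub>R fact n" for n
  proof -
    have "of_nat n * c n * x ^ n + s * (c n * x ^ n) = (s + of_nat n) * c n * x ^ n"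
      by (simp add: algebra_simps)
    also have "(s + of_nat n) * c n = 1 / fact n" using ne[of n] by (simp add: c_def)
    finally show ?thesis by (simp add: scaleR_conv_of_real divide_inverse)
  qed
  with sums_add[OF 1 2] have "(\<lambda>n. x ^ n /\<^sub>R fact n) sums (x * D + s * gser s x)" by simp
  then have "x * D + s * gser s x = exp x"
    using exp_converges[of x] sums_unique2 by blast
  with D show ?thesis by (rule that)
qed

lemma igam_has_field_derivative:
  assumes s: "s \<notin> \<int>\<^sub>\<le>\<^sub>0"
  shows "(igam s has_field_derivative exp (s * y - exp y)) (at y within A)"
proof -
  define x where "x = - exp y"
  obtain D where D: "(gser s has_field_derivative D) (at x)" and ode: "x * D + s * gser s x = exp x"
    using gser_ode[OF s] by metis
  have "(igam s has_field_derivative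
          (exp (s * y) * s * gser s x + exp (s * y) * (D * (- exp y)))) (at y)"
    unfolding igam_def using D
    by (auto intro!: derivative_eq_intros DERIV_chain2[of "gser s"] simp: x_def algebra_simps)
  also have "exp (s * y) * s * gser s x + exp (s * y) * (D * (- exp y)) = exp (s * y) * (x * D + s * gser s x)"
    by (simp add: x_def algebra_simps)
  also have "\<dots> = exp (s * y - exp y)" by (simp only: ode) (simp add: x_def exp_diff exp_minus divide_inverse)
  finally show ?thesis by (rule has_field_derivative_at_within)
qed

text \<open>This is the classical integration by parts, obtained from the same cancellation of
  \<open>s + n\<close>. It carries the limit at infinity from \<open>Re s > 0\<close> to the other
  orders.\<close>

lemma igam_plus1:
  assumes s: "s \<notin> \<int>\<^sub>\<le>\<^sub>0"
  shows "igam (s + 1) y = s * igam s y - exp (s * y - exp y)"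
proof -
  define x where "x = - exp y"
  have s1: "s + 1 \<notin> \<int>\<^sub>\<le>\<^sub>0" using s plus_one_in_nonpos_Ints_imp by blast
  have ne: "s + of_nat n \<noteq> 0" for n
    using s by (metis add_eq_0_iff2 minus_of_nat_in_nonpos_Ints)
  let ?t = "\<lambda>j. x ^ j / (fact j * (s + of_nat j))"
  have 1: "(\<lambda>j. of_nat j * ?t j) sums (x * (\<Sum>j. x ^ j / (fact j * (s + 1 + of_nat j))))"
  proof -
    have "(\<lambda>j. x * (x ^ j / (fact j * (s + 1 + of_nat j)))) sums
            (x * (\<Sum>j. x ^ j / (fact j * (s + 1 + of_nat j))))"
      by (intro sums_mult summable_sums igam_term_summable s1)
    also have "(\<lambda>j. x * (x ^ j / (fact j * (s + 1 + of_nat j)))) = (\<lambda>j. of_nat (Suc j) * ?t (Suc j))"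
    proof
      fix j
      have "of_nat (Suc j) \<noteq> (0 :: complex)" by (rule of_nat_neq_0)
      then show "x * (x ^ j / (fact j * (s + 1 + of_nat j))) = of_nat (Suc j) * ?t (Suc j)"
        by (simp del: of_nat_Suc add: fact_Suc of_nat_Suc[symmetric] add.assoc)
    qed
    finally show ?thesis
      using sums_Suc[of "\<lambda>j. of_nat j * ?t j"] by simp
  qed
  have 2: "(\<lambda>j. s * ?t j) sums (s * (\<Sum>j. ?t j))"
    by (intro sums_mult summable_sums igam_term_summable s)
  have "of_nat n * ?t n + s * ?t n = x ^ n /\<^sub>R fact n" for n
    using ne[of n] by (simp add: scaleR_conv_of_real divide_simps) (simp add: algebra_simps)
  with sums_add[OF 1 2] have
    "(\<lambda>n. x ^ n /\<^sub>R fact n) sums (x * (\<Sum>j. x ^ j / (fact j * (s + 1 + of_nat j))) + s * (\<Sum>j. ?t j))"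
    by simp
  then have e: "x * (\<Sum>j. x ^ j / (fact j * (s + 1 + of_nat j))) + s * (\<Sum>j. ?t j) = exp x"
    using exp_converges[of x] sums_unique2 by blast
  have "s * igam s y - igam (s + 1) y
      = exp (s * y) * (x * (\<Sum>j. x ^ j / (fact j * (s + 1 + of_nat j))) + s * (\<Sum>j. ?t j))"
    unfolding igam_def gser_def x_def[symmetric] by (simp add: x_def distrib_right exp_add algebra_simps)
  also have "\<dots> = exp (s * y - exp y)" by (simp only: e) (simp add: x_def exp_diff exp_minus divide_inverse)
  finally show ?thesis by (simp add: algebra_simps)
qed

text \<open>A mean value inequality with a real majorant: an integral along a segment is estimated
  by exhibiting a function \<phi> whose derivative dominates the integrand. The estimates along rays
  below have this form.\<close>

lemma norm_diff_le_of_deriv_bound: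
  fixes F f :: "complex \<Rightarrow> complex" and \<phi> \<phi>' :: "real \<Rightarrow> real"
  assumes "a \<le> b"
    and F: "\<And>t. t \<in> {a..b} \<Longrightarrow>
      (F has_field_derivative f (p + of_real t * v)) (at (p + of_real t * v))"
    and \<phi>: "\<And>t. t \<in> {a..b} \<Longrightarrow> (\<phi> has_real_derivative \<phi>' t) (at t)"
    and le: "\<And>t. t \<in> {a..b} \<Longrightarrow> norm (f (p + of_real t * v) * v) \<le> \<phi>' t"
  shows "norm (F (p + of_real b * v) - F (p + of_real a * v)) \<le> \<phi> b - \<phi> a"
proof (cases "a = b")
  case False
  define g where "g = (\<lambda>t::real. F (p + of_real t * v))"
  have g: "(g has_vector_derivative f (p + of_real t * v) * v) (at t)" if "t \<in> {a..b}" for t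
  proof -
    have "((\<lambda>t. p + of_real t * v) has_vector_derivative v) (at t)"
      by (auto intro!: derivative_eq_intros simp: scaleR_conv_of_real)
    from field_vector_diff_chain_at[OF this F[OF that]] show ?thesis
      by (simp add: g_def o_def mult.commute)
  qed
  have \<phi>v: "(\<phi> has_vector_derivative \<phi>' t) (at t)" if "t \<in> {a..b}" for t
    using \<phi>[OF that] by (simp add: has_real_derivative_iff_has_vector_derivative)
  have "norm (g b - g a) \<le> \<phi> b - \<phi> a"
  proof (rule differentiable_bound_general[where
        f' = "\<lambda>t. f (p + of_real t * v) * v" and \<phi>' = \<phi>'])
    show "a < b" using False assms(1) by simp
    show "continuous_on {a..b} g" "continuous_on {a..b} \<phi>"
      by (auto intro!: continuous_at_imp_continuous_on
               intro: has_vector_derivative_continuous g \<phi>v)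
  qed (use g \<phi>v le in auto)
  then show ?thesis by (simp add: g_def)
qed simp

text \<open>For \<open>x > 0\<close>, \<open>igam s (ln x)\<close> is the primitive of Euler's
  integrand that vanishes at 0, which is where \<open>Re s > 0\<close> enters; its limit is
  therefore Euler's integral.\<close>

lemma igam_tendsto_Gamma_pos:
  assumes s: "Re s > 0"
  shows "((\<lambda>x::real. igam s (of_real x)) \<longlongrightarrow> Gamma s) at_top"
proof -
  have s': "s \<notin> \<int>\<^sub>\<le>\<^sub>0" using s by (auto elim!: nonpos_Ints_cases)
  obtain d where d: "d > 0" "\<And>j. d \<le> norm (s + of_nat j)"
    using nonpos_Ints_separated[OF s'] by blast
  define f where "f = (\<lambda>t. complex_of_real t powr (s - 1) / of_real (exp t))"
  define F where "F = (\<lambda>x::real. if x = 0 then 0 else igam s (of_real (ln x)))"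
  have F': "(F has_vector_derivative f x) (at x)" if "x > 0" for x
  proof -
    have 1: "((\<lambda>x. complex_of_real (ln x)) has_vector_derivative of_real (inverse x)) (at x)"
      using that by (intro has_vector_derivative_of_real) (auto intro!: derivative_eq_intros simp: divide_inverse)
    have "((igam s \<circ> (\<lambda>x. complex_of_real (ln x))) has_vector_derivative
            of_real (inverse x) * exp (s * of_real (ln x) - exp (of_real (ln x)))) (at x)"
      by (rule field_vector_diff_chain_at[OF 1 igam_has_field_derivative[OF s']])
    also have "of_real (inverse x) * exp (s * of_real (ln x) - exp (of_real (ln x))) = f x"
      using that by (simp add: f_def powr_def Ln_of_real exp_of_real[symmetric] exp_diff ring_distribs)
        (simp add: exp_of_real divide_inverse mult_ac)
    finally show ?thesis
    proof (rule has_vector_derivative_transform_within_open[of _ _ _ "{0<..}"])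
      fix y :: real assume "y \<in> {0<..}"
      then show "(igam s \<circ> (\<lambda>x. complex_of_real (ln x))) y = F y" by (simp add: F_def)
    qed (use that in auto)
  qed
  have F0: "(F \<longlongrightarrow> 0) (at_right 0)"
  proof (rule Lim_null_comparison)
    show "\<forall>\<^sub>F x in at_right 0. norm (F x) \<le> x powr Re s * (exp x / d)"
      using eventually_at_right_less[of 0]
    proof eventually_elim
      case (elim x)
      have "norm (F x) = exp (Re s * ln x) * norm (\<Sum>j. (- of_real x) ^ j / (fact j * (s + of_nat j)))"
        using elim by (simp add: F_def igam_def gser_def norm_mult exp_of_real)
      also have "norm (\<Sum>j. (- of_real x) ^ j / (fact j * (s + of_nat j))) \<le> exp (norm (- complex_of_real x)) / d"
        by (rule igam_term_bounds(2)[OF d])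
      finally show ?case using elim by (simp add: powr_def mult_left_mono)
    qed
    have "((\<lambda>x. x powr a) \<longlongrightarrow> 0) (at_right 0)" if "a > 0" for a :: real
      using that by real_asymp
    from this[OF s] have "((\<lambda>x. x powr Re s * (exp x / d)) \<longlongrightarrow> 0 * (exp 0 / d)) (at_right 0)"
      using d(1) by (intro tendsto_intros) auto
    then show "((\<lambda>x. x powr Re s * (exp x / d)) \<longlongrightarrow> 0) (at_right 0)" by simp
  qed
  have I: "(f has_integral F b) {0..b}" if b: "b > 0" for b
  proof -
    have "continuous_on {0..b} F"
      unfolding continuous_on_eq_continuous_within
    proof
      fix x assume x: "x \<in> {0..b}"
      show "continuous (at x within {0..b}) F"
      proof (cases "x = 0")
        case True
        have "at 0 within {0..b} = at_right 0" using b by (rule at_within_Icc_at_right)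
        with True F0 show ?thesis by (simp add: continuous_within F_def)
      next
        case False
        with x F'[of x] show ?thesis
          by (auto intro: has_vector_derivative_continuous continuous_at_imp_continuous_at_within)
      qed
    qed
    then have "(f has_integral (F b - F 0)) {0..b}"
      by (intro fundamental_theorem_of_calculus_interior) (use b F' in auto)
    then show ?thesis by (simp add: F_def)
  qed
  have f_abs: "f absolutely_integrable_on {0..}"
  proof -
    have "f absolutely_integrable_on {0<..}"
      unfolding f_def by (rule absolutely_integrable_Gamma_integral'[OF s])
    then show ?thesis
      by (rule absolutely_integrable_spike_set) (auto intro: negligible_subset[of "{0}"])
  qed
  have "((\<lambda>b. set_lebesgue_integral lebesgue {0..b} f) \<longlongrightarrow> set_lebesgue_integral lebesgue {0..} f) at_top"
    by (rule tendsto_set_lebesgue_integral_at_top) (use f_abs in auto)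
  also have "set_lebesgue_integral lebesgue {0..} f = Gamma s"
    using set_lebesgue_integral_eq_integral(2)[OF f_abs] Gamma_integral_complex[OF s]
    by (simp add: f_def integral_unique)
  finally have "(F \<longlongrightarrow> Gamma s) at_top"
  proof (rule Lim_transform_eventually)
    show "\<forall>\<^sub>F b in at_top. set_lebesgue_integral lebesgue {0..b} f = F b"
      using eventually_gt_at_top[of 0]
    proof eventually_elim
      case (elim b)
      have "set_integrable lebesgue {0..b} f"
        by (rule set_integrable_subset[OF f_abs]) auto
      from set_lebesgue_integral_eq_integral(2)[OF this] I[OF elim] show ?case
        by (simp add: integral_unique)
    qed
  qed
  from filterlim_compose[OF this exp_at_top] show ?thesis by (simp add: F_def)
qed

text \<open>Induction on the number of unit shifts that bring \<open>s\<close> into the right half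
  plane: \<open>Gamma\<close> obeys the recurrence of \<open>igam\<close>, whose boundary term dies
  out.\<close>

lemma igam_tendsto_Gamma:
  assumes s: "s \<notin> \<int>\<^sub>\<le>\<^sub>0"
  shows "((\<lambda>x::real. igam s (of_real x)) \<longlongrightarrow> Gamma s) at_top"
proof -
  obtain n :: nat where "- Re s < n" using reals_Archimedean2 by blast
  then have "Re s + n > 0" by simp
  then show ?thesis using s
  proof (induction n arbitrary: s)
    case 0
    then show ?case using igam_tendsto_Gamma_pos by simp
  next
    case (Suc n)
    have s: "s \<notin> \<int>\<^sub>\<le>\<^sub>0" "s \<noteq> 0" using Suc.prems(2) by auto
    have s1: "s + 1 \<notin> \<int>\<^sub>\<le>\<^sub>0" using s(1) plus_one_in_nonpos_Ints_imp by blast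
    have lim1: "((\<lambda>x::real. igam (s + 1) (of_real x)) \<longlongrightarrow> Gamma (s + 1)) at_top"
      using Suc.prems(1) s1 by (intro Suc.IH) auto
    have lim2: "((\<lambda>x::real. exp (s * of_real x - exp (of_real x))) \<longlongrightarrow> 0) at_top"
    proof (rule Lim_null_comparison)
      show "\<forall>\<^sub>F x in at_top. norm (exp (s * of_real x - exp (of_real x))) \<le> exp (Re s * x - exp x)"
        by (simp add: exp_of_real)
      show "((\<lambda>x. exp (Re s * x - exp x)) \<longlongrightarrow> 0) at_top" by real_asymp
    qed
    have "((\<lambda>x::real. (igam (s + 1) (of_real x) + exp (s * of_real x - exp (of_real x))) / s)
             \<longlongrightarrow> (Gamma (s + 1) + 0) / s) at_top"
      by (intro tendsto_intros lim1 lim2 s)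
    then show ?case using s by (simp add: igam_plus1[OF s(1)] Gamma_plus1[OF s(1)])
  qed
qed

text \<open>The limit is reached superexponentially fast; comparing the exponent with a parabola, by
  \<open>exp x \<ge> x\<^sup>2 / 2\<close>, gives a constant that is uniform in \<open>s\<close>.\<close>

lemma norm_igam_integrand_le:
  assumes "Re s \<le> \<sigma>" "\<bar>Im s\<bar> \<le> \<tau>" "0 \<le> Re y" "\<bar>Im y\<bar> \<le> \<psi>" "\<psi> < pi / 2"
  shows "norm (exp (s * y - exp y)) \<le> exp ((\<sigma> + M)\<^sup>2 / (2 * cos \<psi>) + \<tau> * \<psi>) * exp (- M * Re y)"
proof -
  define x c where "x = Re y" "c = cos \<psi>"
  have c: "c > 0" using assms unfolding x_c_def by (intro cos_gt_zero_pi) auto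
  have "Re s * x \<le> \<sigma> * x" using assms by (intro mult_right_mono) (auto simp: x_c_def)
  moreover have "- Im s * Im y \<le> \<tau> * \<psi>"
  proof -
    have "- Im s * Im y \<le> \<bar>Im s\<bar> * \<bar>Im y\<bar>" by (metis abs_ge_self abs_minus_cancel abs_mult)
    also have "\<dots> \<le> \<tau> * \<psi>" using assms by (intro mult_mono) auto
    finally show ?thesis .
  qed
  moreover have "exp x * cos (Im y) \<ge> x\<^sup>2 / 2 * c"
  proof (rule mult_mono)
    have "x\<^sup>2 / 2 \<le> 1 + x + x\<^sup>2 / 2" using assms by (simp add: x_c_def)
    also have "\<dots> \<le> exp x" using assms by (intro exp_lower_Taylor_quadratic) (simp add: x_c_def)
    finally show "x\<^sup>2 / 2 \<le> exp x" .
    have "cos \<psi> \<le> cos \<bar>Im y\<bar>" using assms by (intro cos_monotone_0_pi_le) auto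
    then show "c \<le> cos (Im y)" by (simp add: x_c_def)
  qed (use c in auto)
  moreover have "(\<sigma> + M) * x - x\<^sup>2 / 2 * c \<le> (\<sigma> + M)\<^sup>2 / (2 * c)"
  proof -
    have "0 \<le> (\<sigma> + M - c * x)\<^sup>2 / (2 * c)" using c by simp
    also have "(\<sigma> + M - c * x)\<^sup>2 / (2 * c) = (\<sigma> + M)\<^sup>2 / (2 * c) - (\<sigma> + M) * x + x\<^sup>2 / 2 * c"
      using c by (simp add: field_simps power2_eq_square)
    finally show ?thesis by simp
  qed
  ultimately have "Re (s * y - exp y) \<le> (\<sigma> + M)\<^sup>2 / (2 * c) + \<tau> * \<psi> - M * x"
    by (simp add: x_c_def Re_exp algebra_simps)
  then show ?thesis by (simp add: x_c_def exp_add[symmetric] algebra_simps)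
qed

text \<open>The constant depends on \<open>s\<close> only through bounds for \<open>Re s\<close> and
  \<open>\<bar>Im s\<bar>\<close>, because the primitive of the kernel needs it for all orders
  \<open>\<nu> - of_nat k\<close> at once.\<close>

lemma igam_minus_Gamma_bound:
  assumes \<psi>: "0 \<le> \<psi>" "\<psi> < pi / 2" and M: "M > 0"
  obtains C where "C \<ge> 0" and "\<And>s y. s \<notin> \<int>\<^sub>\<le>\<^sub>0 \<Longrightarrow> Re s \<le> \<sigma> \<Longrightarrow> \<bar>Im s\<bar> \<le> \<tau> \<Longrightarrow> 0 \<le> Re y \<Longrightarrow>
    \<bar>Im y\<bar> \<le> \<psi> \<Longrightarrow> norm (igam s y - Gamma s) \<le> C * exp (- M * Re y)"
proof -
  define K where "K = exp ((\<sigma> + M)\<^sup>2 / (2 * cos \<psi>) + \<tau> * \<psi>)"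
  have K: "K > 0" by (simp add: K_def)
  show ?thesis
  proof
    show "K / M \<ge> 0" using K M by simp
    fix s y :: complex
    assume s: "s \<notin> \<int>\<^sub>\<le>\<^sub>0" "Re s \<le> \<sigma>" "\<bar>Im s\<bar> \<le> \<tau>" and y: "0 \<le> Re y" "\<bar>Im y\<bar> \<le> \<psi>"
    have le: "norm (exp (s * t - exp t)) \<le> K * exp (- M * Re t)" if "0 \<le> Re t" "\<bar>Im t\<bar> \<le> \<psi>" for t
      unfolding K_def using norm_igam_integrand_le[OF s(2,3) that \<psi>(2)] .
    have bound: "norm (igam s y - igam s (of_real (Re y + X)))
        \<le> K / M * exp (- M * Re y) + K * \<psi> * exp (- M * (Re y + X))" if X: "X \<ge> 0" for X
    proof -
      have "norm (igam s (y + of_real X * 1) - igam s (y + of_real 0 * 1))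
          \<le> - (K / M) * exp (- M * (Re y + X)) - (- (K / M) * exp (- M * (Re y + 0)))"
      proof (rule norm_diff_le_of_deriv_bound[where
            f = "\<lambda>t. exp (s * t - exp t)" and \<phi>' = "\<lambda>x. K * exp (- M * (Re y + x))"])
        fix t assume t: "t \<in> {0..X}"
        show "norm (exp (s * (y + of_real t * 1) - exp (y + of_real t * 1)) * 1) \<le> K * exp (- M * (Re y + t))"
          using le[of "y + of_real t"] y t by simp
      qed (use X M s in \<open>auto intro!: igam_has_field_derivative derivative_eq_intros\<close>)
      also have "\<dots> \<le> K / M * exp (- M * Re y)" using K M by simp
      finally have 1: "norm (igam s (y + of_real X) - igam s y) \<le> K / M * exp (- M * Re y)" by simp
      \<comment> \<open>A vertical link from \<open>y + X\<close> reaches the real point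
        \<open>q\<close>, where the limit of \<open>igam\<close> is known; the link disappears as
        \<open>X\<close> tends to infinity.\<close>
      define q where "q = complex_of_real (Re y + X)"
      have "norm (igam s (q + of_real 1 * (\<i> * Im y)) - igam s (q + of_real 0 * (\<i> * Im y)))
          \<le> 1 * (K * exp (- M * (Re y + X)) * \<psi>) - 0 * (K * exp (- M * (Re y + X)) * \<psi>)"
      proof (rule norm_diff_le_of_deriv_bound[where f = "\<lambda>t. exp (s * t - exp t)"
              and \<phi>' = "\<lambda>x. K * exp (- M * (Re y + X)) * \<psi>"])
        fix t :: real assume t: "t \<in> {0..1}"
        have "\<bar>t * Im y\<bar> \<le> \<psi>"
          using t y by (simp add: abs_mult) (meson abs_ge_zero mult_left_le_one_le order_trans)
        then have "norm (exp (s * (q + of_real t * (\<i> * Im y)) - exp (q + of_real t * (\<i> * Im y))))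
            \<le> K * exp (- M * (Re y + X))"
          using le[of "q + of_real t * (\<i> * Im y)"] y X by (simp add: q_def)
        then show "norm (exp (s * (q + of_real t * (\<i> * Im y)) - exp (q + of_real t * (\<i> * Im y))) * (\<i> * Im y))
            \<le> K * exp (- M * (Re y + X)) * \<psi>"
          using y K unfolding norm_mult by (intro mult_mono) auto
      qed (use s in \<open>auto intro!: igam_has_field_derivative derivative_eq_intros\<close>)
      moreover have "q + of_real 1 * (\<i> * Im y) = y + of_real X"
        by (simp add: q_def complex_eq_iff)
      ultimately have "norm (igam s (y + of_real X) - igam s q) \<le> K * \<psi> * exp (- M * (Re y + X))"
        by (simp add: mult_ac)
      with 1 dist_triangle3[of "igam s y" "igam s q" "igam s (y + of_real X)"] show ?thesis
        by (simp add: q_def dist_norm)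
    qed
    show "norm (igam s y - Gamma s) \<le> K / M * exp (- M * Re y)"
    proof (rule tendsto_le)
      show "((\<lambda>X. norm (igam s y - igam s (of_real (Re y + X)))) \<longlongrightarrow> norm (igam s y - Gamma s)) at_top"
        by (intro tendsto_intros filterlim_compose[OF igam_tendsto_Gamma[OF s(1)]]
              filterlim_tendsto_add_at_top[OF tendsto_const] filterlim_ident)
      have "((\<lambda>X. exp (- M * (Re y + X))) \<longlongrightarrow> 0) at_top" using M by real_asymp
      from tendsto_add[OF tendsto_const tendsto_mult[OF tendsto_const this]]
      show "((\<lambda>X. K / M * exp (- M * Re y) + K * \<psi> * exp (- M * (Re y + X)))
              \<longlongrightarrow> K / M * exp (- M * Re y)) at_top" by fastforce
      show "\<forall>\<^sub>F X in at_top. norm (igam s y - igam s (of_real (Re y + X)))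
          \<le> K / M * exp (- M * Re y) + K * \<psi> * exp (- M * (Re y + X))"
        using eventually_ge_at_top[of 0] by eventually_elim (rule bound)
    qed simp
  qed
qed

section \<open>Arms of the Schlaefli contour\<close>

text \<open>\<open>arm \<alpha> f\<close> is the integral of the entire function \<open>f\<close> from \<open>0\<close> to \<open>- \<infinity> + \<i> \<alpha>\<close>. Taking the limit of a
  primitive makes the choice of path immaterial.\<close>

definition bker :: "complex \<Rightarrow> complex \<Rightarrow> complex \<Rightarrow> complex" where
  "bker \<nu> w t = exp (exp w * sinh t - \<nu> * t)"

definition prim :: "(complex \<Rightarrow> complex) \<Rightarrow> complex \<Rightarrow> complex" where
  "prim f t = contour_integral (linepath 0 t) f"

definition arm :: "real \<Rightarrow> (complex \<Rightarrow> complex) \<Rightarrow> complex" where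
  "arm \<alpha> f = lim (\<lambda>n. prim f (Complex (- real n) \<alpha>))"

lemma prim_eq:
  assumes "\<And>t. (F has_field_derivative f t) (at t)"
  shows "prim f t = F t - F 0"
  using contour_integral_primitive[of UNIV F f "linepath 0 t"] assms
  by (auto simp: prim_def intro: contour_integral_unique has_field_derivative_at_within)

lemma prim_0 [simp]: "prim f 0 = 0"
  by (simp add: prim_def)

lemma has_field_derivative_prim:
  assumes "f holomorphic_on UNIV"
  shows "(prim f has_field_derivative f t) (at t within A)"
proof -
  obtain F where F: "\<And>t. (F has_field_derivative f t) (at t)"
    using holomorphic_convex_primitive'[OF convex_UNIV open_UNIV assms] by auto
  have "prim f = (\<lambda>t. F t - F 0)" using prim_eq[OF F] by auto
  then have "(prim f has_field_derivative f t) (at t)" by (auto intro!: derivative_eq_intros F)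
  then show ?thesis by (rule has_field_derivative_at_within)
qed

lemma bker_holomorphic [holomorphic_intros]: "bker \<nu> w holomorphic_on A"
proof -
  have "(\<lambda>t. exp (exp w * ((exp t - exp (- t)) / 2) - \<nu> * t)) holomorphic_on A"
    by (intro holomorphic_intros) auto
  then show ?thesis by (simp add: bker_def[abs_def] sinh_field_def)
qed

text \<open>Exponential decay makes the primitive Cauchy along the horizontal ray; the second claim
  is the integral of the tail beyond \<open>a\<close>.\<close>

lemma arm_bound:
  assumes f: "f holomorphic_on UNIV" and c: "c > 0"
    and le: "\<And>x. x \<ge> a \<Longrightarrow> norm (f (Complex (- x) \<alpha>)) \<le> M * exp (- c * x)"
  shows "(\<lambda>n. prim f (Complex (- real n) \<alpha>)) \<longlonglongrightarrow> arm \<alpha> f" (is ?A)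
    and "norm (arm \<alpha> f - prim f (Complex (- a) \<alpha>)) \<le> M / c * exp (- c * a)" (is ?B)
proof -
  define X where "X = (\<lambda>x. prim f (Complex (- x) \<alpha>))"
  have X: "norm (X v - X u) \<le> M / c * exp (- c * u)" if "a \<le> u" "u \<le> v" for u v
  proof -
    have eq: "Complex 0 \<alpha> + of_real t * (-1) = Complex (- t) \<alpha>" for t by (simp add: complex_eq_iff)
    have M: "M \<ge> 0"
      using order_trans[OF norm_ge_zero le[of a]] by (simp add: zero_le_mult_iff)
    have "norm (prim f (Complex 0 \<alpha> + of_real v * (-1)) - prim f (Complex 0 \<alpha> + of_real u * (-1)))
        \<le> - (M / c) * exp (- c * v) - (- (M / c) * exp (- c * u))"
    proof (rule norm_diff_le_of_deriv_bound[where f = f and \<phi>' = "\<lambda>x. M * exp (- c * x)"])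
      fix t assume "t \<in> {u..v}"
      then show "norm (f (Complex 0 \<alpha> + of_real t * (-1)) * (-1)) \<le> M * exp (- c * t)"
        unfolding eq using le[of t] that by simp
    qed (use that c in \<open>auto intro!: has_field_derivative_prim f derivative_eq_intros\<close>)
    also have "\<dots> \<le> M / c * exp (- c * u)" using M c by simp
    finally show ?thesis unfolding eq by (simp add: X_def)
  qed
  have "(\<lambda>n. exp (- c * real n)) \<longlonglongrightarrow> 0" using c by real_asymp
  from tendsto_mult[OF tendsto_const this, of "M / c"]
  have lim0: "(\<lambda>n. M / c * exp (- c * real n)) \<longlonglongrightarrow> 0" by simp
  have "Cauchy (\<lambda>n. X (real n))"
  proof (rule CauchyI)
    fix e :: real assume "e > 0"
    then have "\<forall>\<^sub>F n in sequentially. M / c * exp (- c * real n) < e / 2"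
      by (intro order_tendstoD(2)[OF lim0]) simp
    moreover have "\<forall>\<^sub>F n in sequentially. a \<le> real n"
      using eventually_ge_at_top[of "nat \<lceil>a\<rceil>"]
      by eventually_elim (auto simp: nat_le_iff ceiling_le_iff)
    ultimately have "\<forall>\<^sub>F n in sequentially. M / c * exp (- c * real n) < e / 2 \<and> a \<le> real n"
      by eventually_elim simp
    then obtain N where N: "M / c * exp (- c * real N) < e / 2" "a \<le> real N"
      by (auto simp: eventually_sequentially)
    show "\<exists>N. \<forall>m\<ge>N. \<forall>n\<ge>N. norm (X (real m) - X (real n)) < e"
    proof (intro exI allI impI)
      fix m n assume "m \<ge> N" "n \<ge> N"
      then have "norm (X (real m) - X (real N)) < e / 2" "norm (X (real n) - X (real N)) < e / 2"
        using order.strict_trans1[OF X N(1)] N(2) by auto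
      then show "norm (X (real m) - X (real n)) < e"
        using norm_diff_triangle_less[of "X (real m)" "X (real N)" "e / 2" "X (real n)" "e / 2"]
        by (simp add: norm_minus_commute)
    qed
  qed
  then have "convergent (\<lambda>n. X (real n))" by (rule Cauchy_convergent)
  then show A: ?A unfolding arm_def X_def by (simp add: convergent_LIMSEQ_iff)
  show ?B
  proof (rule tendsto_upperbound)
    show "(\<lambda>n. norm (prim f (Complex (- real n) \<alpha>) - prim f (Complex (- a) \<alpha>)))
        \<longlonglongrightarrow> norm (arm \<alpha> f - prim f (Complex (- a) \<alpha>))"
      by (intro tendsto_intros A)
    show "\<forall>\<^sub>F n in sequentially. norm (prim f (Complex (- real n) \<alpha>) - prim f (Complex (- a) \<alpha>))
        \<le> M / c * exp (- c * a)"
      using eventually_ge_at_top[of "nat \<lceil>a\<rceil>"] 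
    proof eventually_elim
      case (elim n)
      then have "a \<le> real n" by (auto simp: nat_le_iff ceiling_le_iff)
      then show ?case using X[of a "real n"] by (simp add: X_def)
    qed
  qed simp
qed

lemma sinh_times_exp: "exp w * sinh t = (exp (w + t) - exp (w - t)) / 2" for w t :: complex
  by (simp add: sinh_field_def right_diff_distrib mult_exp_exp)

text \<open>At heights within a quarter turn of arg z, \<open>Re (exp (w - t))\<close> grows like
  \<open>exp x\<close> and beats every linear term; its quadratic minorant is enough. The factor
  with \<open>V\<close> reserves room for a perturbation of the order.\<close>

lemma norm_bker_strip_le:
  assumes "\<bar>y - Im w\<bar> \<le> \<psi>" "\<psi> < pi / 2" "0 \<le> x" "\<bar>y\<bar> \<le> Y" "norm \<nu> + V \<le> U" "0 \<le> V"
  shows "norm (bker \<nu> w (Complex (- x) y)) * exp (V * (x + \<bar>y\<bar>))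
    \<le> exp (exp (Re w) + U * Y + (U + 1)\<^sup>2 / (exp (Re w) * cos \<psi>)) * exp (- x)"
proof -
  define r c t where "r = exp (Re w)" "c = cos \<psi>" "t = Complex (- x) y"
  have c: "c > 0" using assms unfolding r_c_t_def by (intro cos_gt_zero_pi) auto
  have r: "r > 0" by (simp add: r_c_t_def)
  have "Re (exp (w + t)) \<le> r"
  proof -
    have "Re (exp (w + t)) \<le> exp (Re w - x)" by (simp add: Re_exp r_c_t_def)
    also have "\<dots> \<le> r" using assms by (simp add: r_c_t_def)
    finally show ?thesis .
  qed
  moreover have "r * (x\<^sup>2 / 2) * c \<le> Re (exp (w - t))"
  proof -
    have "cos \<psi> \<le> cos \<bar>y - Im w\<bar>" using assms by (intro cos_monotone_0_pi_le) auto
    then have "c \<le> cos (Im w - y)" by (simp add: r_c_t_def cos_diff mult.commute)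
    moreover have "x\<^sup>2 / 2 \<le> exp x"
      using exp_lower_Taylor_quadratic[of x] assms by simp
    ultimately have "(r * (x\<^sup>2 / 2)) * c \<le> (r * exp x) * cos (Im w - y)"
      using r c by (intro mult_mono) auto
    then show ?thesis by (simp add: Re_exp r_c_t_def exp_add)
  qed
  moreover have "Re (- \<nu> * t) + V * (x + \<bar>y\<bar>) \<le> U * (x + Y)"
  proof -
    have "Re (- \<nu> * t) \<le> norm \<nu> * norm t" by (metis complex_Re_le_cmod norm_minus_cancel norm_mult)
    also have "norm t \<le> x + \<bar>y\<bar>" using cmod_le[of t] assms by (simp add: r_c_t_def)
    finally have "Re (- \<nu> * t) + V * (x + \<bar>y\<bar>) \<le> (norm \<nu> + V) * (x + \<bar>y\<bar>)"
      by (simp add: mult_left_mono distrib_right)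
    also have "\<dots> \<le> U * (x + Y)" using assms by (intro mult_mono) (auto intro: order_trans[OF _ assms(5)])
    finally show ?thesis .
  qed
  \<comment> \<open>Completing the square. The \<open>1\<close> in \<open>U + 1\<close> is what
    remains as the decay \<open>exp (- x)\<close>.\<close>
  moreover have "(U + 1) * x \<le> (U + 1)\<^sup>2 / (r * c) + r * (x\<^sup>2 / 2) * c / 2"
  proof -
    have "0 \<le> (U + 1 - r * c * x / 2)\<^sup>2 / (r * c)" using c r by simp
    also have "\<dots> = (U + 1)\<^sup>2 / (r * c) - (U + 1) * x + r * (x\<^sup>2 / 2) * c / 2"
      using c r by (simp add: field_simps power2_eq_square)
    finally show ?thesis by simp
  qed
  ultimately have le: "Re (exp (w + t)) \<le> r" "r * (x\<^sup>2 / 2) * c \<le> Re (exp (w - t))"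
      "Re (- \<nu> * t) + V * (x + \<bar>y\<bar>) \<le> U * (x + Y)"
      "(U + 1) * x \<le> (U + 1)\<^sup>2 / (r * c) + r * (x\<^sup>2 / 2) * c / 2"
    by blast+
  have "Re (exp w * sinh t - \<nu> * t) + V * (x + \<bar>y\<bar>) \<le> r + U * Y + (U + 1)\<^sup>2 / (r * c) - x"
  proof -
    have "Re (exp w * sinh t - \<nu> * t) = Re (exp (w + t)) / 2 - Re (exp (w - t)) / 2 + Re (- \<nu> * t)"
      by (simp add: sinh_times_exp diff_divide_distrib)
    moreover have "Re (- \<nu> * t) + V * (x + \<bar>y\<bar>) \<le> U * x + U * Y"
        "U * x + x \<le> (U + 1)\<^sup>2 / (r * c) + r * (x\<^sup>2 / 2) * c / 2"
      using le(3,4) by (simp_all only: distrib_left distrib_right mult_1)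
    moreover have "E = A / 2 - B / 2 + R \<Longrightarrow> R + S \<le> UX + UY \<Longrightarrow> UX + x \<le> Q + p / 2 \<Longrightarrow>
        A \<le> r \<Longrightarrow> p \<le> B \<Longrightarrow> 0 < r \<Longrightarrow> E + S \<le> r + UY + Q - x" for E A B R S Q UX UY p :: real
      by linarith
    ultimately show ?thesis using le(1,2) r by blast
  qed
  then show ?thesis
    by (simp add: bker_def r_c_t_def exp_add[symmetric])
qed

lemma norm_bker_strip_le':
  assumes "\<bar>y - Im w\<bar> \<le> \<psi>" "\<psi> < pi / 2" "0 \<le> x" "\<bar>y\<bar> \<le> Y"
  shows "norm (bker \<nu> w (Complex (- x) y))
    \<le> exp (exp (Re w) + norm \<nu> * Y + (norm \<nu> + 1)\<^sup>2 / (exp (Re w) * cos \<psi>)) * exp (- x)"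
  using norm_bker_strip_le[OF assms, of \<nu> 0 "norm \<nu>"] by simp

lemma arm_bker_tendsto:
  assumes "\<bar>\<alpha> - Im w\<bar> < pi / 2"
  shows "(\<lambda>n. prim (bker \<nu> w) (Complex (- real n) \<alpha>)) \<longlonglongrightarrow> arm \<alpha> (bker \<nu> w)"
proof (rule arm_bound(1))
  fix x :: real assume "x \<ge> 0"
  then show "norm (bker \<nu> w (Complex (- x) \<alpha>))
      \<le> exp (exp (Re w) + norm \<nu> * \<bar>\<alpha>\<bar> + (norm \<nu> + 1)\<^sup>2 / (exp (Re w) * cos \<bar>\<alpha> - Im w\<bar>)) * exp (- 1 * x)"
    using norm_bker_strip_le'[OF order_refl assms, of x "\<bar>\<alpha>\<bar>" \<nu>] by simp
qed (auto intro: bker_holomorphic)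

text \<open>The vertical link between the two rays stays in the strip of decay and vanishes at
  infinity. This frees the height of the ray, which the descent paths choose to suit
  themselves.\<close>

lemma arm_bker_eq:
  assumes \<alpha>: "\<bar>\<alpha> - Im w\<bar> < pi / 2"
  shows "arm \<alpha> (bker \<nu> w) = arm (Im w) (bker \<nu> w)"
proof -
  define M where "M = exp (exp (Re w) + norm \<nu> * (\<bar>\<alpha>\<bar> + \<bar>Im w\<bar>)
      + (norm \<nu> + 1)\<^sup>2 / (exp (Re w) * cos \<bar>\<alpha> - Im w\<bar>))"
  let ?P = "prim (bker \<nu> w)"
  have le: "norm (?P (Complex (- x) \<alpha>) - ?P (Complex (- x) (Im w))) \<le> M * exp (- x) * \<bar>\<alpha> - Im w\<bar>"
    if x: "x \<ge> 0" for x
  proof -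
    have eq: "Complex (- x) (Im w) + of_real t * (\<i> * of_real (\<alpha> - Im w))
        = Complex (- x) (Im w + t * (\<alpha> - Im w))" for t by (simp add: complex_eq_iff)
    have "norm (?P (Complex (- x) (Im w) + of_real 1 * (\<i> * of_real (\<alpha> - Im w))) -
          ?P (Complex (- x) (Im w) + of_real 0 * (\<i> * of_real (\<alpha> - Im w))))
        \<le> 1 * (M * exp (- x) * \<bar>\<alpha> - Im w\<bar>) - 0 * (M * exp (- x) * \<bar>\<alpha> - Im w\<bar>)"
    proof (rule norm_diff_le_of_deriv_bound[where f = "bker \<nu> w" and
            \<phi>' = "\<lambda>_. M * exp (- x) * \<bar>\<alpha> - Im w\<bar>"])
      fix t :: real assume t: "t \<in> {0..1}"
      have 1: "\<bar>Im w + t * (\<alpha> - Im w) - Im w\<bar> \<le> \<bar>\<alpha> - Im w\<bar>"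
        using t by (simp add: abs_mult mult_left_le_one_le)
      have 2: "\<bar>Im w + t * (\<alpha> - Im w)\<bar> \<le> \<bar>\<alpha>\<bar> + \<bar>Im w\<bar>"
      proof -
        have "Im w + t * (\<alpha> - Im w) = (1 - t) * Im w + t * \<alpha>" by (simp add: algebra_simps)
        also have "\<bar>\<dots>\<bar> \<le> \<bar>(1 - t) * Im w\<bar> + \<bar>t * \<alpha>\<bar>" by (rule abs_triangle_ineq)
        also have "\<dots> \<le> \<bar>Im w\<bar> + \<bar>\<alpha>\<bar>"
          using t by (intro add_mono) (auto simp: abs_mult intro!: mult_left_le_one_le)
        finally show ?thesis by simp
      qed
      show "norm (bker \<nu> w (Complex (- x) (Im w) + of_real t * (\<i> * of_real (\<alpha> - Im w))) *
            (\<i> * of_real (\<alpha> - Im w))) \<le> M * exp (- x) * \<bar>\<alpha> - Im w\<bar>"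
        unfolding eq norm_mult using norm_bker_strip_le'[OF 1 \<alpha> x 2, of \<nu>]
        by (auto simp: M_def intro!: mult_right_mono simp flip: of_real_diff)
    qed (auto intro!: has_field_derivative_prim bker_holomorphic derivative_eq_intros)
    then show ?thesis unfolding eq by simp
  qed
  have "(\<lambda>n. ?P (Complex (- real n) \<alpha>) - ?P (Complex (- real n) (Im w))) \<longlonglongrightarrow> 0"
  proof (rule Lim_null_comparison)
    show "\<forall>\<^sub>F n in sequentially. norm (?P (Complex (- real n) \<alpha>) - ?P (Complex (- real n) (Im w)))
        \<le> M * exp (- real n) * \<bar>\<alpha> - Im w\<bar>" by (intro always_eventually allI le) simp
    have "(\<lambda>n. exp (- real n)) \<longlonglongrightarrow> 0" by real_asymp
    from tendsto_mult_right[OF this, of "M"] show "(\<lambda>n. M * exp (- real n) * \<bar>\<alpha> - Im w\<bar>) \<longlonglongrightarrow> 0"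
      by (intro tendsto_mult_left_zero) (simp add: mult.commute)
  qed
  moreover have "(\<lambda>n. ?P (Complex (- real n) \<alpha>) - ?P (Complex (- real n) (Im w)))
      \<longlonglongrightarrow> arm \<alpha> (bker \<nu> w) - arm (Im w) (bker \<nu> w)"
    by (intro tendsto_diff arm_bker_tendsto \<alpha>) auto
  ultimately show ?thesis using LIMSEQ_unique by force
qed

text \<open>The kernels for two orders differ by the factor
  \<open>exp ((\<nu>0 - \<nu>) * t) - 1\<close>, which makes the arm Lipschitz near
  \<open>\<nu>0\<close>. Continuity is what gives access to integer orders.\<close>

lemma isCont_arm_bker: "isCont (\<lambda>\<nu>. arm (Im w) (bker \<nu> w)) \<nu>0"
proof -
  define \<theta> where "\<theta> = Im w"
  \<comment> \<open>\<open>K\<close> controls the horizontal ray at height \<open>\<theta>\<close>,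
    \<open>L\<close> the vertical segment from 0 up to it. The summand 2 in both pays for the factor
    \<open>exp (2 * norm t)\<close> below.\<close>
  define K where "K = exp (exp (Re w) + (norm \<nu>0 + 2) * \<bar>\<theta>\<bar> + (norm \<nu>0 + 2 + 1)\<^sup>2 / exp (Re w))"
  define L where "L = exp (exp (Re w) + (norm \<nu>0 + 2) * \<bar>\<theta>\<bar>)"
  let ?C = "K + L * \<bar>\<theta>\<bar>"
  have main: "norm (arm \<theta> (bker \<nu> w) - arm \<theta> (bker \<nu>0 w)) \<le> norm (\<nu> - \<nu>0) * ?C"
    if \<nu>: "norm (\<nu> - \<nu>0) \<le> 1" for \<nu>
  proof -
    define D where "D = (\<lambda>t. bker \<nu> w t - bker \<nu>0 w t)"
    have D_hol: "D holomorphic_on UNIV" unfolding D_def by (intro holomorphic_intros)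
    have D_prim: "prim D t = prim (bker \<nu> w) t - prim (bker \<nu>0 w) t" for t
    proof -
      have "prim D t = (prim (bker \<nu> w) t - prim (bker \<nu>0 w) t) - (prim (bker \<nu> w) 0 - prim (bker \<nu>0 w) 0)"
        unfolding D_def by (rule prim_eq)
          (auto intro!: derivative_eq_intros has_field_derivative_prim bker_holomorphic)
      then show ?thesis by simp
    qed
    \<comment> \<open>One factor \<open>exp (norm t)\<close> comes from the mean value inequality
      with \<open>norm (\<nu> - \<nu>0) \<le> 1\<close>, the other absorbs
      \<open>norm t\<close>.\<close>
    have D_le: "norm (D t) \<le> norm (\<nu> - \<nu>0) * (norm (bker \<nu>0 w t) * exp (2 * norm t))" for t
    proof -
      have "norm (exp ((\<nu>0 - \<nu>) * t) - exp 0) \<le> exp (norm t) * norm ((\<nu>0 - \<nu>) * t - 0)"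
      proof (rule field_differentiable_bound[where S = "cball 0 (norm t)" and f' = exp])
        fix z :: complex assume "z \<in> cball 0 (norm t)"
        then show "norm (exp z) \<le> exp (norm t)" using norm_exp[of z] by (auto intro: order_trans)
      next
        have "norm ((\<nu>0 - \<nu>) * t) \<le> 1 * norm t"
          unfolding norm_mult using \<nu> by (intro mult_right_mono) (auto simp: norm_minus_commute)
        then show "(\<nu>0 - \<nu>) * t \<in> cball 0 (norm t)" by simp
      qed (auto intro!: derivative_eq_intros)
      also have "norm ((\<nu>0 - \<nu>) * t - 0) = norm (\<nu> - \<nu>0) * norm t"
        by (simp add: norm_mult norm_minus_commute)
      also have "exp (norm t) * (norm (\<nu> - \<nu>0) * norm t) \<le> norm (\<nu> - \<nu>0) * exp (2 * norm t)"
      proof -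
        have "norm t \<le> exp (norm t)" using exp_ge_add_one_self[of "norm t"] by linarith
        then have "norm t * exp (norm t) \<le> exp (norm t) * exp (norm t)" by (intro mult_right_mono) auto
        then have "norm (\<nu> - \<nu>0) * (norm t * exp (norm t)) \<le> norm (\<nu> - \<nu>0) * (exp (norm t) * exp (norm t))"
          by (intro mult_left_mono) auto
        then show ?thesis by (simp add: exp_add[symmetric] mult_ac)
      qed
      finally have "norm (exp ((\<nu>0 - \<nu>) * t) - 1) \<le> norm (\<nu> - \<nu>0) * exp (2 * norm t)" by simp
      moreover have "D t = bker \<nu>0 w t * (exp ((\<nu>0 - \<nu>) * t) - 1)"
        by (simp add: D_def bker_def exp_add[symmetric] algebra_simps)
      ultimately show ?thesis by (metis mult.left_commute mult_left_mono norm_ge_zero norm_mult)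
    qed
    have D_hor: "norm (D (Complex (- x) \<theta>)) \<le> norm (\<nu> - \<nu>0) * K * exp (- 1 * x)" if x: "x \<ge> 0" for x
    proof -
      have "norm (Complex (- x) \<theta>) \<le> x + \<bar>\<theta>\<bar>" using cmod_le[of "Complex (- x) \<theta>"] x by simp
      then have "norm (bker \<nu>0 w (Complex (- x) \<theta>)) * exp (2 * norm (Complex (- x) \<theta>))
          \<le> norm (bker \<nu>0 w (Complex (- x) \<theta>)) * exp (2 * (x + \<bar>\<theta>\<bar>))"
        by (intro mult_left_mono) auto
      also have "\<dots> \<le> K * exp (- x)"
        using norm_bker_strip_le[of \<theta> w 0 x "\<bar>\<theta>\<bar>" \<nu>0 2 "norm \<nu>0 + 2"] x
        by (simp add: K_def \<theta>_def)
      finally have "norm (\<nu> - \<nu>0) * (norm (bker \<nu>0 w (Complex (- x) \<theta>)) * exp (2 * norm (Complex (- x) \<theta>)))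
          \<le> norm (\<nu> - \<nu>0) * (K * exp (- x))" by (intro mult_left_mono) auto
      with D_le[of "Complex (- x) \<theta>"] show ?thesis by (simp add: mult_ac)
    qed
    have D_ver: "norm (prim D (Complex 0 \<theta>)) \<le> norm (\<nu> - \<nu>0) * L * \<bar>\<theta>\<bar>"
    proof -
      have "norm (prim D (Complex 0 \<theta>) - prim D 0) \<le> norm (\<nu> - \<nu>0) * L * norm (Complex 0 \<theta> - 0)"
      proof (rule field_differentiable_bound[where S = "closed_segment 0 (Complex 0 \<theta>)" and f' = D])
        fix t assume "t \<in> closed_segment 0 (Complex 0 \<theta>)"
        then obtain u where u: "0 \<le> u" "u \<le> 1" "t = of_real u * Complex 0 \<theta>"
          by (auto simp: in_segment scaleR_conv_of_real)
        define y where "y = u * \<theta>"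
        have t: "t = \<i> * of_real y" by (simp add: u y_def complex_eq_iff)
        have y: "\<bar>y\<bar> \<le> \<bar>\<theta>\<bar>" using u by (simp add: y_def abs_mult mult_left_le_one_le)
        have "norm (sinh t) \<le> 1"
        proof -
          have "sinh t = \<i> * of_real (sin y)"
            by (simp add: t sinh_field_def sin_of_real[symmetric] sin_exp_eq field_simps)
          then show ?thesis by (simp add: norm_mult)
        qed
        then have "norm (exp w * sinh t - \<nu>0 * t) \<le> exp (Re w) * 1 + norm \<nu>0 * norm t"
          by (intro order_trans[OF norm_triangle_ineq4] add_mono) (auto simp: norm_mult)
        then have "norm (bker \<nu>0 w t) \<le> exp (exp (Re w) + norm \<nu>0 * norm t)"
          unfolding bker_def using norm_exp[of "exp w * sinh t - \<nu>0 * t"] by (auto intro: order_trans)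
        then have "norm (bker \<nu>0 w t) * exp (2 * norm t) \<le> exp (exp (Re w) + norm \<nu>0 * norm t) * exp (2 * norm t)"
          by (intro mult_right_mono) auto
        also have "\<dots> = exp (exp (Re w) + (norm \<nu>0 + 2) * norm t)"
          by (simp add: exp_add[symmetric] algebra_simps)
        also have "\<dots> \<le> L" using y by (auto simp: L_def t norm_mult intro!: mult_left_mono)
        finally have "norm (\<nu> - \<nu>0) * (norm (bker \<nu>0 w t) * exp (2 * norm t)) \<le> norm (\<nu> - \<nu>0) * L"
          by (intro mult_left_mono) auto
        with D_le[of t] show "norm (D t) \<le> norm (\<nu> - \<nu>0) * L" by linarith
      qed (auto intro: has_field_derivative_prim D_hol)
      then show ?thesis by (simp add: prim_def complex_norm)
    qed
    have eq: "arm \<theta> D = arm \<theta> (bker \<nu> w) - arm \<theta> (bker \<nu>0 w)"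
    proof (rule LIMSEQ_unique)
      show "(\<lambda>n. prim D (Complex (- real n) \<theta>)) \<longlonglongrightarrow> arm \<theta> D"
        by (rule arm_bound(1)[OF D_hol _ D_hor]) auto
      show "(\<lambda>n. prim D (Complex (- real n) \<theta>)) \<longlonglongrightarrow> arm \<theta> (bker \<nu> w) - arm \<theta> (bker \<nu>0 w)"
        unfolding D_prim by (intro tendsto_diff arm_bker_tendsto) (auto simp: \<theta>_def)
    qed
    have "norm (arm \<theta> D - prim D (Complex 0 \<theta>)) \<le> norm (\<nu> - \<nu>0) * K"
      using arm_bound(2)[OF D_hol _ D_hor, of 0] by simp
    then show ?thesis
      unfolding eq[symmetric] using D_ver norm_triangle_sub[of "arm \<theta> D" "prim D (Complex 0 \<theta>)"] by (simp add: algebra_simps)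
  qed
  have "((\<lambda>\<nu>. arm \<theta> (bker \<nu> w) - arm \<theta> (bker \<nu>0 w)) \<longlongrightarrow> 0) (at \<nu>0)"
  proof (rule Lim_null_comparison)
    show "\<forall>\<^sub>F \<nu> in at \<nu>0. norm (arm \<theta> (bker \<nu> w) - arm \<theta> (bker \<nu>0 w)) \<le> norm (\<nu> - \<nu>0) * ?C"
      unfolding eventually_at by (rule exI[of _ 1]) (auto simp: dist_norm intro!: main)
    have "((\<lambda>\<nu>. norm (\<nu> - \<nu>0) * ?C) \<longlongrightarrow> norm (\<nu>0 - \<nu>0) * ?C) (at \<nu>0)" by (intro tendsto_intros)
    then show "((\<lambda>\<nu>. norm (\<nu> - \<nu>0) * ?C) \<longlongrightarrow> 0) (at \<nu>0)" by simp
  qed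
  then show ?thesis unfolding isCont_def \<theta>_def by (rule Lim_null[THEN iffD2])
qed

section \<open>Hankel functions as sums of two arms\<close>

text \<open>Fubini for iterated series; the product majorant gives unconditional summability over
  pairs. It serves to compare the two arms at \<open>t = 0\<close>.\<close>

lemma suminf_swap_dominated:
  fixes f :: "nat \<Rightarrow> nat \<Rightarrow> complex"
  assumes le: "\<And>k j. norm (f k j) \<le> a k * b j"
    and nonneg: "\<And>k. 0 \<le> a k" "\<And>j. 0 \<le> b j"
    and sm: "summable a" "summable b"
  shows "(\<Sum>k. \<Sum>j. f k j) = (\<Sum>j. \<Sum>k. f k j)"
proof -
  have "(\<lambda>(k, j). a k * b j) summable_on UNIV \<times> UNIV"
  proof (rule summable_on_SigmaI)
    show "((\<lambda>j. case (k, j) of (k, j) \<Rightarrow> a k * b j) has_sum a k * suminf b) UNIV" for k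
      unfolding prod.case using nonneg sm
      by (intro has_sum_cmult_right sums_nonneg_imp_has_sum summable_sums)
    show "(\<lambda>k. a k * suminf b) summable_on UNIV"
      using nonneg sm by (intro summable_on_cmult_left) (simp add: summable_on_UNIV_nonneg_real_iff)
  qed (use nonneg in auto)
  then have "(\<lambda>x. norm (case x of (k, j) \<Rightarrow> f k j)) summable_on UNIV \<times> UNIV"
    by (rule Infinite_Sum.abs_summable_on_comparison_test') (use le in auto)
  then have S: "(\<lambda>(k, j). f k j) summable_on UNIV \<times> UNIV"
    by (rule abs_summable_summable)
  have inf: "infsum g UNIV = suminf g" if "\<And>k. norm (g k) \<le> c k" "summable c" for g :: "nat \<Rightarrow> complex" and c
  proof -
    have n: "summable (\<lambda>k. norm (g k))"
      by (rule summable_comparison_test'[OF that(2)]) (use that(1) in auto)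
    show ?thesis
      by (intro infsumI norm_summable_imp_has_sum[OF n] summable_sums summable_norm_cancel[OF n])
  qed
  have nle: "norm (suminf g) \<le> suminf c" if "\<And>k. norm (g k) \<le> c k" "summable c" for g :: "nat \<Rightarrow> complex" and c
    by (rule norm_suminf_le[OF that])
  have row: "infsum (f k) UNIV = (\<Sum>j. f k j)" for k
    by (rule inf[of _ "\<lambda>j. a k * b j"]) (use le sm in \<open>auto intro: summable_mult\<close>)
  have col: "infsum (\<lambda>k. f k j) UNIV = (\<Sum>k. f k j)" for j
    by (rule inf[of _ "\<lambda>k. a k * b j"]) (use le sm in \<open>auto intro: summable_mult2\<close>)
  have "(\<Sum>k. \<Sum>j. f k j) = infsum (\<lambda>k. infsum (\<lambda>j. f k j) UNIV) UNIV"
  proof -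
    have "norm (\<Sum>j. f k j) \<le> a k * suminf b" for k
      using nle[of "f k" "\<lambda>j. a k * b j"] le sm by (simp add: suminf_mult summable_mult)
    from inf[OF this] sm show ?thesis by (simp add: row summable_mult2)
  qed
  also have "\<dots> = infsum (\<lambda>j. infsum (\<lambda>k. f k j) UNIV) UNIV"
    by (rule infsum_swap_banach[OF S])
  also have "\<dots> = (\<Sum>j. \<Sum>k. f k j)"
  proof -
    have "norm (\<Sum>k. f k j) \<le> suminf a * b j" for j
      using nle[of "\<lambda>k. f k j" "\<lambda>k. a k * b j"] le sm by (simp add: suminf_mult2 summable_mult2)
    from inf[OF this] sm show ?thesis by (simp add: col summable_mult)
  qed
  finally show ?thesis .
qed

section \<open>Term-by-term primitive of the kernel for non-integer order\<close>

lemma not_Ints_separated: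
  assumes "(\<nu> :: complex) \<notin> \<int>"
  obtains d where "d > 0" "\<And>i. d \<le> norm (\<nu> + of_int i)" "\<And>i j. d \<le> norm (\<nu> - of_nat i + of_nat j)"
proof -
  obtain d where "d > 0" and d: "\<And>x. x \<in> \<int> \<Longrightarrow> d \<le> dist \<nu> x"
    using separate_point_closed[OF closed_Ints assms] by blast
  have 1: "d \<le> norm (\<nu> + of_int i)" for i
    using d[of "- of_int i"] by (simp add: dist_norm)
  moreover have "d \<le> norm (\<nu> - of_nat i + of_nat j)" for i j
    using 1[of "int j - int i"] by (simp add: algebra_simps)
  ultimately show ?thesis using \<open>d > 0\<close> that by blast
qed

lemma not_Ints_diff_nat: "(\<nu> :: complex) \<notin> \<int> \<Longrightarrow> \<nu> - of_nat k \<notin> \<int>\<^sub>\<le>\<^sub>0"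
proof
  assume "\<nu> \<notin> \<int>" "\<nu> - of_nat k \<in> \<int>\<^sub>\<le>\<^sub>0"
  then have "\<nu> - of_nat k + of_nat k \<in> \<int>" by (intro Ints_add Ints_of_nat) (auto elim: nonpos_Ints_cases)
  with \<open>\<nu> \<notin> \<int>\<close> show False by simp
qed

text \<open>The number (z/2)^(2k - \<nu>) / k!, with the power taken on the Riemann surface.\<close>

definition bcoeff :: "complex \<Rightarrow> complex \<Rightarrow> nat \<Rightarrow> complex" where
  "bcoeff \<nu> w k = exp ((2 * of_nat k - \<nu>) * (w - of_real (ln 2))) / fact k"

text \<open>Writing \<open>exp (z sinh t) = (\<Sum>k. (z / 2)\<^sup>k exp (k t) / k!) exp (- z exp (- t) / 2)\<close> and integrating term by
  term gives the primitive \<open>bser\<close> of \<open>bker\<close>; \<open>blim\<close> is its limit at \<open>- \<infinity>\<close>.\<close>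

definition bser :: "complex \<Rightarrow> complex \<Rightarrow> complex \<Rightarrow> complex" where
  "bser \<nu> w t = - (\<Sum>k. bcoeff \<nu> w k * igam (\<nu> - of_nat k) (w - of_real (ln 2) - t))"

definition blim :: "complex \<Rightarrow> complex \<Rightarrow> complex" where
  "blim \<nu> w = - (\<Sum>k. bcoeff \<nu> w k * Gamma (\<nu> - of_nat k))"

lemma exp_minus_ln2: "exp (w - of_real (ln 2)) = exp w / (2 :: complex)"
  by (simp add: exp_diff exp_of_real)

text \<open>The powers of z hidden in \<open>bcoeff\<close> and \<open>igam\<close> combine so that
  only integer powers of z remain. The resulting double series, nearly symmetric in \<open>k\<close>
  and \<open>j\<close>, is used for summability and for the reflection at
  \<open>t = 0\<close>.\<close>

lemma bcoeff_igam_eq: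
  "bcoeff \<nu> w k * igam (\<nu> - of_nat k) (w - of_real (ln 2) - t) =
     exp (- \<nu> * t) * ((exp w / 2 * exp t) ^ k / fact k *
       (\<Sum>j. (- (exp w / 2 * exp (- t))) ^ j / (fact j * (\<nu> - of_nat k + of_nat j))))"
proof -
  define v where "v = w - complex_of_real (ln 2)"
  have "exp ((2 * of_nat k - \<nu>) * v) * exp ((\<nu> - of_nat k) * (v - t)) = exp (- \<nu> * t + of_nat k * (v + t))"
    by (simp add: exp_add[symmetric] algebra_simps)
  also have "\<dots> = exp (- \<nu> * t) * (exp v * exp t) ^ k"
    by (simp only: exp_add exp_of_nat_mult)
  moreover have "exp (v - t) = exp v * exp (- t)" by (simp add: exp_add[symmetric])
  ultimately show ?thesis
    unfolding bcoeff_def igam_def gser_def v_def[symmetric] exp_minus_ln2[of w, folded v_def, symmetric]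
    by (simp add: field_simps)
qed

lemma bcoeff_summable: "summable (\<lambda>k. norm (bcoeff \<nu> w k))"
proof -
  define v where "v = w - complex_of_real (ln 2)"
  have "bcoeff \<nu> w k = exp (- \<nu> * v) * ((exp v ^ 2) ^ k /\<^sub>R fact k)" for k
    by (simp add: bcoeff_def v_def[symmetric] scaleR_conv_of_real exp_of_nat_mult[symmetric] exp_add[symmetric]
        divide_inverse algebra_simps flip: exp_double) 
  moreover have "summable (\<lambda>k. norm (exp (- \<nu> * v)) * norm ((exp v ^ 2) ^ k /\<^sub>R fact k))"
    by (intro summable_mult summable_norm_exp)
  ultimately show ?thesis by (simp only: norm_mult)
qed

lemma bser_term_summable:
  assumes "\<nu> \<notin> \<int>"
  shows "summable (\<lambda>k. norm (bcoeff \<nu> w k * igam (\<nu> - of_nat k) (w - of_real (ln 2) - t)))"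
proof -
  obtain d where d: "d > 0" "\<And>i j. d \<le> norm (\<nu> - of_nat i + of_nat j)"
    using not_Ints_separated[OF assms] by metis
  define x y where "x = exp w / 2 * exp t" "y = - (exp w / 2 * exp (- t))"
  have "norm (bcoeff \<nu> w k * igam (\<nu> - of_nat k) (w - of_real (ln 2) - t))
      \<le> norm (exp (- \<nu> * t)) * (norm x ^ k /\<^sub>R fact k * (exp (norm y) / d))" for k
    unfolding bcoeff_igam_eq x_y_def[symmetric] norm_mult
    by (intro mult_left_mono mult_mono igam_term_bounds(2)[OF d])
       (use d in \<open>auto simp: norm_mult norm_inverse norm_power divide_inverse mult_ac\<close>)
  note le = this
  have sm: "summable (\<lambda>k. norm (exp (- \<nu> * t)) * (norm x ^ k /\<^sub>R fact k * (exp (norm y) / d)))"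
    by (intro summable_mult summable_mult2 summable_exp_generic)
  show ?thesis by (rule summable_comparison_test'[OF sm]) (simp only: real_norm_def abs_norm_cancel le)
qed

text \<open>The differentiated terms are those of an exponential series times a bounded factor on
  the unit ball around \<open>t\<close>, so the series may be differentiated termwise.\<close>

lemma has_field_derivative_bser:
  assumes \<nu>: "\<nu> \<notin> \<int>"
  shows "(bser \<nu> w has_field_derivative bker \<nu> w t) (at t)"
proof -
  define v where "v = w - complex_of_real (ln 2)"
  define f where "f = (\<lambda>k t. bcoeff \<nu> w k * igam (\<nu> - of_nat k) (v - t))"
  define f' where "f' = (\<lambda>k t. - ((exp (v + t)) ^ k /\<^sub>R fact k * exp (- \<nu> * t - exp (v - t))))"
  have der: "(f k has_field_derivative f' k s) (at s within S)" for k s S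
  proof -
    have e: "bcoeff \<nu> w k * exp ((\<nu> - of_nat k) * (v - s) - exp (v - s)) =
        (exp (v + s)) ^ k /\<^sub>R fact k * exp (- \<nu> * s - exp (v - s))"
    proof -
      have "exp ((2 * of_nat k - \<nu>) * v) * exp ((\<nu> - of_nat k) * (v - s) - exp (v - s))
          = exp (of_nat k * (v + s)) * exp (- \<nu> * s - exp (v - s))"
        by (simp only: exp_add[symmetric]) (simp add: algebra_simps)
      then show ?thesis
        by (simp add: bcoeff_def v_def[symmetric] exp_of_nat_mult scaleR_conv_of_real divide_inverse mult_ac)
    qed
    have "(f k has_field_derivative
        bcoeff \<nu> w k * (exp ((\<nu> - of_nat k) * (v - s) - exp (v - s)) * (- 1))) (at s within S)"
      unfolding f_def
      by (rule DERIV_cmult, rule DERIV_chain2[of "igam (\<nu> - of_nat k)"])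
         (auto intro!: igam_has_field_derivative not_Ints_diff_nat \<nu> derivative_eq_intros)
    also have "bcoeff \<nu> w k * (exp ((\<nu> - of_nat k) * (v - s) - exp (v - s)) * (- 1)) = f' k s"
      using e by (simp add: f'_def)
    finally show ?thesis .
  qed
  define R where "R = norm t + 1"
  have "uniformly_convergent_on (ball t 1) (\<lambda>n x. \<Sum>i<n. f' i x)"
  proof (rule Weierstrass_m_test')
    fix k x assume "x \<in> ball t 1"
    then have x: "norm x \<le> R"
      using norm_triangle_sub[of x t] by (simp add: R_def dist_norm norm_minus_commute)
    have "norm (exp (v + x)) \<le> exp (norm v + R)"
      using norm_exp[of "v + x"] norm_triangle_ineq[of v x] x by (auto elim!: order_trans)
    moreover have "norm (exp (- \<nu> * x - exp (v - x))) \<le> exp (norm \<nu> * R + exp (norm v + R))"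
    proof -
      have "norm (- \<nu> * x - exp (v - x)) \<le> norm \<nu> * R + exp (norm v + R)"
      proof (rule order_trans[OF norm_triangle_ineq4 add_mono])
        show "norm (- \<nu> * x) \<le> norm \<nu> * R" using x by (simp add: norm_mult mult_left_mono)
        show "norm (exp (v - x)) \<le> exp (norm v + R)"
          using norm_exp[of "v - x"] norm_triangle_ineq4[of v x] x by (auto elim!: order_trans)
      qed
      then show ?thesis using norm_exp order_trans exp_le_cancel_iff by blast
    qed
    ultimately show "norm (f' k x) \<le> exp (norm v + R) ^ k /\<^sub>R fact k * exp (norm \<nu> * R + exp (norm v + R))"
      unfolding f'_def norm_minus_cancel norm_mult
      by (intro mult_mono) (auto simp: norm_power divide_inverse intro!: mult_left_mono power_mono)
  qed (intro summable_mult2 summable_exp_generic)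
  moreover have "summable (\<lambda>k. f k t)"
    unfolding f_def v_def by (rule summable_norm_cancel[OF bser_term_summable[OF \<nu>]])
  ultimately have "((\<lambda>s. \<Sum>k. f k s) has_field_derivative (\<Sum>k. f' k t)) (at t)"
    by (intro has_field_derivative_series'(2)[of "ball t 1" f f' t]) (auto intro!: der)
  then have "((\<lambda>s. - (\<Sum>k. f k s)) has_field_derivative - (\<Sum>k. f' k t)) (at t)"
    by (rule DERIV_minus)
  \<comment> \<open>The sum over \<open>k\<close> rebuilds exp (z exp t / 2), the factor that had
    been expanded.\<close>
  moreover have "(\<Sum>k. f' k t) = - (exp (exp (v + t)) * exp (- \<nu> * t - exp (v - t)))"
    unfolding f'_def by (intro sums_unique[symmetric] sums_minus sums_mult2 exp_converges)
  moreover have "exp (exp (v + t)) * exp (- \<nu> * t - exp (v - t)) = bker \<nu> w t"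
  proof -
    have e: "exp (v + t) = exp (w + t) / 2" "exp (v - t) = exp (w - t) / 2"
      using exp_minus_ln2[of "w + t"] exp_minus_ln2[of "w - t"] by (simp_all add: v_def algebra_simps)
    show ?thesis
      unfolding bker_def sinh_times_exp exp_add[symmetric] e diff_divide_distrib
      by (simp add: algebra_simps)
  qed
  ultimately show ?thesis by (simp add: bser_def[abs_def] f_def v_def)
qed

lemma bser_tendsto:
  assumes \<nu>: "\<nu> \<notin> \<int>"
  shows "(\<lambda>n. bser \<nu> w (Complex (- real n) (Im w))) \<longlonglongrightarrow> blim \<nu> w"
proof -
  define v where "v = w - complex_of_real (ln 2)"
  \<comment> \<open>On the ray at height \<open>Im w\<close> the argument \<open>v - t\<close> is
    real, hence the opening 0. The real parts of all orders \<open>\<nu> - of_nat k\<close> are at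
    most \<open>Re \<nu>\<close> and their imaginary parts agree, so one constant serves every
    \<open>k\<close>.\<close>
  obtain C where C: "C \<ge> 0" "\<And>s y. s \<notin> \<int>\<^sub>\<le>\<^sub>0 \<Longrightarrow> Re s \<le> Re \<nu> \<Longrightarrow> \<bar>Im s\<bar> \<le> \<bar>Im \<nu>\<bar> \<Longrightarrow> 0 \<le> Re y \<Longrightarrow>
    \<bar>Im y\<bar> \<le> 0 \<Longrightarrow> norm (igam s y - Gamma s) \<le> C * exp (- 1 * Re y)"
    using igam_minus_Gamma_bound[of 0 1 "Re \<nu>" "\<bar>Im \<nu>\<bar>"] by auto
  define S where "S = (\<Sum>k. norm (bcoeff \<nu> w k))"
  have le: "norm (bser \<nu> w (Complex (- x) (Im w)) - blim \<nu> w) \<le> S * C * exp (- (Re v + x))"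
    if x: "x \<ge> 0" "x \<ge> - Re v" for x
  proof -
    define y where "y = v - Complex (- x) (Im w)"
    have y: "Re y = Re v + x" "Im y = 0" by (simp_all add: y_def v_def)
    let ?b = "bcoeff \<nu> w" and ?s = "\<lambda>k. \<nu> - of_nat k"
    have n: "norm (igam (?s k) y - Gamma (?s k)) \<le> C * exp (- Re y)" for k
      using C(2)[of "?s k" y] not_Ints_diff_nat[OF \<nu>] y x by simp
    have n': "norm (?b k * (igam (?s k) y - Gamma (?s k))) \<le> norm (?b k) * (C * exp (- Re y))" for k
      unfolding norm_mult by (intro mult_left_mono n) auto
    have sm: "summable (\<lambda>k. norm (?b k) * (C * exp (- Re y)))"
      by (intro summable_mult2 bcoeff_summable)
    have s1: "summable (\<lambda>k. ?b k * (igam (?s k) y - Gamma (?s k)))"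
      by (rule summable_norm_cancel, rule summable_comparison_test'[OF sm]) (use n' in auto)
    have s2: "summable (\<lambda>k. ?b k * igam (?s k) y)"
      unfolding y_def v_def by (rule summable_norm_cancel[OF bser_term_summable[OF \<nu>]])
    have s3: "summable (\<lambda>k. ?b k * Gamma (?s k))"
      using summable_diff[OF s2 s1] by (simp add: algebra_simps)
    have "bser \<nu> w (Complex (- x) (Im w)) - blim \<nu> w = - (\<Sum>k. ?b k * (igam (?s k) y - Gamma (?s k)))"
      unfolding right_diff_distrib suminf_diff[OF s2 s3, symmetric]
      by (simp add: bser_def blim_def y_def v_def)
    also have "norm \<dots> \<le> (\<Sum>k. norm (?b k) * (C * exp (- Re y)))"
      unfolding norm_minus_cancel by (rule norm_suminf_le[OF n' sm])
    also have "\<dots> = S * (C * exp (- Re y))"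
      unfolding S_def by (rule suminf_mult2[symmetric, OF bcoeff_summable])
    finally show ?thesis by (simp add: y)
  qed
  have "(\<lambda>n. bser \<nu> w (Complex (- real n) (Im w)) - blim \<nu> w) \<longlonglongrightarrow> 0"
  proof (rule Lim_null_comparison)
    show "\<forall>\<^sub>F n in sequentially. norm (bser \<nu> w (Complex (- real n) (Im w)) - blim \<nu> w)
        \<le> S * C * exp (- (Re v + real n))"
      using eventually_ge_at_top[of "nat \<lceil>- Re v\<rceil>"]
      by eventually_elim (intro le, auto simp: nat_le_iff ceiling_le_iff)
    have "(\<lambda>n. exp (- (Re v + real n))) \<longlonglongrightarrow> 0" by real_asymp
    from tendsto_mult[OF tendsto_const this, of "S * C"]
    show "(\<lambda>n. S * C * exp (- (Re v + real n))) \<longlonglongrightarrow> 0" by simp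
  qed
  then show ?thesis by (rule Lim_null[THEN iffD2])
qed

lemma arm_bker_eq_blim:
  assumes \<nu>: "\<nu> \<notin> \<int>"
  shows "arm (Im w) (bker \<nu> w) = blim \<nu> w - bser \<nu> w 0"
proof (rule LIMSEQ_unique[OF arm_bker_tendsto])
  have "prim (bker \<nu> w) t = bser \<nu> w t - bser \<nu> w 0" for t
    by (rule prim_eq[OF has_field_derivative_bser[OF \<nu>]])
  then show "(\<lambda>n. prim (bker \<nu> w) (Complex (- real n) (Im w))) \<longlonglongrightarrow> blim \<nu> w - bser \<nu> w 0"
    by (auto intro!: tendsto_intros bser_tendsto \<nu>)
qed simp

text \<open>At \<open>t = 0\<close> both arms contribute the same double series, with opposite signs.\<close>

lemma bser_0_reflect:
  assumes \<nu>: "\<nu> \<notin> \<int>" and w': "exp w' = - exp w"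
  shows "bser (- \<nu>) w' 0 = - bser \<nu> w 0"
proof -
  obtain d where d: "d > 0" "\<And>i. d \<le> norm (\<nu> + of_int i)" "\<And>i j. d \<le> norm (\<nu> - of_nat i + of_nat j)"
    using not_Ints_separated[OF \<nu>] by metis
  define x where "x = exp w / 2"
  define f where "f = (\<lambda>k j. x ^ k / fact k * ((- x) ^ j / (fact j * (\<nu> - of_nat k + of_nat j))))"
  have sm: "summable (\<lambda>j. (- x) ^ j / (fact j * (\<nu> - of_nat k + of_nat j)))" for k
    by (rule summable_norm_cancel[OF igam_term_bounds(1)[OF d(1,3)]])
  have row: "x ^ k / fact k * (\<Sum>j. (- x) ^ j / (fact j * (\<nu> - of_nat k + of_nat j))) = (\<Sum>j. f k j)" for k
    unfolding f_def by (rule suminf_mult[symmetric, OF sm])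
  have coeff: "bcoeff \<nu> w k * igam (\<nu> - of_nat k) (w - of_real (ln 2)) = (\<Sum>j. f k j)" for k
    using bcoeff_igam_eq[of \<nu> w k 0] row[of k] by (simp add: x_def)
  have 1: "bser \<nu> w 0 = - (\<Sum>k. \<Sum>j. f k j)"
    by (simp add: bser_def coeff)
  have d': "d \<le> norm (- \<nu> - of_nat i + of_nat j)" for i j
    using d(3)[of j i] by (metis (no_types, opaque_lifting) add.commute diff_add_eq_diff_diff_swap
        minus_diff_eq norm_minus_cancel uminus_add_conv_diff add_uminus_conv_diff)
  have sm': "summable (\<lambda>j. x ^ j / (fact j * (- \<nu> - of_nat k + of_nat j)))" for k
    by (rule summable_norm_cancel[OF igam_term_bounds(1)[OF d(1) d']])
  \<comment> \<open>Exchanging the roles of \<open>k\<close> and \<open>j\<close> while negating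
    \<open>\<nu>\<close> and z changes only the sign of the denominator.\<close>
  have flip: "(- x) ^ j / fact j * (x ^ k / (fact k * (- \<nu> - of_nat j + of_nat k))) = - f k j" for j k
  proof -
    have "- \<nu> - of_nat j + of_nat k = - (\<nu> - of_nat k + of_nat j)" by simp
    then show ?thesis unfolding f_def by (simp only: mult_minus_right minus_divide_right[symmetric]) (simp add: mult_ac)
  qed
  have "bser (- \<nu>) w' 0 = - (\<Sum>j. \<Sum>k. - f k j)"
  proof -
    have "bcoeff (- \<nu>) w' j * igam (- \<nu> - of_nat j) (w' - of_real (ln 2)) =
        (\<Sum>k. (- x) ^ j / fact j * (x ^ k / (fact k * (- \<nu> - of_nat j + of_nat k))))" for j
      using bcoeff_igam_eq[of "- \<nu>" w' j 0] suminf_mult[OF sm'[of j], of "(- x) ^ j / fact j"]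
      by (simp add: x_def w')
    then show ?thesis by (simp only: bser_def flip diff_0_right)
  qed
  \<comment> \<open>The rows of one double series are the columns of the other, so the cancellation
    of the two arms is exactly this interchange.\<close>
  also have "(\<Sum>j. \<Sum>k. - f k j) = (\<Sum>k. \<Sum>j. - f k j)"
  proof (rule suminf_swap_dominated[symmetric])
    show "norm (- f k j) \<le> (norm x ^ k /\<^sub>R fact k / d) * (norm x ^ j /\<^sub>R fact j)" for k j
    proof -
      have "norm (- f k j) = norm x ^ k / fact k * norm ((- x) ^ j / (fact j * (\<nu> - of_nat k + of_nat j)))"
        by (simp add: f_def norm_mult norm_divide norm_power)
      also have "\<dots> \<le> norm x ^ k / fact k * (norm (- x) ^ j /\<^sub>R fact j / d)"
        by (intro mult_left_mono norm_igam_term_le d) auto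
      finally show ?thesis by (simp add: divide_inverse mult_ac)
    qed
    show "summable (\<lambda>k. norm x ^ k /\<^sub>R fact k / d)" "summable (\<lambda>k. norm x ^ k /\<^sub>R fact k)"
      by (intro summable_divide summable_exp_generic)+
  qed (use d in auto)
  also have "(\<Sum>k. \<Sum>j. - f k j) = - (\<Sum>k. \<Sum>j. f k j)"
  proof -
    have "(\<Sum>j. - f k j) = - (\<Sum>j. f k j)" for k
      unfolding f_def by (intro suminf_minus summable_mult sm)
    moreover have "summable (\<lambda>k. \<Sum>j. f k j)"
      using summable_norm_cancel[OF bser_term_summable[OF \<nu>, of w 0]]
      by (simp add: coeff)
    ultimately show ?thesis by (simp add: suminf_minus)
  qed
  finally show ?thesis using 1 by simp
qed

section \<open>The Bessel series as a function of the order, and the integral for Hankel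
  functions\<close>

lemma norm_pochhammer_ge_1:
  assumes "Re z \<ge> 1"
  shows "norm (pochhammer z n) \<ge> 1"
proof (induction n)
  case (Suc n)
  have "1 \<le> Re (z + of_nat n)" using assms by simp
  also have "\<dots> \<le> norm (z + of_nat n)" by (rule complex_Re_le_cmod)
  finally have "1 * 1 \<le> norm (pochhammer z n) * norm (z + of_nat n)"
    using Suc by (intro mult_mono) auto
  then show ?case by (simp add: pochhammer_Suc norm_mult)
qed simp

lemma continuous_on_rGamma_shift: "continuous_on A (\<lambda>\<nu>. rGamma (\<nu> + of_nat k + 1 :: complex))"
  by (rule continuous_on_compose2[OF continuous_on_rGamma[of UNIV]]) (auto intro!: continuous_intros)

text \<open>Once \<open>Re (\<nu> + of_nat K + 1) \<ge> 1\<close>, further shifts divide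
  \<open>rGamma\<close> by a Pochhammer symbol of modulus at least 1, so the bound at the single
  index \<open>K\<close>, from compactness, persists.\<close>

lemma rGamma_shift_bounded:
  obtains K B where "\<And>\<nu> k. \<nu> \<in> cball \<nu>0 1 \<Longrightarrow> k \<ge> K \<Longrightarrow> norm (rGamma (\<nu> + of_nat k + 1 :: complex)) \<le> B"
proof -
  define K where "K = nat \<lceil>1 - Re \<nu>0\<rceil>"
  have "compact ((\<lambda>\<nu>. rGamma (\<nu> + of_nat K + 1)) ` cball \<nu>0 1)"
    by (intro compact_continuous_image continuous_on_rGamma_shift compact_cball)
  then obtain B where B: "\<And>\<nu>. \<nu> \<in> cball \<nu>0 1 \<Longrightarrow> norm (rGamma (\<nu> + of_nat K + 1)) \<le> B"
    by (force dest: compact_imp_bounded simp: bounded_iff)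
  show ?thesis
  proof
    fix \<nu> k assume \<nu>: "\<nu> \<in> cball \<nu>0 1" and k: "k \<ge> K"
    have "\<bar>Re (\<nu>0 - \<nu>)\<bar> \<le> 1" using \<nu> abs_Re_le_cmod[of "\<nu>0 - \<nu>"] by (simp add: dist_norm)
    moreover have "1 - Re \<nu>0 \<le> real K" unfolding K_def by linarith
    ultimately have "Re (\<nu> + of_nat K + 1) \<ge> 1" by simp
    then have p: "1 \<le> norm (pochhammer (\<nu> + of_nat K + 1) (k - K))" by (rule norm_pochhammer_ge_1)
    have "1 * norm (rGamma (\<nu> + of_nat k + 1))
        \<le> norm (pochhammer (\<nu> + of_nat K + 1) (k - K)) * norm (rGamma (\<nu> + of_nat k + 1))"
      by (intro mult_right_mono p) auto
    also have "\<dots> = norm (rGamma (\<nu> + of_nat K + 1))"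
      using pochhammer_rGamma[of "\<nu> + of_nat K + 1" "k - K"] k
      by (simp add: norm_mult of_nat_diff algebra_simps)
    also have "\<dots> \<le> B" by (rule B[OF \<nu>])
    finally show "norm (rGamma (\<nu> + of_nat k + 1)) \<le> B" by simp
  qed
qed

text \<open>The reciprocal Gamma factors are bounded uniformly near \<open>\<nu>0\<close> from some
  index on, so the Weierstrass test is applied in its eventual form with an exponential
  majorant.\<close>

lemma
  shows bessel_J_summable:
      "summable (\<lambda>k. (-1) ^ k * rGamma (\<nu>0 + of_nat k + 1) / fact k * (x :: complex) ^ (2 * k))" (is ?A)
    and isCont_bessel_J_series:
      "isCont (\<lambda>\<nu>. \<Sum>k. (-1) ^ k * rGamma (\<nu> + of_nat k + 1) / fact k * x ^ (2 * k)) \<nu>0" (is ?B)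
proof -
  let ?f = "\<lambda>k \<nu>. (-1) ^ k * rGamma (\<nu> + of_nat k + 1) / fact k * x ^ (2 * k)"
  obtain K B where B: "\<And>\<nu> k. \<nu> \<in> cball \<nu>0 1 \<Longrightarrow> k \<ge> K \<Longrightarrow> norm (rGamma (\<nu> + of_nat k + 1 :: complex)) \<le> B"
    by (rule rGamma_shift_bounded[of \<nu>0]) (rule that)
  let ?M = "\<lambda>k. B * ((norm x ^ 2) ^ k /\<^sub>R fact k)"
  have le: "norm (?f k \<nu>) \<le> ?M k" if "\<nu> \<in> cball \<nu>0 1" "k \<ge> K" for k \<nu>
  proof -
    have P: "norm (x ^ (2 * k)) = (norm x ^ 2) ^ k" by (simp only: norm_power power_mult)
    have "norm (?f k \<nu>) = norm (rGamma (\<nu> + of_nat k + 1)) * norm (x ^ (2 * k)) / fact k"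
      by (simp add: norm_mult norm_divide norm_power)
    also have "\<dots> \<le> B * norm (x ^ (2 * k)) / fact k"
      by (intro divide_right_mono mult_right_mono B that) auto
    also have "\<dots> = ?M k" unfolding P by (simp only: divide_inverse real_scaleR_def mult_ac)
    finally show ?thesis .
  qed
  have M: "summable ?M" by (intro summable_mult summable_exp_generic)
  have ev: "\<forall>\<^sub>F k in sequentially. \<forall>\<nu>\<in>cball \<nu>0 1. norm (?f k \<nu>) \<le> ?M k"
    using eventually_ge_at_top[of K] by (rule eventually_mono) (intro ballI le)
  have "\<forall>\<^sub>F k in sequentially. norm (?f k \<nu>0) \<le> ?M k"
    using ev by (rule eventually_mono) (elim bspec, simp)
  then show ?A by (rule summable_comparison_test_ev[OF _ M])
  have "uniform_limit (cball \<nu>0 1) (\<lambda>n \<nu>. \<Sum>k<n. ?f k \<nu>) (\<lambda>\<nu>. \<Sum>k. ?f k \<nu>) sequentially"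
    by (rule Weierstrass_m_test_ev[OF ev M])
  then have "continuous_on (cball \<nu>0 1) (\<lambda>\<nu>. \<Sum>k. ?f k \<nu>)"
    by (rule uniform_limit_theorem[rotated]) (auto intro!: always_eventually continuous_intros continuous_on_rGamma_shift)
  then show ?B by (rule continuous_on_interior) simp
qed

lemma isCont_bessel_J: "isCont (\<lambda>\<nu>. bessel_J \<nu> w) \<nu>0"
  unfolding bessel_J_def surf_powr_def powr_def
  by (intro continuous_intros isCont_bessel_J_series) auto

lemma sin_pi_times_nonzero:
  assumes "(\<nu> :: complex) \<notin> \<int>"
  shows "sin (of_real pi * \<nu>) \<noteq> 0"
  using assms by (simp add: sin_eq_0)
    (metis Ints_of_int mult.commute mult_cancel_left of_real_eq_0_iff of_real_mult of_real_of_int_eq pi_neq_zero)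

text \<open>The reflection formula turns \<open>Gamma (\<nu> - of_nat k)\<close> into the reciprocal
  Gamma coefficient of the Bessel series of order \<open>- \<nu>\<close>, with a sign alternating in
  \<open>k\<close>.\<close>

lemma blim_eq_bessel_J:
  assumes \<nu>: "\<nu> \<notin> \<int>"
  shows "blim \<nu> w = - (of_real pi / sin (of_real pi * \<nu>)) * bessel_J (- \<nu>) w"
proof -
  define v where "v = w - complex_of_real (ln 2)"
  define s where "s = sin (of_real pi * \<nu>)"
  have s: "s \<noteq> 0" using sin_pi_times_nonzero[OF \<nu>] by (simp add: s_def)
  let ?j = "\<lambda>k. (-1) ^ k * rGamma (- \<nu> + of_nat k + 1) / fact k * (surf_proj w / 2) ^ (2 * k)"
  have Gam: "Gamma (\<nu> - of_nat k) = (-1) ^ k * of_real pi / s * rGamma (- \<nu> + of_nat k + 1)" for k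
  proof -
    define z where "z = \<nu> - of_nat k"
    have z1: "1 - z \<notin> \<int>\<^sub>\<le>\<^sub>0"
    proof
      assume "1 - z \<in> \<int>\<^sub>\<le>\<^sub>0"
      then have "1 - (1 - z) + of_nat k \<in> \<int>" by (intro Ints_add Ints_diff Ints_of_nat) (auto elim: nonpos_Ints_cases)
      with \<nu> show False by (simp add: z_def)
    qed
    have "sin (of_real pi * z) = sin (of_real pi * \<nu> - of_real (of_int (int k) * pi))"
      by (simp add: z_def algebra_simps)
    also have "\<dots> = (-1) ^ k * s"
      unfolding sin_diff by (simp add: s_def sin_of_real[symmetric] cos_of_real[symmetric] del: of_real_mult of_int_of_nat_eq)
        (simp add: mult.commute)
    finally have sz: "sin (of_real pi * z) = (-1) ^ k * s" .
    have "Gamma z = Gamma z * Gamma (1 - z) * rGamma (1 - z)"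
      using z1 by (simp add: rGamma_inverse_Gamma Gamma_eq_zero_iff)
    also have "\<dots> = of_real pi / ((-1) ^ k * s) * rGamma (1 - z)"
      by (simp add: Gamma_reflection_complex sz)
    also have "of_real pi / ((-1) ^ k * s) = (-1) ^ k * of_real pi / s"
      using s by (simp add: divide_simps)
    finally show ?thesis by (simp add: z_def algebra_simps)
  qed
  have coeff: "bcoeff \<nu> w k * Gamma (\<nu> - of_nat k) = of_real pi / s * exp (- \<nu> * v) * ?j k" for k
  proof -
    have "bcoeff \<nu> w k = exp (- \<nu> * v) * exp (of_nat (2 * k) * v) / fact k"
      by (simp add: bcoeff_def v_def[symmetric] exp_add[symmetric] algebra_simps)
    also have "exp (of_nat (2 * k) * v) = (surf_proj w / 2) ^ (2 * k)"
      unfolding exp_of_nat_mult by (simp add: v_def exp_minus_ln2 surf_proj_def)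
    finally show ?thesis unfolding Gam by (simp only: divide_inverse mult_ac)
  qed
  then have "blim \<nu> w = - (of_real pi / s * exp (- \<nu> * v) * suminf ?j)"
    unfolding blim_def by (simp only: suminf_mult[OF bessel_J_summable])
  moreover have "exp (- \<nu> * v) = surf_powr w (- \<nu>) / 2 powr (- \<nu>)"
    by (simp add: v_def surf_powr_def powr_def exp_diff[symmetric] Ln_of_real[of 2, simplified] algebra_simps)
  ultimately show ?thesis by (simp add: bessel_J_def s_def mult.assoc)
qed

text \<open>The series contains only even powers of z, so continuation by an odd number of half
  turns affects the prefactor alone.\<close>

lemma bessel_J_rotate:
  assumes "exp c = -1"
  shows "bessel_J \<nu> (w + c) = exp (\<nu> * c) * bessel_J \<nu> w"
proof -
  have "surf_proj (w + c) = - surf_proj w" using assms by (simp add: surf_proj_def exp_add)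
  moreover have "surf_powr (w + c) \<nu> = exp (\<nu> * c) * surf_powr w \<nu>"
    by (simp add: surf_powr_def exp_add[symmetric] algebra_simps)
  ultimately show ?thesis by (simp add: bessel_J_def)
qed

text \<open>Below, \<open>\<sigma> = 1\<close> is the case of \<open>H\<^sup>(\<^sup>1\<^sup>)\<close> and \<open>\<sigma> = -1\<close> that of \<open>H\<^sup>(\<^sup>2\<^sup>)\<close>.\<close>

lemma hankel_not_Ints:
  assumes \<nu>: "\<nu> \<notin> \<int>" and \<sigma>: "\<sigma> = 1 \<or> \<sigma> = -1" and w': "w' = w - \<sigma> * \<i> * of_real pi"
  shows "bessel_J \<nu> w + \<sigma> * \<i> *
      ((bessel_J \<nu> w * cos (of_real pi * \<nu>) - bessel_J (- \<nu>) w) / sin (of_real pi * \<nu>)) =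
    \<sigma> * \<i> / of_real pi * (arm (Im w) (bker \<nu> w) + arm (Im w') (bker (- \<nu>) w'))"
proof -
  define s c where "s = sin (of_real pi * \<nu>)" "c = cos (of_real pi * \<nu>)"
  define J J' where "J = bessel_J \<nu> w" "J' = bessel_J (- \<nu>) w"
  have s: "s \<noteq> 0"
    using sin_pi_times_nonzero[OF \<nu>] by (simp add: s_c_def)
  have e: "exp (- (\<sigma> * \<i> * of_real pi)) = -1" using \<sigma> by (auto simp: exp_minus mult.commute[of \<i>])
  have \<nu>': "- \<nu> \<notin> \<int>" using \<nu> by simp
  have "arm (Im w) (bker \<nu> w) + arm (Im w') (bker (- \<nu>) w') = blim \<nu> w + blim (- \<nu>) w'"
    unfolding arm_bker_eq_blim[OF \<nu>] arm_bker_eq_blim[OF \<nu>']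
    using bser_0_reflect[OF \<nu>, of w' w] e by (simp add: w' exp_add[of w "- (\<sigma> * \<i> * of_real pi)", simplified])
  \<comment> \<open>The left arm supplies the function of order \<open>- \<nu>\<close> at z, the
    reflected arm the one of order \<open>\<nu>\<close> after a half turn; together they form the
    classical connection formula for the Hankel function.\<close>
  also have "\<dots> = of_real pi / s * (exp (- (\<sigma> * \<i> * (of_real pi * \<nu>))) * J - J')"
  proof -
    have "bessel_J \<nu> w' = exp (- (\<sigma> * \<i> * (of_real pi * \<nu>))) * J"
      using bessel_J_rotate[OF e, of \<nu> w] by (simp add: w' s_c_def J_J'_def mult_ac)
    then show ?thesis
      unfolding blim_eq_bessel_J[OF \<nu>] blim_eq_bessel_J[OF \<nu>']
      by (simp add: s_c_def J_J'_def algebra_simps)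
  qed
  also have "exp (- (\<sigma> * \<i> * (of_real pi * \<nu>))) = c - \<sigma> * \<i> * s"
    using \<sigma> exp_Euler[of "of_real pi * \<nu>"] exp_Euler[of "- (of_real pi * \<nu>)"]
    by (auto simp: s_c_def)
  also have "\<sigma> * \<i> / of_real pi * (of_real pi / s * ((c - \<sigma> * \<i> * s) * J - J')) =
      J + \<sigma> * \<i> * ((J * c - J') / s)"
    using s \<sigma> by (auto simp: field_simps)
  finally show ?thesis by (simp add: s_c_def J_J'_def)
qed

text \<open>At an integer order \<open>bessel_Y\<close> is a limit over nearby orders, all of them
  non-integer; the right-hand side and \<open>bessel_J\<close> are continuous in the order, so the
  identity passes to the limit.\<close>

lemma hankel_eq_arms:
  assumes \<sigma>: "\<sigma> = 1 \<or> \<sigma> = -1" and w': "w' = w - \<sigma> * \<i> * of_real pi"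
  shows "bessel_J \<nu> w + \<sigma> * \<i> * bessel_Y \<nu> w =
    \<sigma> * \<i> / of_real pi * (arm (Im w) (bker \<nu> w) + arm (Im w') (bker (- \<nu>) w'))"
proof (cases "\<nu> \<in> \<int>")
  case False
  then show ?thesis using hankel_not_Ints[OF False \<sigma> w'] by (simp add: bessel_Y_def)
next
  case True
  define H where "H = (\<lambda>\<nu>. \<sigma> * \<i> / of_real pi * (arm (Im w) (bker \<nu> w) + arm (Im w') (bker (- \<nu>) w')))"
  define Y where "Y = (\<lambda>\<mu>. (bessel_J \<mu> w * cos (of_real pi * \<mu>) - bessel_J (- \<mu>) w) / sin (of_real pi * \<mu>))"
  have \<sigma>0: "\<sigma> \<noteq> 0" using \<sigma> by auto
  have "isCont H \<nu>"
    unfolding H_def by (intro continuous_intros isCont_arm_bker isCont_o2[OF _ isCont_arm_bker])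
  then have lim: "((\<lambda>\<mu>. (H \<mu> - bessel_J \<mu> w) / (\<sigma> * \<i>)) \<longlongrightarrow> (H \<nu> - bessel_J \<nu> w) / (\<sigma> * \<i>)) (at \<nu>)"
    using isCont_bessel_J[of \<nu> w] \<sigma>0 unfolding isCont_def by (intro tendsto_intros) auto
  have "\<forall>\<^sub>F \<mu> in at \<nu>. (H \<mu> - bessel_J \<mu> w) / (\<sigma> * \<i>) = Y \<mu>"
  proof -
    obtain n where n: "\<nu> = of_int n" using True by (auto elim: Ints_cases)
    have "\<mu> \<notin> \<int>" if "\<mu> \<noteq> \<nu>" "dist \<mu> \<nu> < 1" for \<mu>
    proof
      assume "\<mu> \<in> \<int>"
      then obtain m where m: "\<mu> = of_int m" by (auto elim: Ints_cases)
      have "norm (of_int (m - n) :: complex) < 1" using that by (simp add: m n dist_norm)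
      then have "\<bar>m - n\<bar> < 1" unfolding norm_of_int by linarith
      then show False using that m n by simp
    qed
    then have "\<forall>\<^sub>F \<mu> in at \<nu>. \<mu> \<notin> \<int>"
      unfolding eventually_at by (intro exI[of _ 1]) auto
    then show ?thesis
    proof eventually_elim
      case (elim \<mu>)
      have "H \<mu> = bessel_J \<mu> w + \<sigma> * \<i> * Y \<mu>"
        unfolding H_def Y_def by (rule hankel_not_Ints[OF elim \<sigma> w', symmetric])
      then show ?case using \<sigma>0 by simp
    qed
  qed
  with lim have "(Y \<longlongrightarrow> (H \<nu> - bessel_J \<nu> w) / (\<sigma> * \<i>)) (at \<nu>)" by (rule Lim_transform_eventually)
  then have "Lim (at \<nu>) Y = (H \<nu> - bessel_J \<nu> w) / (\<sigma> * \<i>)" by (intro tendsto_Lim) auto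
  moreover have "bessel_Y \<nu> w = Lim (at \<nu>) Y" using True by (simp add: bessel_Y_def Y_def)
  ultimately have "bessel_J \<nu> w + \<sigma> * \<i> * bessel_Y \<nu> w = H \<nu>" using \<sigma>0 by simp
  then show ?thesis by (simp only: H_def)
qed

section \<open>Watson's lemma at the double saddle point\<close>

text \<open>The entire function 6 (sinh t - t) / t^3, given by its power series so that 0 is an
  ordinary point.\<close>

definition qfun :: "complex \<Rightarrow> complex" where
  "qfun t = (\<Sum>k. (if even k then 6 / fact (k + 3) else 0) * t ^ k)"

lemma qfun_summable: "summable (\<lambda>k. (if even k then 6 / fact (k + 3) else 0) * t ^ k :: complex)"
proof (rule summable_comparison_test')
  show "summable (\<lambda>k. 6 * (norm t ^ k /\<^sub>R fact k))" by (intro summable_mult summable_exp_generic)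
  fix k :: nat
  have "norm ((if even k then 6 / fact (k + 3) else 0) * t ^ k :: complex) \<le> 6 / fact (k + 3) * norm t ^ k"
    by (simp add: norm_mult norm_power norm_divide)
  also have "\<dots> \<le> 6 / fact k * norm t ^ k"
    by (intro mult_right_mono divide_left_mono fact_mono) auto
  finally show "norm ((if even k then 6 / fact (k + 3) else 0) * t ^ k :: complex) \<le> 6 * (norm t ^ k /\<^sub>R fact k)"
    by (simp add: divide_inverse mult_ac)
qed

lemma qfun_holomorphic [holomorphic_intros]: "qfun holomorphic_on A"
proof -
  have "\<exists>D. (qfun has_field_derivative D) (at t)" for t
    using termdiffs_strong_converges_everywhere[OF qfun_summable, of t] unfolding qfun_def[abs_def] by blast
  then show ?thesis
    by (meson field_differentiable_at_within field_differentiable_def holomorphic_on_def)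
qed

lemma qfun_0 [simp]: "qfun 0 = 1"
proof -
  have "qfun 0 = (\<Sum>k\<in>{0}. (if even k then 6 / fact (k + 3) else 0) * 0 ^ k)"
    unfolding qfun_def by (rule suminf_finite) auto
  also have "\<dots> = 1" by (simp add: fact_numeral)
  finally show ?thesis .
qed

lemma sinh_minus_self: "sinh t - t = t ^ 3 * qfun t / 6"
proof -
  let ?s = "\<lambda>n. if even n then 0 else t ^ n /\<^sub>R fact n"
  have S: "?s sums sinh t" by (rule sinh_converges)
  have shift: "?s (n + 3) = t ^ 3 / 6 * ((if even n then 6 / fact (n + 3) else 0) * t ^ n)" for n
  proof -
    have "t ^ (n + 3) /\<^sub>R F = t ^ 3 / 6 * (6 / of_real F * t ^ n)" for F
      by (simp add: scaleR_conv_of_real power_add field_simps)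
    from this[of "fact (n + 3)"] show ?thesis
      by (cases "even n") (simp_all only: of_real_fact even_add odd_numeral if_True if_False simp_thms mult_zero_left mult_zero_right)
  qed
  have "sinh t = (\<Sum>n. ?s (n + 3)) + (\<Sum>n<3. ?s n)"
    unfolding sums_unique[OF S] by (rule suminf_split_initial_segment[OF sums_summable[OF S]])
  also have "(\<Sum>n<3. ?s n) = t" by (simp add: numeral_3_eq_3)
  also have "(\<Sum>n. ?s (n + 3)) = t ^ 3 / 6 * qfun t"
    unfolding shift qfun_def by (rule suminf_mult[OF qfun_summable])
  finally show ?thesis by simp
qed

text \<open>The identity extends to the nonzero roots of sinh t = t, where both sides take the value
  0 of division by zero.\<close>

lemma B_base_eq: "B_base t = 1 / qfun t"
proof (cases "t = 0")
  case False
  then show ?thesis by (simp add: B_base_def sinh_minus_self)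
qed (simp add: B_base_def)

text \<open>Lagrange inversion, without inverting \<open>\<sigma>\<close>: the coefficients of an expansion in powers of
  \<open>\<sigma>(t) = t h(t)\<close> weighted by \<open>\<sigma>'\<close> are read off by integrating over a small circle.\<close>

lemma expansion_in_powers:
  assumes r: "r > 0" and h: "h holomorphic_on ball 0 r" "\<And>t. t \<in> ball 0 r \<Longrightarrow> h t \<noteq> 0"
    and \<phi>: "\<phi> holomorphic_on ball 0 r"
  defines "\<sigma> \<equiv> \<lambda>t. t * h t"
  shows "\<exists>c R. R holomorphic_on ball 0 r \<and>
    (\<forall>t\<in>ball 0 r. \<phi> t = (\<Sum>n<N. c n * (\<sigma> t ^ n * deriv \<sigma> t)) + \<sigma> t ^ N * R t)"
proof (induction N)
  case 0
  then show ?case using \<phi> by auto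
next
  case (Suc N)
  then obtain c R where R: "R holomorphic_on ball 0 r"
    and eq: "\<And>t. t \<in> ball 0 r \<Longrightarrow> \<phi> t = (\<Sum>n<N. c n * (\<sigma> t ^ n * deriv \<sigma> t)) + \<sigma> t ^ N * R t"
    by blast
  have \<sigma>: "\<sigma> holomorphic_on ball 0 r" unfolding \<sigma>_def by (intro holomorphic_intros h)
  have "(\<sigma> has_field_derivative 1 * h 0 + deriv h 0 * 0) (at 0)"
    unfolding \<sigma>_def using r
    by (intro DERIV_mult DERIV_ident holomorphic_derivI[OF h(1)]) auto
  then have \<sigma>'0: "deriv \<sigma> 0 = h 0" by (simp add: DERIV_imp_deriv)
  have h0: "h 0 \<noteq> 0" using h(2) r by simp
  \<comment> \<open>The coefficient is chosen to make \<open>R - a * deriv \<sigma>\<close> vanish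
    at 0, where \<open>deriv \<sigma>\<close> equals \<open>h 0\<close>; the difference can then be
    divided by \<open>\<sigma>\<close> holomorphically.\<close>
  define a where "a = R 0 / h 0"
  define g where "g = (\<lambda>t. R t - a * deriv \<sigma> t)"
  have g: "g holomorphic_on ball 0 r" unfolding g_def by (intro holomorphic_intros R \<sigma>) auto
  have g0: "g 0 = 0" using h0 by (simp add: g_def a_def \<sigma>'0)
  define k where "k = (\<lambda>t. if t = 0 then deriv g 0 else g t / t)"
  have k: "k holomorphic_on ball 0 r"
    by (rule pole_theorem_open_0[OF g, of 0]) (auto simp: k_def g0)
  have main: "\<phi> t = (\<Sum>n<Suc N. (if n = N then a else c n) * (\<sigma> t ^ n * deriv \<sigma> t)) + \<sigma> t ^ Suc N * (k t / h t)"
    if t: "t \<in> ball 0 r" for t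
  proof -
    have "R t = a * deriv \<sigma> t + \<sigma> t * (k t / h t)"
      using h(2)[OF t] g0 by (cases "t = 0") (auto simp: k_def g_def \<sigma>_def)
    then show ?thesis unfolding eq[OF t] by (simp add: algebra_simps)
  qed
  have hol: "(\<lambda>t. k t / h t) holomorphic_on ball 0 r" by (intro holomorphic_intros k h)
  show ?case
    by (rule exI[of _ "\<lambda>n. if n = N then a else c n"], rule exI[of _ "\<lambda>t. k t / h t"])
       (intro conjI ballI hol main)
qed

lemma power_mult_divide_power:
  fixes x y :: complex
  assumes "x \<noteq> 0" "n < m"
  shows "x ^ m * y / x ^ (n + 1) = x ^ (m - Suc n) * y"
proof -
  have "m = (m - Suc n) + (n + 1)" using assms(2) by simp
  then have "x ^ m = x ^ (m - Suc n) * x ^ (n + 1)" by (metis power_add)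
  then show ?thesis using assms(1) by simp
qed

text \<open>After division by \<open>\<sigma> t ^ (n + 1)\<close>, the terms with
  \<open>m < n\<close> have a single-valued primitive, those with \<open>m > n\<close> and the
  remainder are holomorphic. Only \<open>m = n\<close> survives, as the logarithmic derivative at
  the simple zero of \<open>\<sigma>\<close>. Cauchy's formula evaluates the same integral in terms
  of \<open>h\<close>.\<close>

lemma expansion_coeff:
  assumes r: "r > 0" and h: "h holomorphic_on ball 0 r" "\<And>t. t \<in> ball 0 r \<Longrightarrow> h t \<noteq> 0"
    and \<phi>: "\<phi> holomorphic_on ball 0 r"
  defines "\<sigma> \<equiv> \<lambda>t. t * h t"
  assumes R: "R holomorphic_on ball 0 r"
    and eq: "\<And>t. t \<in> ball 0 r \<Longrightarrow> \<phi> t = (\<Sum>n<N. c n * (\<sigma> t ^ n * deriv \<sigma> t)) + \<sigma> t ^ N * R t"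
    and n: "n < N"
  shows "c n = 1 / fact n * (deriv ^^ n) (\<lambda>t. \<phi> t / h t ^ (n + 1)) 0"
proof -
  define \<rho> where "\<rho> = r / 2"
  have \<rho>: "0 < \<rho>" "\<rho> < r" using r by (auto simp: \<rho>_def)
  let ?C = "circlepath (0 :: complex) \<rho>"
  let ?S = "ball (0 :: complex) r - {0}"
  have img: "path_image ?C \<subseteq> ?S" using \<rho> by (auto simp: path_image_circlepath)
  have \<sigma>: "\<sigma> holomorphic_on ball 0 r" unfolding \<sigma>_def by (intro holomorphic_intros h)
  have \<sigma>0: "\<sigma> t \<noteq> 0" if "t \<in> ?S" for t using that h(2) by (auto simp: \<sigma>_def)
  have \<sigma>': "(\<sigma> has_field_derivative deriv \<sigma> t) (at t)" if "t \<in> ball 0 r" for t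
    by (rule holomorphic_derivI[OF \<sigma> open_ball that])
  have closed: "(f has_contour_integral 0) ?C"
    if "\<And>t. t \<in> ?S \<Longrightarrow> (F has_field_derivative f t) (at t)" for f F
    using contour_integral_primitive[of ?S F f ?C] that img by (auto intro: has_field_derivative_at_within)
  have hol0: "(f has_contour_integral 0) ?C" if "f holomorphic_on ball 0 r" for f
    by (rule Cauchy_theorem_convex_simple[OF that]) (use img in auto)
  have I1: "((\<lambda>t. \<sigma> t ^ m * deriv \<sigma> t / \<sigma> t ^ (n + 1)) has_contour_integral
      (if m = n then 2 * pi * \<i> else 0)) ?C" for m
  proof -
    consider "m > n" | "m < n" | "m = n" by linarith
    then show ?thesis
    proof cases
      case 1
      have "((\<lambda>t. \<sigma> t ^ (m - Suc n) * deriv \<sigma> t) has_contour_integral 0) ?C"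
        by (rule hol0) (intro holomorphic_intros \<sigma> open_ball)
      then have "((\<lambda>t. \<sigma> t ^ m * deriv \<sigma> t / \<sigma> t ^ (n + 1)) has_contour_integral 0) ?C"
      proof (rule has_contour_integral_eq)
        fix t assume "t \<in> path_image ?C"
        then have "t \<in> ?S" using img by blast
        from power_mult_divide_power[OF \<sigma>0[OF this] 1]
        show "\<sigma> t ^ (m - Suc n) * deriv \<sigma> t = \<sigma> t ^ m * deriv \<sigma> t / \<sigma> t ^ (n + 1)" ..
      qed
      then show ?thesis using 1 by simp
    next
      case 2
      define j where "j = n - m"
      have j: "j > 0" "n = m + j" using 2 by (auto simp: j_def)
      have "((\<lambda>t. \<sigma> t ^ m * deriv \<sigma> t / \<sigma> t ^ (n + 1)) has_contour_integral 0) ?C"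
      proof (rule closed)
        fix t assume t: "t \<in> ?S"
        have "((\<lambda>t. - (1 / of_nat j) * inverse (\<sigma> t ^ j)) has_field_derivative
            - (1 / of_nat j) * (- (inverse (\<sigma> t ^ j) * (of_nat j * (deriv \<sigma> t * \<sigma> t ^ (j - Suc 0))) * inverse (\<sigma> t ^ j)))) (at t)"
          using t \<sigma>0[OF t] by (intro DERIV_cmult DERIV_inverse' DERIV_power \<sigma>') auto
        also have "- (1 / of_nat j) * (- (inverse (\<sigma> t ^ j) * (of_nat j * (deriv \<sigma> t * \<sigma> t ^ (j - Suc 0))) * inverse (\<sigma> t ^ j)))
            = \<sigma> t ^ m * deriv \<sigma> t / \<sigma> t ^ (n + 1)"
        proof -
          have nz: "of_nat j \<noteq> (0 :: complex)" using j by simp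
          obtain i where i: "j = Suc i" using j by (cases j) auto
          have "\<sigma> t ^ (j - Suc 0) = \<sigma> t ^ j / \<sigma> t" "\<sigma> t ^ (n + 1) = \<sigma> t ^ m * \<sigma> t ^ j * \<sigma> t"
            using \<sigma>0[OF t] by (simp_all add: i j(2) power_add)
          then show ?thesis using nz \<sigma>0[OF t] by (simp add: field_simps)
        qed
        finally show "((\<lambda>t. - (1 / of_nat j) * inverse (\<sigma> t ^ j)) has_field_derivative
            \<sigma> t ^ m * deriv \<sigma> t / \<sigma> t ^ (n + 1)) (at t)" .
      qed
      then show ?thesis using 2 by simp
    next
      case 3
      have "((\<lambda>t. 1 / (t - 0)) has_contour_integral 2 * pi * \<i> * 1) ?C"
        using Cauchy_integral_circlepath_simple[of "\<lambda>_. 1" 0 \<rho> 0] \<rho> by simp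
      moreover have "((\<lambda>t. deriv h t / h t) has_contour_integral 0) ?C"
        by (rule hol0) (intro holomorphic_intros h open_ball)
      ultimately have "((\<lambda>t. 1 / (t - 0) + deriv h t / h t) has_contour_integral 2 * pi * \<i> * 1 + 0) ?C"
        by (rule has_contour_integral_add)
      then have "((\<lambda>t. \<sigma> t ^ m * deriv \<sigma> t / \<sigma> t ^ (n + 1)) has_contour_integral 2 * pi * \<i> * 1 + 0) ?C"
      proof (rule has_contour_integral_eq)
        fix t assume "t \<in> path_image ?C"
        then have t: "t \<in> ?S" using img by blast
        have "(\<sigma> has_field_derivative 1 * h t + deriv h t * t) (at t)"
          unfolding \<sigma>_def using t
          by (intro DERIV_mult DERIV_ident holomorphic_derivI[OF h(1)]) auto
        then have "deriv \<sigma> t = h t + deriv h t * t" by (simp add: DERIV_imp_deriv)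
        then show "1 / (t - 0) + deriv h t / h t = \<sigma> t ^ m * deriv \<sigma> t / \<sigma> t ^ (n + 1)"
          using \<sigma>0[OF t] t h(2)[of t] 3 by (simp add: \<sigma>_def divide_simps)
      qed
      then show ?thesis using 3 by simp
    qed
  qed
  have I2: "((\<lambda>t. \<sigma> t ^ N * R t / \<sigma> t ^ (n + 1)) has_contour_integral 0) ?C"
  proof -
    have "((\<lambda>t. \<sigma> t ^ (N - Suc n) * R t) has_contour_integral 0) ?C"
      by (rule hol0) (intro holomorphic_intros \<sigma> R)
    then show ?thesis
    proof (rule has_contour_integral_eq)
      fix t assume "t \<in> path_image ?C"
      then have "t \<in> ?S" using img by blast
      from power_mult_divide_power[OF \<sigma>0[OF this] n]
      show "\<sigma> t ^ (N - Suc n) * R t = \<sigma> t ^ N * R t / \<sigma> t ^ (n + 1)" ..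
    qed
  qed
  have "((\<lambda>t. (\<Sum>m<N. c m * (\<sigma> t ^ m * deriv \<sigma> t / \<sigma> t ^ (n + 1))) + \<sigma> t ^ N * R t / \<sigma> t ^ (n + 1))
      has_contour_integral (\<Sum>m<N. c m * (if m = n then 2 * pi * \<i> else 0)) + 0) ?C"
    by (intro has_contour_integral_add has_contour_integral_sum has_contour_integral_lmul I1 I2) auto
  then have "((\<lambda>t. \<phi> t / \<sigma> t ^ (n + 1)) has_contour_integral (\<Sum>m<N. c m * (if m = n then 2 * pi * \<i> else 0)) + 0) ?C"
  proof (rule has_contour_integral_eq)
    fix t assume "t \<in> path_image ?C"
    then have "t \<in> ball 0 r" using img by blast
    from eq[OF this] show "(\<Sum>m<N. c m * (\<sigma> t ^ m * deriv \<sigma> t / \<sigma> t ^ (n + 1))) + \<sigma> t ^ N * R t / \<sigma> t ^ (n + 1)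
        = \<phi> t / \<sigma> t ^ (n + 1)"
      by (simp add: add_divide_distrib sum_divide_distrib)
  qed
  also have "(\<Sum>m<N. c m * (if m = n then 2 * pi * \<i> else 0)) + 0 = c n * (2 * pi * \<i>)"
    using n by (simp add: if_distrib cong: if_cong)
  finally have L: "contour_integral ?C (\<lambda>t. \<phi> t / \<sigma> t ^ (n + 1)) = c n * (2 * pi * \<i>)"
    by (rule contour_integral_unique)
  have H: "(\<lambda>t. \<phi> t / h t ^ (n + 1)) holomorphic_on ball 0 r"
    by (intro holomorphic_intros \<phi> h) (use h(2) in auto)
  have "contour_integral ?C (\<lambda>t. \<phi> t / h t ^ (n + 1) / (t - 0) ^ Suc n) =
      (2 * pi * \<i>) * (deriv ^^ n) (\<lambda>t. \<phi> t / h t ^ (n + 1)) 0 / fact n"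
    using \<rho> by (intro Cauchy_contour_integral_circlepath holomorphic_on_imp_continuous_on
        holomorphic_on_subset[OF H]) auto
  moreover have "(\<lambda>t. \<phi> t / h t ^ (n + 1) / (t - 0) ^ Suc n) = (\<lambda>t. \<phi> t / \<sigma> t ^ (n + 1))"
    by (simp add: \<sigma>_def power_mult_distrib mult_ac fun_eq_iff)
  ultimately have "(2 * pi * \<i>) * c n = (2 * pi * \<i>) * (1 / fact n * (deriv ^^ n) (\<lambda>t. \<phi> t / h t ^ (n + 1)) 0)"
    using L by (simp add: mult_ac)
  then show ?thesis by (subst (asm) mult_cancel_left) simp
qed

text \<open>Trades cubic exponential decay for a rational function with an explicit primitive. For
  \<open>y > 1\<close> the cube is replaced by a square, which is then completed.\<close>

lemma exp_cube_times_power_le: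
  fixes c y :: real
  assumes c: "c > 0" and y: "y \<ge> 0"
  shows "exp (- c * y ^ 3) * (1 + y) ^ K \<le> exp (real K + (real K)\<^sup>2 / (4 * c))"
proof -
  have "(1 + y) ^ K \<le> exp y ^ K" using y by (intro power_mono) auto
  then have "exp (- c * y ^ 3) * (1 + y) ^ K \<le> exp (- c * y ^ 3) * exp y ^ K"
    by (intro mult_left_mono) auto
  also have "\<dots> = exp (real K * y - c * y ^ 3)"
    by (simp add: exp_of_nat_mult[symmetric] exp_add[symmetric])
  also have "real K * y - c * y ^ 3 \<le> real K + (real K)\<^sup>2 / (4 * c)"
  proof (cases "y \<le> 1")
    case True
    then have "real K * y \<le> real K * 1" by (intro mult_left_mono) auto
    moreover have "0 \<le> c * y ^ 3" "0 \<le> (real K)\<^sup>2 / (4 * c)" using c y by auto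
    ultimately show ?thesis by linarith
  next
    case False
    have "c * y\<^sup>2 \<le> c * y ^ 3" using False c by (intro mult_left_mono power_increasing) auto
    moreover have "0 \<le> (real K - 2 * c * y)\<^sup>2 / (4 * c)" using c by simp
    moreover have "(real K - 2 * c * y)\<^sup>2 / (4 * c) = (real K)\<^sup>2 / (4 * c) - real K * y + c * y\<^sup>2"
      using c by (simp add: field_simps power2_eq_square)
    ultimately show ?thesis by linarith
  qed
  then have "exp (real K * y - c * y ^ 3) \<le> exp (real K + (real K)\<^sup>2 / (4 * c))" by simp
  finally show ?thesis .
qed

text \<open>The integrand is compared with the derivative of \<open>(x / (1 + b x)) ^ (N + 1) / (N + 1)\<close>, where
  \<open>b = exp (X / 3)\<close>; this avoids evaluating an integral.\<close>

lemma watson_remainder: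
  fixes F f :: "complex \<Rightarrow> complex"
  assumes c: "c > 0" and \<rho>: "\<rho> > 0" and M: "M \<ge> 0"
    and F: "\<And>x. x \<in> {0..\<rho>} \<Longrightarrow> (F has_field_derivative f (of_real x * d)) (at (of_real x * d))"
    and le: "\<And>x. x \<in> {0..\<rho>} \<Longrightarrow> norm (f (of_real x * d) * d) \<le> M * x ^ N * exp (- c * exp X * x ^ 3)"
  shows "norm (F (of_real \<rho> * d) - F 0) \<le>
    M * exp (real (N + 2) + (real (N + 2))\<^sup>2 / (4 * c)) / real (N + 1) * exp (- (real (N + 1) / 3) * X)"
proof -
  define b K where "b = exp (X / 3)" "K = exp (real (N + 2) + (real (N + 2))\<^sup>2 / (4 * c))"
  have b: "b > 0" "K > 0" by (simp_all add: b_K_def)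
  have b3: "b ^ 3 = exp X" unfolding b_K_def exp_of_nat_mult[symmetric] by simp
  have bN: "exp (- (real (N + 1) / 3) * X) = (1 / b) ^ (N + 1)"
  proof -
    have "exp (- (real (N + 1) / 3) * X) = exp (of_nat (N + 1) * (- X / 3))" by (simp add: field_simps)
    also have "\<dots> = exp (- X / 3) ^ (N + 1)" by (rule exp_of_nat_mult)
    also have "exp (- X / 3) = 1 / b" using exp_minus[of "X / 3"] by (simp add: b_K_def(1) inverse_eq_divide)
    finally show ?thesis .
  qed
  \<comment> \<open>The derivative carries the denominator to the power N + 2: N from the power rule
    and 2 from x / (1 + b x). With \<open>X\<close> the logarithm of |z|, the bound x / (1 + b x) <
    1 / b yields the order |z|^(-(N+1)/3).\<close>
  define \<Phi> where "\<Phi> = (\<lambda>x. M * K / real (N + 1) * (x / (1 + b * x)) ^ (N + 1))"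
  have "norm (F (0 + of_real \<rho> * d) - F (0 + of_real 0 * d)) \<le> \<Phi> \<rho> - \<Phi> 0"
  proof (rule norm_diff_le_of_deriv_bound[where f = f and
        \<phi>' = "\<lambda>x. M * K * (x ^ N / (1 + b * x) ^ (N + 2))"])
    fix x assume x: "x \<in> {0..\<rho>}"
    then have pos: "1 + b * x > 0" using b by (auto intro: add_pos_nonneg)
    show "(F has_field_derivative f (0 + of_real x * d)) (at (0 + of_real x * d))" using F[OF x] by simp
    have 1: "((\<lambda>x. x / (1 + b * x)) has_real_derivative 1 / (1 + b * x)\<^sup>2) (at x)"
      using pos by (auto intro!: derivative_eq_intros simp: field_simps power2_eq_square)
    have "(\<Phi> has_real_derivative M * K / real (N + 1) *
        (of_nat (N + 1) * (1 / (1 + b * x)\<^sup>2 * (x / (1 + b * x)) ^ (N + 1 - Suc 0)))) (at x)"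
      unfolding \<Phi>_def by (intro DERIV_cmult DERIV_power 1)
    also have "M * K / real (N + 1) * (of_nat (N + 1) * (1 / (1 + b * x)\<^sup>2 * (x / (1 + b * x)) ^ (N + 1 - Suc 0)))
        = M * K * (x ^ N / (1 + b * x) ^ (N + 2))"
    proof -
      have "M * K / n * (n * (1 / p\<^sup>2 * (x / p) ^ N)) = M * K * (x ^ N / p ^ (N + 2))" if "n \<noteq> 0" "p \<noteq> 0" for n p
        using that by (simp add: power_divide power_add power2_eq_square field_simps)
      from this[of "real (N + 1)" "1 + b * x"] pos show ?thesis by simp
    qed
    finally show "(\<Phi> has_real_derivative M * K * (x ^ N / (1 + b * x) ^ (N + 2))) (at x)" .
    have "exp (- c * (b * x) ^ 3) * (1 + b * x) ^ (N + 2) \<le> K"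
      unfolding b_K_def(2) using x b by (intro exp_cube_times_power_le c) auto
    then have "exp (- c * (b * x) ^ 3) \<le> K / (1 + b * x) ^ (N + 2)"
      using pos by (simp add: pos_le_divide_eq)
    moreover have "(b * x) ^ 3 = exp X * x ^ 3" by (simp add: power_mult_distrib b3)
    ultimately have "M * x ^ N * exp (- c * exp X * x ^ 3) \<le> M * x ^ N * (K / (1 + b * x) ^ (N + 2))"
      using x M by (intro mult_left_mono) (auto simp: mult.assoc)
    with le[OF x] show "norm (f (0 + of_real x * d) * d) \<le> M * K * (x ^ N / (1 + b * x) ^ (N + 2))"
      by (simp add: mult_ac)
  qed (use \<rho> in auto)
  also have "\<Phi> \<rho> - \<Phi> 0 \<le> M * K / real (N + 1) * (1 / b) ^ (N + 1)"
  proof -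
    have "\<rho> / (1 + b * \<rho>) \<le> 1 / b" using b \<rho> by (simp add: field_simps add_pos_pos)
    then have "(\<rho> / (1 + b * \<rho>)) ^ (N + 1) \<le> (1 / b) ^ (N + 1)"
      using b \<rho> by (intro power_mono) (auto simp: add_pos_pos less_imp_le)
    then have "M * K / real (N + 1) * (\<rho> / (1 + b * \<rho>)) ^ (N + 1) \<le> M * K / real (N + 1) * (1 / b) ^ (N + 1)"
      using M b by (intro mult_left_mono) auto
    then show ?thesis by (simp add: \<Phi>_def)
  qed
  finally show ?thesis unfolding bN b_K_def by simp
qed

text \<open>The coefficient of z^(-(n+1)/3) in the integral of u^n exp (z u^3 / 6) over u from 0 to
  minus infinity; the sign comes from u = -v.\<close>

definition arm_const :: "nat \<Rightarrow> complex" where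
  "arm_const n = (-1) ^ (n + 1) * 6 powr (of_nat (n + 1) / 3) * Gamma (of_nat (n + 1) / 3) / 3"

definition arm_sum :: "complex \<Rightarrow> nat \<Rightarrow> complex \<Rightarrow> complex" where
  "arm_sum \<kappa> N w = (\<Sum>n<N. B_poly n \<kappa> * (arm_const n * exp (- (of_nat (n + 1) / 3) * w)))"

text \<open>Off the nonpositive real axis \<open>Ln\<close> of an inverse is minus
  \<open>Ln\<close>, so the principal power in \<open>B_poly\<close> agrees near 0 with the
  reciprocal power of the cube root \<open>h\<close>.\<close>

lemma B_poly_eq:
  assumes r: "r > 0" and q: "\<And>t. t \<in> ball 0 r \<Longrightarrow> qfun t \<notin> \<real>\<^sub>\<le>\<^sub>0"
  defines "h \<equiv> \<lambda>t. exp (Ln (qfun t) / 3)"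
  shows "B_poly n \<kappa> = 1 / fact n * (deriv ^^ n) (\<lambda>t. exp (\<kappa> * t) / h t ^ (n + 1)) 0"
proof -
  have h: "h holomorphic_on ball 0 r" unfolding h_def using q by (intro holomorphic_intros) auto
  have eq: "exp (\<kappa> * t) / h t ^ (n + 1) = exp (\<kappa> * t) * B_base t powr (of_nat (n + 1) / 3)"
    if t: "t \<in> ball 0 r" for t
  proof -
    have "qfun t \<noteq> 0" using q[OF t] by auto
    then have "B_base t powr (of_nat (n + 1) / 3) = exp (of_nat (n + 1) / 3 * Ln (inverse (qfun t)))"
      by (simp add: B_base_eq powr_def inverse_eq_divide)
    also have "Ln (inverse (qfun t)) = - Ln (qfun t)" by (rule Ln_inverse[OF q[OF t]])
    also have "exp (of_nat (n + 1) / 3 * - Ln (qfun t)) = inverse (exp (of_nat (n + 1) * (Ln (qfun t) / 3)))"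
      by (simp add: exp_minus[symmetric])
    also have "exp (of_nat (n + 1) * (Ln (qfun t) / 3)) = h t ^ (n + 1)"
      unfolding h_def by (rule exp_of_nat_mult)
    finally have "B_base t powr (of_nat (n + 1) / 3) = inverse (h t ^ (n + 1))" .
    then show ?thesis by (simp only: divide_inverse)
  qed
  have H: "(\<lambda>t. exp (\<kappa> * t) / h t ^ (n + 1)) holomorphic_on ball 0 r"
    by (intro holomorphic_intros h) (auto simp: h_def)
  then have H': "(\<lambda>t. exp (\<kappa> * t) * B_base t powr (of_nat (n + 1) / 3)) holomorphic_on ball 0 r"
    by (rule holomorphic_transform) (use eq in auto)
  show ?thesis unfolding B_poly_def
    using higher_deriv_transform_within_open[OF H H' open_ball, of 0 n] eq r by simp
qed

text \<open>Written with \<open>gser\<close> instead of \<open>igam\<close>, the primitive involves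
  no logarithm and is differentiable at the saddle itself, where \<open>\<sigma>\<close>
  vanishes.\<close>

lemma has_field_derivative_cubic_primitive:
  assumes \<sigma>: "(\<sigma> has_field_derivative \<sigma>') (at t)"
  shows "((\<lambda>t. \<sigma> t ^ (n + 1) / 3 * gser (of_nat (n + 1) / 3) (z * \<sigma> t ^ 3 / 6)) has_field_derivative
    exp (z * \<sigma> t ^ 3 / 6) * (\<sigma> t ^ n * \<sigma>')) (at t)"
proof -
  define s where "s = (of_nat (n + 1) / 3 :: complex)"
  have "s = of_real (real (n + 1) / 3)" by (simp add: s_def)
  then have "s \<notin> \<int>\<^sub>\<le>\<^sub>0" by (auto elim!: nonpos_Ints_cases simp: complex_eq_iff)
  then obtain D where D: "(gser s has_field_derivative D) (at (z * \<sigma> t ^ 3 / 6))"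
    and ode: "z * \<sigma> t ^ 3 / 6 * D + s * gser s (z * \<sigma> t ^ 3 / 6) = exp (z * \<sigma> t ^ 3 / 6)"
    using gser_ode by metis
  have 1: "((\<lambda>t. z * \<sigma> t ^ 3 / 6) has_field_derivative z * \<sigma> t ^ 2 * \<sigma>' / 2) (at t)"
    using \<sigma> by (auto intro!: derivative_eq_intros simp: field_simps)
  have 2: "((\<lambda>t. \<sigma> t ^ (n + 1) / 3) has_field_derivative s * \<sigma> t ^ n * \<sigma>') (at t)"
    using DERIV_cdivide[OF DERIV_power[OF \<sigma>, of "n + 1"], of 3] by (simp add: s_def algebra_simps)
  have "((\<lambda>t. \<sigma> t ^ (n + 1) / 3 * gser s (z * \<sigma> t ^ 3 / 6)) has_field_derivative
      s * \<sigma> t ^ n * \<sigma>' * gser s (z * \<sigma> t ^ 3 / 6) + D * (z * \<sigma> t ^ 2 * \<sigma>' / 2) * (\<sigma> t ^ (n + 1) / 3)) (at t)"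
    by (rule DERIV_mult[OF 2 DERIV_chain2[OF D 1]])
  also have "s * \<sigma> t ^ n * \<sigma>' * gser s (z * \<sigma> t ^ 3 / 6) + D * (z * \<sigma> t ^ 2 * \<sigma>' / 2) * (\<sigma> t ^ (n + 1) / 3)
      = (z * \<sigma> t ^ 3 / 6 * D + s * gser s (z * \<sigma> t ^ 3 / 6)) * (\<sigma> t ^ n * \<sigma>')"
    by (simp add: power3_eq_cube power2_eq_square algebra_simps)
  finally show ?thesis unfolding ode unfolding s_def .
qed

text \<open>At the far end of the local path a logarithm \<open>l\<close> of \<open>\<sigma>\<close>
  is available. The shift by 3 pi \<i> selects the branch of the logarithm of -z \<sigma>^3 / 6
  suited to directions near the negative axis, and it produces the sign of
  \<open>arm_const\<close>.\<close>

lemma cubic_primitive_eq: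
  assumes \<sigma>: "\<sigma> = exp l" and y: "y = w + 3 * l - of_real (ln 6) - 3 * of_real pi * \<i>"
  shows "\<sigma> ^ (n + 1) / 3 * gser (of_nat (n + 1) / 3) (exp w * \<sigma> ^ 3 / 6) =
    (-1) ^ (n + 1) * 6 powr (of_nat (n + 1) / 3) / 3 * exp (- (of_nat (n + 1) / 3) * w) * igam (of_nat (n + 1) / 3) y"
proof -
  define s where "s = (of_nat (n + 1) / 3 :: complex)"
  have s3: "3 * s = of_nat (n + 1)" by (simp add: s_def)
  have e3: "exp (3 * of_real pi * \<i>) = (-1 :: complex)"
  proof -
    have "exp (of_nat 3 * (of_real pi * \<i>)) = (-1 :: complex) ^ 3"
      unfolding exp_of_nat_mult by simp
    then show ?thesis by (simp add: mult.assoc)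
  qed
  have "exp (3 * l) = \<sigma> ^ 3" using exp_of_nat_mult[of 3 l] by (simp add: \<sigma>)
  then have "exp y = - (exp w * \<sigma> ^ 3 / 6)"
    by (simp add: y exp_diff exp_add e3 exp_of_real)
  then have "igam s y = exp (s * y) * gser s (exp w * \<sigma> ^ 3 / 6)" by (simp add: igam_def)
  then have g: "gser s (exp w * \<sigma> ^ 3 / 6) = exp (- s * y) * igam s y"
    by (simp add: exp_minus)
  have "exp (of_nat (n + 1) * l) * exp (- s * y) =
      exp (of_nat (n + 1) * (of_real pi * \<i>)) * exp (s * of_real (ln 6)) * exp (- s * w)"
    unfolding exp_add[symmetric] s3[symmetric] y by (simp add: algebra_simps)
  also have "exp (of_nat (n + 1) * (of_real pi * \<i>)) = (-1 :: complex) ^ (n + 1)"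
    unfolding exp_of_nat_mult by simp
  also have "exp (s * of_real (ln 6)) = 6 powr s"
    using Ln_of_real[of 6] by (simp add: powr_def)
  finally have "\<sigma> ^ (n + 1) * exp (- s * y) = (-1) ^ (n + 1) * 6 powr s * exp (- s * w)"
    by (simp only: \<sigma> exp_of_nat_mult)
  then show ?thesis unfolding s_def[symmetric] g by (simp add: field_simps del: power_Suc)
qed

lemma bker_eq_cubic: "bker (exp w - \<kappa>) w t = exp (exp w * (t ^ 3 * qfun t) / 6) * exp (\<kappa> * t)"
proof -
  have "exp w * sinh t - (exp w - \<kappa>) * t = exp w * (sinh t - t) + \<kappa> * t" by (simp add: algebra_simps)
  then show ?thesis by (simp add: bker_def sinh_minus_self exp_add)
qed

lemma qfun_near_0:
  assumes "\<epsilon> > 0"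
  obtains r where "r > 0" "\<And>t. t \<in> ball 0 r \<Longrightarrow> qfun t \<notin> \<real>\<^sub>\<le>\<^sub>0"
    "\<And>t. t \<in> ball 0 r \<Longrightarrow> 1 / 2 \<le> norm (qfun t)" "\<And>t. t \<in> ball 0 r \<Longrightarrow> \<bar>Im (Ln (qfun t))\<bar> \<le> \<epsilon>"
proof -
  have "isCont qfun 0"
    using holomorphic_on_imp_continuous_on[OF qfun_holomorphic[of UNIV]]
    by (simp add: continuous_on_eq_continuous_at)
  then have q: "(qfun \<longlongrightarrow> 1) (nhds 0)" by (simp add: isCont_def tendsto_nhds_iff)
  have "((\<lambda>t. Im (Ln (qfun t))) \<longlongrightarrow> Im (Ln 1)) (nhds 0)"
    by (intro tendsto_intros q) (auto simp: complex_nonpos_Reals_iff)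
  then have "\<forall>\<^sub>F t in nhds 0. dist (Im (Ln (qfun t))) (Im (Ln 1)) < \<epsilon>" using assms by (rule tendstoD)
  moreover have "\<forall>\<^sub>F t in nhds 0. dist (qfun t) 1 < 1 / 2" by (rule tendstoD[OF q]) simp
  ultimately have "\<forall>\<^sub>F t in nhds 0. qfun t \<notin> \<real>\<^sub>\<le>\<^sub>0 \<and> 1 / 2 \<le> norm (qfun t) \<and> \<bar>Im (Ln (qfun t))\<bar> \<le> \<epsilon>"
  proof eventually_elim
    case (elim t)
    have "Re (1 - qfun t) \<le> norm (1 - qfun t)" by (rule complex_Re_le_cmod)
    also have "\<dots> < 1 / 2" using elim(2) by (simp add: dist_norm norm_minus_commute)
    finally have "Re (qfun t) > 1 / 2" by simp
    moreover have "Re (qfun t) \<le> norm (qfun t)" by (rule complex_Re_le_cmod)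
    ultimately show ?case using elim(1) by (auto simp: complex_nonpos_Reals_iff)
  qed
  then obtain r where "r > 0" and r: "\<And>t. dist t 0 < r \<Longrightarrow>
      qfun t \<notin> \<real>\<^sub>\<le>\<^sub>0 \<and> 1 / 2 \<le> norm (qfun t) \<and> \<bar>Im (Ln (qfun t))\<bar> \<le> \<epsilon>"
    unfolding eventually_nhds_metric by blast
  show ?thesis by (rule that[OF \<open>r > 0\<close>]) (use r in \<open>auto simp: dist_norm\<close>)
qed

text \<open>Along the direction \<open>\<phi>\<close> the argument of -z t^3, taken on the right
  branch, is \<open>Im w + 3 * \<phi> - 3 * pi\<close>, so the hypothesis means descent. The radius
  stays free below \<open>\<rho>1\<close>, because one radius must later serve several requirements;
  the constants may depend on it.\<close>

lemma watson_local:
  assumes \<psi>: "0 \<le> \<psi>" "\<psi> < pi / 2"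
  obtains \<rho>1 where "\<rho>1 > 0" "\<And>\<rho>. 0 < \<rho> \<Longrightarrow> \<rho> \<le> \<rho>1 \<Longrightarrow> \<exists>C X. \<forall>w. X \<le> Re w \<longrightarrow> \<bar>Im w + 3 * \<phi> - 3 * pi\<bar> \<le> \<psi> \<longrightarrow>
    norm (prim (bker (exp w - \<kappa>) w) (of_real \<rho> * cis \<phi>) - arm_sum \<kappa> N w) \<le> C * exp (- (real (N + 1) / 3) * Re w)"
proof -
  \<comment> \<open>Half of the angular slack is reserved for the argument of \<open>qfun\<close> on
    the small disc.\<close>
  define \<epsilon> where "\<epsilon> = (pi / 2 - \<psi>) / 2"
  have \<epsilon>: "\<epsilon> > 0" "\<psi> + \<epsilon> < pi / 2" using \<psi> by (auto simp: \<epsilon>_def field_simps)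
  obtain r where r: "r > 0" and q: "\<And>t. t \<in> ball 0 r \<Longrightarrow> qfun t \<notin> \<real>\<^sub>\<le>\<^sub>0"
    "\<And>t. t \<in> ball 0 r \<Longrightarrow> 1 / 2 \<le> norm (qfun t)" "\<And>t. t \<in> ball 0 r \<Longrightarrow> \<bar>Im (Ln (qfun t))\<bar> \<le> \<epsilon>"
    using qfun_near_0[OF \<epsilon>(1)] by metis
  define h where "h = (\<lambda>t. exp (Ln (qfun t) / 3))"
  define \<sigma> where "\<sigma> = (\<lambda>t. t * h t)"
  have h: "h holomorphic_on ball 0 r" unfolding h_def using q(1) by (intro holomorphic_intros) auto
  have h0: "h t \<noteq> 0" for t by (simp add: h_def)
  have \<sigma>: "\<sigma> holomorphic_on ball 0 r" unfolding \<sigma>_def by (intro holomorphic_intros h)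
  have e: "(\<lambda>t. exp (\<kappa> * t)) holomorphic_on ball 0 r" by (intro holomorphic_intros)
  have \<sigma>3: "\<sigma> t ^ 3 = t ^ 3 * qfun t" if "t \<in> ball 0 r" for t
  proof -
    have "qfun t \<noteq> 0" using q(1)[OF that] by auto
    moreover have "h t ^ 3 = exp (of_nat 3 * (Ln (qfun t) / 3))" unfolding h_def by (rule exp_of_nat_mult[symmetric])
    ultimately show ?thesis by (simp add: \<sigma>_def power_mult_distrib)
  qed
  obtain c R where R: "R holomorphic_on ball 0 r" and eq0: "\<And>t. t \<in> ball 0 r \<Longrightarrow>
      exp (\<kappa> * t) = (\<Sum>n<N. c n * (\<sigma> t ^ n * deriv \<sigma> t)) + \<sigma> t ^ N * R t"
    using expansion_in_powers[OF r h h0 e, of N] unfolding \<sigma>_def by blast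
  have "c n = B_poly n \<kappa>" if "n < N" for n
    using expansion_coeff[OF r h h0 e R eq0[unfolded \<sigma>_def] that] B_poly_eq[OF r q(1), of n \<kappa>]
    by (simp add: h_def)
  then have eq: "exp (\<kappa> * t) = (\<Sum>n<N. B_poly n \<kappa> * (\<sigma> t ^ n * deriv \<sigma> t)) + \<sigma> t ^ N * R t"
    if "t \<in> ball 0 r" for t using eq0[OF that] by simp
  have cos_pos: "cos (\<psi> + \<epsilon>) > 0" using \<psi> \<epsilon> by (intro cos_gt_zero_pi) auto
  \<comment> \<open>The 12 is 6, from the phase, times 2, from the lower bound 1/2 for the modulus
    of \<open>qfun\<close>.\<close>
  define c0 where "c0 = cos (\<psi> + \<epsilon>) / 12"
  have c0: "c0 > 0" using cos_pos by (simp add: c0_def)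
  \<comment> \<open>The decay rate is set to \<open>real (N + 1) / 3\<close>, so that truncating
    each Gamma integral costs no more than the allowed error.\<close>
  obtain Cg where Cg: "Cg \<ge> 0" "\<And>s y. s \<notin> \<int>\<^sub>\<le>\<^sub>0 \<Longrightarrow> Re s \<le> real (N + 1) / 3 \<Longrightarrow> \<bar>Im s\<bar> \<le> 0 \<Longrightarrow> 0 \<le> Re y \<Longrightarrow>
    \<bar>Im y\<bar> \<le> \<psi> + \<epsilon> \<Longrightarrow> norm (igam s y - Gamma s) \<le> Cg * exp (- (real (N + 1) / 3) * Re y)"
    using igam_minus_Gamma_bound[of "\<psi> + \<epsilon>" "real (N + 1) / 3"] \<psi> \<epsilon> by (metis add_nonneg_nonneg less_imp_le divide_pos_pos of_nat_0_less_iff zero_less_Suc Suc_eq_plus1 zero_less_numeral)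
  show ?thesis
  proof (rule that[of "r / 2"])
    show "r / 2 > 0" using r by simp
    fix \<rho> assume \<rho>: "0 < \<rho>" "\<rho> \<le> r / 2"
    define d where "d = cis \<phi>"
    have ray: "of_real x * d \<in> ball 0 r" if "x \<in> {0..\<rho>}" for x
      using that \<rho> by (auto simp: d_def norm_mult)
    obtain M where M: "M \<ge> 0" "\<And>t. t \<in> cball 0 \<rho> \<Longrightarrow> norm (h t ^ N * R t) \<le> M"
    proof -
      have "compact ((\<lambda>t. h t ^ N * R t) ` cball 0 \<rho>)"
      proof (intro compact_continuous_image compact_cball holomorphic_on_imp_continuous_on)
        have "(\<lambda>t. h t ^ N * R t) holomorphic_on ball 0 r" by (intro holomorphic_intros h R)
        then show "(\<lambda>t. h t ^ N * R t) holomorphic_on cball 0 \<rho>"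
          by (rule holomorphic_on_subset) (use \<rho> in auto)
      qed
      then obtain M where M: "\<And>t. t \<in> cball 0 \<rho> \<Longrightarrow> norm (h t ^ N * R t) \<le> M"
        by (force dest: compact_imp_bounded simp: bounded_iff)
      have "0 \<le> M" using order_trans[OF norm_ge_zero M[of 0]] \<rho> by simp
      with M that show thesis by blast
    qed
    define t0 Lq l where "t0 = of_real \<rho> * d" "Lq = Ln (qfun t0)" "l = of_real (ln \<rho>) + \<i> * of_real \<phi> + Lq / 3"
    have t0: "t0 \<in> ball 0 r" using ray[of \<rho>] \<rho> by (simp add: t0_Lq_l_def)
    have \<sigma>0: "\<sigma> t0 = exp l"
      using \<rho> by (simp add: \<sigma>_def h_def t0_Lq_l_def exp_add exp_of_real d_def cis_conv_exp)
    \<comment> \<open>\<open>L\<close> is the logarithm of the modulus of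
      \<open>\<sigma> t0 ^ 3 / 6\<close>, hence \<open>Re y - Re w\<close> below; requiring
      \<open>- L \<le> Re w\<close> keeps \<open>Re y\<close> nonnegative.\<close>
    define L where "L = 3 * ln \<rho> + Re Lq - ln 6"
    define K where "K = (\<Sum>n<N. norm (B_poly n \<kappa>) * (norm ((-1) ^ (n + 1) * 6 powr (of_nat (n + 1) / 3) / 3 :: complex) *
        (Cg * exp (- (real (N + 1) / 3) * L))))"
    define K' where "K' = M * exp (real (N + 2) + (real (N + 2))\<^sup>2 / (4 * c0)) / real (N + 1)"
    have main: "norm (prim (bker (exp w - \<kappa>) w) t0 - arm_sum \<kappa> N w) \<le> (K' + K) * exp (- (real (N + 1) / 3) * Re w)"
      if w: "max 0 (- L) \<le> Re w" "\<bar>Im w + 3 * \<phi> - 3 * pi\<bar> \<le> \<psi>" for w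
    proof -
      define G where "G = (\<lambda>n t. \<sigma> t ^ (n + 1) / 3 * gser (of_nat (n + 1) / 3) (exp w * \<sigma> t ^ 3 / 6))"
      define F where "F = (\<lambda>t. prim (bker (exp w - \<kappa>) w) t - (\<Sum>n<N. B_poly n \<kappa> * G n t))"
      define f where "f = (\<lambda>t. exp (exp w * \<sigma> t ^ 3 / 6) * (\<sigma> t ^ N * R t))"
      have "norm (F (of_real \<rho> * d) - F 0) \<le> K' * exp (- (real (N + 1) / 3) * Re w)"
        unfolding K'_def
      proof (rule watson_remainder[where f = f])
        fix x assume x: "x \<in> {0..\<rho>}"
        define t where "t = of_real x * d"
        have t: "t \<in> ball 0 r" unfolding t_def by (rule ray[OF x])
        have "(F has_field_derivative bker (exp w - \<kappa>) w t -
            (\<Sum>n<N. B_poly n \<kappa> * (exp (exp w * \<sigma> t ^ 3 / 6) * (\<sigma> t ^ n * deriv \<sigma> t)))) (at t)"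
          unfolding F_def G_def
          by (intro DERIV_diff has_field_derivative_prim bker_holomorphic DERIV_sum DERIV_cmult
              has_field_derivative_cubic_primitive holomorphic_derivI[OF \<sigma> open_ball t])
        also have "bker (exp w - \<kappa>) w t - (\<Sum>n<N. B_poly n \<kappa> * (exp (exp w * \<sigma> t ^ 3 / 6) * (\<sigma> t ^ n * deriv \<sigma> t))) = f t"
        proof -
          have "bker (exp w - \<kappa>) w t = exp (exp w * \<sigma> t ^ 3 / 6) * exp (\<kappa> * t)"
            unfolding bker_eq_cubic \<sigma>3[OF t] ..
          then show ?thesis unfolding eq[OF t] f_def
            by (simp add: distrib_left sum_distrib_left mult_ac)
        qed
        finally show "(F has_field_derivative f (of_real x * d)) (at (of_real x * d))" by (simp add: t_def)
        have "norm (exp (exp w * \<sigma> t ^ 3 / 6)) \<le> exp (- c0 * exp (Re w) * x ^ 3)"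
        proof -
          define \<theta> where "\<theta> = Im w + 3 * \<phi> + Im (Ln (qfun t))"
          have qt: "qfun t = exp (Ln (qfun t))" using q(1)[OF t] by (subst exp_Ln) auto
          have d3: "d ^ 3 = exp (3 * \<i> * of_real \<phi>)"
            using exp_of_nat_mult[of 3 "\<i> * of_real \<phi>"] by (simp add: d_def cis_conv_exp mult_ac)
          have "exp w * \<sigma> t ^ 3 / 6 = of_real (x ^ 3 / 6) * (exp w * d ^ 3 * qfun t)"
            unfolding \<sigma>3[OF t] by (simp add: t_def power_mult_distrib mult_ac)
          also have "exp w * d ^ 3 * qfun t = exp (w + 3 * \<i> * of_real \<phi> + Ln (qfun t))"
            unfolding exp_add d3[symmetric] using qt by simp
          also have "Re (of_real (x ^ 3 / 6) * \<dots>) = x ^ 3 / 6 * (exp (Re w + Re (Ln (qfun t))) * cos \<theta>)"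
            by (simp add: Re_exp \<theta>_def)
          also have "exp (Re w + Re (Ln (qfun t))) = exp (Re w) * norm (qfun t)"
            using norm_exp_eq_Re[of "Ln (qfun t)"] qt by (simp add: exp_add)
          finally have re: "Re (exp w * \<sigma> t ^ 3 / 6) = x ^ 3 / 6 * (exp (Re w) * norm (qfun t) * cos \<theta>)" .
          \<comment> \<open>The hypothesis measures the phase from 3 pi, where the real part of the
            exponent is most negative.\<close>
          have "cos \<theta> = - cos (\<theta> - 3 * pi)"
          proof -
            have "cos (\<theta> - 3 * pi) = cos (\<theta> - pi - 2 * pi)" by (simp add: algebra_simps)
            also have "\<dots> = cos (\<theta> - pi)" by (simp only: cos_diff[of _ "2 * pi"]) simp
            also have "\<dots> = - cos \<theta>" by (simp add: cos_diff)
            finally show ?thesis by simp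
          qed
          moreover have "cos (\<psi> + \<epsilon>) \<le> cos (\<theta> - 3 * pi)"
          proof -
            have "\<bar>\<theta> - 3 * pi\<bar> \<le> \<psi> + \<epsilon>" using w(2) q(3)[OF t] unfolding \<theta>_def by linarith
            then have "cos (\<psi> + \<epsilon>) \<le> cos \<bar>\<theta> - 3 * pi\<bar>" using \<epsilon>(2) \<psi> by (intro cos_monotone_0_pi_le) auto
            then show ?thesis by simp
          qed
          ultimately have "cos (\<psi> + \<epsilon>) \<le> - cos \<theta>" by simp
          then have "(exp (Re w) * (1 / 2)) * cos (\<psi> + \<epsilon>) \<le> (exp (Re w) * norm (qfun t)) * (- cos \<theta>)"
            using q(2)[OF t] cos_pos by (intro mult_mono) auto
          then have "x ^ 3 / 6 * ((exp (Re w) * (1 / 2)) * cos (\<psi> + \<epsilon>)) \<le> x ^ 3 / 6 * ((exp (Re w) * norm (qfun t)) * (- cos \<theta>))"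
            using x by (intro mult_left_mono) auto
          then have "Re (exp w * \<sigma> t ^ 3 / 6) \<le> - c0 * exp (Re w) * x ^ 3"
            unfolding re c0_def by (simp add: algebra_simps)
          then show ?thesis by simp
        qed
        moreover have "norm (\<sigma> t ^ N * R t) \<le> x ^ N * M"
        proof -
          have "norm (\<sigma> t ^ N * R t) = x ^ N * norm (h t ^ N * R t)"
            using x by (simp add: \<sigma>_def t_def d_def power_mult_distrib norm_mult norm_power)
          also have "\<dots> \<le> x ^ N * M"
            using x by (intro mult_left_mono M(2)) (auto simp: t_def d_def norm_mult)
          finally show ?thesis .
        qed
        ultimately have "norm (f t) \<le> exp (- c0 * exp (Re w) * x ^ 3) * (x ^ N * M)"
          unfolding f_def norm_mult[of "exp (exp w * \<sigma> t ^ 3 / 6)"] by (intro mult_mono) auto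
        then show "norm (f (of_real x * d) * d) \<le> M * x ^ N * exp (- c0 * exp (Re w) * x ^ 3)"
          by (simp add: t_def norm_mult d_def mult_ac)
      qed (use c0 \<rho> M in auto)
      moreover have "F 0 = 0" by (simp add: F_def G_def \<sigma>_def)
      ultimately have 1: "norm (F t0) \<le> K' * exp (- (real (N + 1) / 3) * Re w)" by (simp add: t0_Lq_l_def)
      define y where "y = w + 3 * l - of_real (ln 6) - 3 * of_real pi * \<i>"
      have y: "Re y = Re w + L" "\<bar>Im y\<bar> \<le> \<psi> + \<epsilon>"
        using w(2) q(3)[OF t0] by (simp_all add: y_def t0_Lq_l_def L_def)
      have G: "norm (G n t0 - arm_const n * exp (- (of_nat (n + 1) / 3) * w))
          \<le> norm ((-1) ^ (n + 1) * 6 powr (of_nat (n + 1) / 3) / 3 :: complex) *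
             (Cg * exp (- (real (N + 1) / 3) * L)) * exp (- (real (N + 1) / 3) * Re w)" if n: "n < N" for n
      proof -
        define s where "s = (of_nat (n + 1) / 3 :: complex)"
        have sr: "s = of_real (real (n + 1) / 3)" by (simp add: s_def)
        have s: "s \<notin> \<int>\<^sub>\<le>\<^sub>0" "Re s \<le> real (N + 1) / 3" "\<bar>Im s\<bar> \<le> 0" 
          using n unfolding sr by (auto elim!: nonpos_Ints_cases simp: complex_eq_iff)
        define a where "a = ((-1) ^ (n + 1) * 6 powr s / 3 :: complex)"
        have "G n t0 - arm_const n * exp (- s * w) = a * exp (- s * w) * (igam s y - Gamma s)"
          unfolding G_def arm_const_def s_def[symmetric] a_def
            cubic_primitive_eq[OF \<sigma>0 y_def, of n, folded s_def]
        proof -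
          have "p / 3 * e * I - p * g / 3 * e = p / 3 * e * (I - g)" for p e I g :: complex
            by (simp add: field_simps)
          then show "(-1) ^ (n + 1) * 6 powr s / 3 * exp (- s * w) * igam s y -
              (-1) ^ (n + 1) * 6 powr s * Gamma s / 3 * exp (- s * w) =
              (-1) ^ (n + 1) * 6 powr s / 3 * exp (- s * w) * (igam s y - Gamma s)" .
        qed
        also have "norm \<dots> \<le> (norm a * 1) * (Cg * exp (- (real (N + 1) / 3) * Re y))"
          unfolding norm_mult[of _ "igam s y - Gamma s"] norm_mult[of a]
        proof (intro mult_mono Cg(2) s y(2))
          show "norm (exp (- s * w)) \<le> 1" using w(1) by (simp add: sr)
        qed (use w(1) y(1) in auto)
        also have "exp (- (real (N + 1) / 3) * Re y) = exp (- (real (N + 1) / 3) * L) * exp (- (real (N + 1) / 3) * Re w)"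
          unfolding y(1) distrib_left exp_add by (rule mult.commute)
        finally show ?thesis by (simp add: s_def a_def mult_ac)
      qed
      have "(\<Sum>n<N. B_poly n \<kappa> * G n t0) - arm_sum \<kappa> N w =
          (\<Sum>n<N. B_poly n \<kappa> * (G n t0 - arm_const n * exp (- (of_nat (n + 1) / 3) * w)))"
        by (simp add: arm_sum_def right_diff_distrib sum_subtractf)
      also have "norm \<dots> \<le> (\<Sum>n<N. norm (B_poly n \<kappa>) * (norm ((-1) ^ (n + 1) * 6 powr (of_nat (n + 1) / 3) / 3 :: complex) *
             (Cg * exp (- (real (N + 1) / 3) * L)) * exp (- (real (N + 1) / 3) * Re w)))"
      proof (rule sum_norm_le)
        fix n assume "n \<in> {..<N}"
        then have n: "n < N" by simp
        show "norm (B_poly n \<kappa> * (G n t0 - arm_const n * exp (- (of_nat (n + 1) / 3) * w)))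
            \<le> norm (B_poly n \<kappa>) * (norm ((-1) ^ (n + 1) * 6 powr (of_nat (n + 1) / 3) / 3 :: complex) *
             (Cg * exp (- (real (N + 1) / 3) * L)) * exp (- (real (N + 1) / 3) * Re w))"
          unfolding norm_mult[of "B_poly n \<kappa>"] by (intro mult_left_mono G n) auto
      qed
      also have "\<dots> = K * exp (- (real (N + 1) / 3) * Re w)"
        unfolding K_def sum_distrib_right by (simp only: mult_ac)
      finally have 2: "norm ((\<Sum>n<N. B_poly n \<kappa> * G n t0) - arm_sum \<kappa> N w) \<le> K * exp (- (real (N + 1) / 3) * Re w)" .
      have "prim (bker (exp w - \<kappa>) w) t0 - arm_sum \<kappa> N w = F t0 + ((\<Sum>n<N. B_poly n \<kappa> * G n t0) - arm_sum \<kappa> N w)"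
        by (simp add: F_def)
      also have "norm \<dots> \<le> K' * exp (- (real (N + 1) / 3) * Re w) + K * exp (- (real (N + 1) / 3) * Re w)"
        by (intro order_trans[OF norm_triangle_ineq] add_mono 1 2)
      finally show ?thesis by (simp add: distrib_right)
    qed
    show "\<exists>C X. \<forall>w. X \<le> Re w \<longrightarrow> \<bar>Im w + 3 * \<phi> - 3 * pi\<bar> \<le> \<psi> \<longrightarrow>
      norm (prim (bker (exp w - \<kappa>) w) (of_real \<rho> * cis \<phi>) - arm_sum \<kappa> N w) \<le> C * exp (- (real (N + 1) / 3) * Re w)"
      using main unfolding t0_Lq_l_def(1) d_def by blast
  qed
qed

section \<open>Paths of descent\<close>

definition arm_expansion_on :: "complex \<Rightarrow> nat \<Rightarrow> real set \<Rightarrow> bool" where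
  "arm_expansion_on \<kappa> N \<Theta> \<longleftrightarrow> (\<exists>C X. \<forall>w. X \<le> Re w \<longrightarrow> Im w \<in> \<Theta> \<longrightarrow>
     norm (arm (Im w) (bker (exp w - \<kappa>) w) - arm_sum \<kappa> N w) \<le> C * exp (- (real (N + 1) / 3) * Re w))"

text \<open>For each phase \<open>\<theta> = arg z\<close> in \<open>\<Theta>\<close>, \<open>z (sinh t - t)\<close> has negative real part along the straight segment
  from \<open>t0\<close> to some \<open>- a + \<i> \<alpha>\<close> followed by the horizontal ray to \<open>- \<infinity> + \<i> \<alpha>\<close>, uniformly in \<open>\<theta>\<close>.\<close>

definition descent :: "real set \<Rightarrow> complex \<Rightarrow> bool" where
  "descent \<Theta> t0 \<longleftrightarrow> (\<exists>c>0. \<exists>A\<ge>0. \<forall>\<theta>\<in>\<Theta>. \<exists>\<alpha> a. 0 \<le> a \<and> a \<le> A \<and> \<bar>\<alpha>\<bar> \<le> A \<and> \<bar>\<alpha> - \<theta>\<bar> < pi / 2 \<and>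
     (\<forall>t\<in>closed_segment t0 (Complex (- a) \<alpha>). Re (cis \<theta> * (sinh t - t)) \<le> - c) \<and>
     (\<forall>x\<ge>a. Re (cis \<theta> * (sinh (Complex (- x) \<alpha>) - Complex (- x) \<alpha>)) \<le> - c * (1 + x)))"

lemma descentI:
  assumes "c > 0"
    and "\<And>\<theta>. \<theta> \<in> \<Theta> \<Longrightarrow> 0 \<le> a \<theta> \<and> a \<theta> \<le> A \<and> \<bar>\<alpha> \<theta>\<bar> \<le> A \<and> \<bar>\<alpha> \<theta> - \<theta>\<bar> < pi / 2"
    and "\<And>\<theta> t. \<theta> \<in> \<Theta> \<Longrightarrow> t \<in> closed_segment t0 (Complex (- a \<theta>) (\<alpha> \<theta>)) \<Longrightarrow> Re (cis \<theta> * (sinh t - t)) \<le> - c"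
    and "\<And>\<theta> x. \<theta> \<in> \<Theta> \<Longrightarrow> a \<theta> \<le> x \<Longrightarrow>
      Re (cis \<theta> * (sinh (Complex (- x) (\<alpha> \<theta>)) - Complex (- x) (\<alpha> \<theta>))) \<le> - c * (1 + x)"
    and "A \<ge> 0"
  shows "descent \<Theta> t0"
  unfolding descent_def using assms by blast

text \<open>\<open>sinh\<close> commutes with conjugation, so a mirrored path descends for the
  opposite phase. Only nonnegative phases then need an explicit path.\<close>

lemma descent_cnj:
  assumes "descent \<Theta> t0"
  shows "descent (uminus ` \<Theta>) (cnj t0)"
proof -
  have re: "Re (cis (- \<theta>) * (sinh (cnj t) - cnj t)) = Re (cis \<theta> * (sinh t - t))" for \<theta> t
  proof -
    have "sinh (cnj t) = cnj (sinh t)" by (simp add: sinh_field_def exp_cnj)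
    then have "cis (- \<theta>) * (sinh (cnj t) - cnj t) = cnj (cis \<theta> * (sinh t - t))" by (simp add: cis_cnj)
    then show ?thesis by (simp only: cnj.sel)
  qed
  obtain c A where c: "c > 0" and A: "A \<ge> 0" and *: "\<And>\<theta>. \<theta> \<in> \<Theta> \<Longrightarrow> \<exists>\<alpha> a. 0 \<le> a \<and> a \<le> A \<and> \<bar>\<alpha>\<bar> \<le> A \<and> \<bar>\<alpha> - \<theta>\<bar> < pi / 2 \<and>
     (\<forall>t\<in>closed_segment t0 (Complex (- a) \<alpha>). Re (cis \<theta> * (sinh t - t)) \<le> - c) \<and>
     (\<forall>x\<ge>a. Re (cis \<theta> * (sinh (Complex (- x) \<alpha>) - Complex (- x) \<alpha>)) \<le> - c * (1 + x))"
    using assms unfolding descent_def by blast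
  show ?thesis
    unfolding descent_def
  proof (rule exI[of _ c], rule conjI[OF c], rule exI[of _ A], rule conjI[OF A], rule ballI)
    fix \<theta>' assume "\<theta>' \<in> uminus ` \<Theta>"
    then obtain \<theta> where \<theta>: "\<theta> \<in> \<Theta>" "\<theta>' = - \<theta>" by auto
    obtain \<alpha> a where a: "0 \<le> a" "a \<le> A" "\<bar>\<alpha>\<bar> \<le> A" "\<bar>\<alpha> - \<theta>\<bar> < pi / 2"
      and seg: "\<And>t. t \<in> closed_segment t0 (Complex (- a) \<alpha>) \<Longrightarrow> Re (cis \<theta> * (sinh t - t)) \<le> - c"
      and hor: "\<And>x. x \<ge> a \<Longrightarrow> Re (cis \<theta> * (sinh (Complex (- x) \<alpha>) - Complex (- x) \<alpha>)) \<le> - c * (1 + x)"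
      using *[OF \<theta>(1)] by blast
    have C: "Complex x (- \<alpha>) = cnj (Complex x \<alpha>)" for x by (simp add: complex_eq_iff)
    have "Re (cis \<theta>' * (sinh t - t)) \<le> - c" if t: "t \<in> closed_segment (cnj t0) (Complex (- a) (- \<alpha>))" for t
    proof -
      obtain u where u: "0 \<le> u" "u \<le> 1" "t = (1 - u) *\<^sub>R cnj t0 + u *\<^sub>R cnj (Complex (- a) \<alpha>)"
        using t unfolding C by (auto simp: in_segment)
      then have "cnj t = (1 - u) *\<^sub>R t0 + u *\<^sub>R Complex (- a) \<alpha>" by (simp add: complex_eq_iff)
      then have "cnj t \<in> closed_segment t0 (Complex (- a) \<alpha>)" using u by (auto simp: in_segment)
      then have "Re (cis \<theta> * (sinh (cnj t) - cnj t)) \<le> - c" by (rule seg)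
      then show ?thesis using re[of \<theta> "cnj t"] by (simp only: \<theta>(2) complex_cnj_cnj)
    qed
    moreover have "Re (cis \<theta>' * (sinh (Complex (- x) (- \<alpha>)) - Complex (- x) (- \<alpha>))) \<le> - c * (1 + x)" if "x \<ge> a" for x
      unfolding C \<theta>(2) re using hor[OF that] .
    moreover have "\<bar>- \<alpha>\<bar> \<le> A" "\<bar>- \<alpha> - \<theta>'\<bar> < pi / 2" using a by (auto simp: \<theta> abs_minus_commute)
    ultimately show "\<exists>\<alpha> a. 0 \<le> a \<and> a \<le> A \<and> \<bar>\<alpha>\<bar> \<le> A \<and> \<bar>\<alpha> - \<theta>'\<bar> < pi / 2 \<and>
       (\<forall>t\<in>closed_segment (cnj t0) (Complex (- a) \<alpha>). Re (cis \<theta>' * (sinh t - t)) \<le> - c) \<and>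
       (\<forall>x\<ge>a. Re (cis \<theta>' * (sinh (Complex (- x) \<alpha>) - Complex (- x) \<alpha>)) \<le> - c * (1 + x))"
      using a(1,2) by blast
  qed
qed

lemma norm_bker_saddle: 
  "norm (bker (exp w - \<kappa>) w t) \<le> exp (exp (Re w) * Re (cis (Im w) * (sinh t - t)) + norm \<kappa> * norm t)"
proof -
  define u where "u = cis (Im w) * (sinh t - t)"
  have "exp w = of_real (exp (Re w)) * cis (Im w)" by (rule exp_eq_polar)
  then have "exp w * sinh t - (exp w - \<kappa>) * t = of_real (exp (Re w)) * u + \<kappa> * t"
    by (simp add: u_def algebra_simps)
  then have "Re (exp w * sinh t - (exp w - \<kappa>) * t) = exp (Re w) * Re u + Re (\<kappa> * t)" by simp
  moreover have "Re (\<kappa> * t) \<le> norm \<kappa> * norm t" by (metis complex_Re_le_cmod norm_mult)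
  ultimately show ?thesis unfolding bker_def u_def[symmetric] norm_exp_eq_Re by simp
qed

text \<open>With \<open>x\<close> the logarithm of |z|, exponentially small terms are absorbed into
  any negative power of |z|; again a completed square.\<close>

lemma exp_minus_exp_le:
  fixes c m x :: real
  assumes "c > 0" "x \<ge> 0"
  shows "exp (- c * exp x) \<le> exp (m\<^sup>2 / (2 * c)) * exp (- m * x)"
proof -
  have "c * (x\<^sup>2 / 2) \<le> c * exp x"
    using exp_lower_Taylor_quadratic[OF assms(2)] assms by (intro mult_left_mono) auto
  moreover have "0 \<le> (m - c * x)\<^sup>2 / (2 * c)" using assms by simp
  moreover have "(m - c * x)\<^sup>2 / (2 * c) = m\<^sup>2 / (2 * c) - m * x + c * (x\<^sup>2 / 2)"
    using assms by (simp add: field_simps power2_eq_square)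
  ultimately have "- c * exp x \<le> m\<^sup>2 / (2 * c) + - m * x" by simp
  then show ?thesis by (simp only: exp_add[symmetric] exp_le_cancel_iff)
qed

text \<open>Beyond \<open>t0\<close> the segment and the ray both contribute at most a constant
  times exp (-c |z|). The factor exp (\<kappa> t) is harmless: bounded on the segment, and
  outweighed on the ray by the linear descent.\<close>

lemma arm_expansion_of_descent:
  assumes loc: "\<exists>C X. \<forall>w. X \<le> Re w \<longrightarrow> Im w \<in> \<Theta> \<longrightarrow>
      norm (prim (bker (exp w - \<kappa>) w) t0 - arm_sum \<kappa> N w) \<le> C * exp (- (real (N + 1) / 3) * Re w)"
    and desc: "descent \<Theta> t0"
  shows "arm_expansion_on \<kappa> N \<Theta>"
proof -
  define m where "m = real (N + 1) / 3"
  obtain C X where loc: "\<And>w. X \<le> Re w \<Longrightarrow> Im w \<in> \<Theta> \<Longrightarrow>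
      norm (prim (bker (exp w - \<kappa>) w) t0 - arm_sum \<kappa> N w) \<le> C * exp (- m * Re w)"
    using loc unfolding m_def by blast
  obtain c A where c: "c > 0" and A: "A \<ge> 0" and *: "\<And>\<theta>. \<theta> \<in> \<Theta> \<Longrightarrow> \<exists>\<alpha> a. 0 \<le> a \<and> a \<le> A \<and> \<bar>\<alpha>\<bar> \<le> A \<and> \<bar>\<alpha> - \<theta>\<bar> < pi / 2 \<and>
     (\<forall>t\<in>closed_segment t0 (Complex (- a) \<alpha>). Re (cis \<theta> * (sinh t - t)) \<le> - c) \<and>
     (\<forall>x\<ge>a. Re (cis \<theta> * (sinh (Complex (- x) \<alpha>) - Complex (- x) \<alpha>)) \<le> - c * (1 + x))"
    using desc unfolding descent_def by blast
  define k B D where "k = norm \<kappa>" "B = norm t0 + 2 * A" "D = exp (k * B) * (2 * B) + exp (k * A)"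
  have k: "k \<ge> 0" and B: "B \<ge> 0" and D: "D \<ge> 0" using A by (auto simp: k_B_D_def)
  show ?thesis
    unfolding arm_expansion_on_def m_def[symmetric]
  proof (intro exI allI impI)
    \<comment> \<open>The threshold with \<open>(k + 1) / c\<close> makes
      \<open>c * Z - k \<ge> 1\<close>, so the ray keeps a decay rate of at least 1 after
      \<open>\<kappa>\<close> has taken its share.\<close>
    fix w assume w: "max X (max 0 (ln ((k + 1) / c))) \<le> Re w" and \<theta>: "Im w \<in> \<Theta>"
    define Z where "Z = exp (Re w)"
    have Z: "c * Z \<ge> k + 1"
    proof -
      have "exp (ln ((k + 1) / c)) \<le> Z" unfolding Z_def using w by simp
      then show ?thesis using c k by (simp add: field_simps)
    qed
    obtain \<alpha> a where a: "0 \<le> a" "a \<le> A" "\<bar>\<alpha>\<bar> \<le> A" "\<bar>\<alpha> - Im w\<bar> < pi / 2"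
      and seg: "\<And>t. t \<in> closed_segment t0 (Complex (- a) \<alpha>) \<Longrightarrow> Re (cis (Im w) * (sinh t - t)) \<le> - c"
      and hor: "\<And>x. x \<ge> a \<Longrightarrow> Re (cis (Im w) * (sinh (Complex (- x) \<alpha>) - Complex (- x) \<alpha>)) \<le> - c * (1 + x)"
      using *[OF \<theta>] by blast
    let ?f = "bker (exp w - \<kappa>) w"
    define t1 where "t1 = Complex (- a) \<alpha>"
    have t1: "norm t1 \<le> 2 * A" using cmod_le[of t1] a by (simp add: t1_def)
    have 1: "norm (prim ?f t1 - prim ?f t0) \<le> exp (- c * Z) * (exp (k * B) * (2 * B))"
    proof -
      have "norm (prim ?f t1 - prim ?f t0) \<le> exp (- c * Z + k * B) * norm (t1 - t0)"
      proof (rule field_differentiable_bound[where S = "closed_segment t0 t1" and f' = ?f])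
        fix t assume t: "t \<in> closed_segment t0 t1"
        then obtain u where u: "0 \<le> u" "u \<le> 1" "t = (1 - u) *\<^sub>R t0 + u *\<^sub>R t1"
          by (auto simp: in_segment)
        have "norm t \<le> norm ((1 - u) *\<^sub>R t0) + norm (u *\<^sub>R t1)"
          unfolding u(3) by (rule norm_triangle_ineq)
        also have "\<dots> \<le> 1 * norm t0 + 1 * norm t1"
          using u unfolding norm_scaleR by (intro add_mono mult_right_mono) auto
        also have "\<dots> \<le> B" using t1 by (simp add: k_B_D_def)
        finally have "norm t \<le> B" .
        then have "k * norm t \<le> k * B" using k by (intro mult_left_mono)
        moreover have "Z * Re (cis (Im w) * (sinh t - t)) \<le> Z * (- c)"
          using seg t unfolding t1_def Z_def by (intro mult_left_mono) auto
        ultimately have "Z * Re (cis (Im w) * (sinh t - t)) + k * norm t \<le> - c * Z + k * B"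
          by (simp add: mult.commute)
        with norm_bker_saddle[of w \<kappa> t] show "norm (?f t) \<le> exp (- c * Z + k * B)"
          unfolding Z_def[symmetric] k_B_D_def(1)[symmetric] by (meson exp_le_cancel_iff order_trans)
      qed (auto intro: has_field_derivative_prim bker_holomorphic)
      also have "\<dots> \<le> exp (- c * Z + k * B) * (2 * B)"
      proof (rule mult_left_mono)
        have "norm (t1 - t0) \<le> norm t1 + norm t0" by (rule norm_triangle_ineq4)
        also have "\<dots> \<le> 2 * B" using t1 A norm_ge_zero[of t0] unfolding k_B_D_def by argo
        finally show "norm (t1 - t0) \<le> 2 * B" .
      qed simp
      finally show ?thesis by (simp only: exp_add mult.assoc)
    qed
    have 2: "norm (arm (Im w) ?f - prim ?f t1) \<le> exp (- c * Z) * exp (k * A)"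
    proof -
      have pos: "c * Z - k > 0" "c * Z - k \<ge> 1" using Z by auto
      have "norm (arm \<alpha> ?f - prim ?f (Complex (- a) \<alpha>))
          \<le> exp (- c * Z + k * A) / (c * Z - k) * exp (- (c * Z - k) * a)"
      proof (rule arm_bound(2))
        fix x assume x: "x \<ge> a"
        define t where "t = Complex (- x) \<alpha>"
        have "norm t \<le> x + A" using cmod_le[of t] a x by (simp add: t_def)
        then have "k * norm t \<le> k * (x + A)" using k by (intro mult_left_mono)
        moreover have "Z * Re (cis (Im w) * (sinh t - t)) \<le> Z * (- c * (1 + x))"
          using hor[OF x] unfolding t_def Z_def by (intro mult_left_mono) auto
        ultimately have "Z * Re (cis (Im w) * (sinh t - t)) + k * norm t \<le> (- c * Z + k * A) + - (c * Z - k) * x"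
          by (simp add: algebra_simps)
        with norm_bker_saddle[of w \<kappa> t]
        have "norm (?f t) \<le> exp ((- c * Z + k * A) + - (c * Z - k) * x)"
          unfolding Z_def[symmetric] k_B_D_def(1)[symmetric] by (meson exp_le_cancel_iff order_trans)
        then show "norm (?f (Complex (- x) \<alpha>)) \<le> exp (- c * Z + k * A) * exp (- (c * Z - k) * x)"
          unfolding t_def exp_add .
      qed (use pos in \<open>auto intro: bker_holomorphic\<close>)
      also have "\<dots> \<le> exp (- c * Z + k * A) * 1"
      proof (rule mult_mono)
        show "exp (- c * Z + k * A) / (c * Z - k) \<le> exp (- c * Z + k * A)"
          using pos by (simp add: divide_le_eq)
        have "0 \<le> (c * Z - k) * a" using pos a by (intro mult_nonneg_nonneg) auto
        then show "exp (- (c * Z - k) * a) \<le> 1" by (simp only: mult_minus_left exp_le_one_iff neg_le_0_iff_le)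
      qed auto
      finally show ?thesis unfolding arm_bker_eq[OF a(4)] t1_def by (simp only: exp_add mult_1_right)
    qed
    have "exp (- c * Z) \<le> exp (m\<^sup>2 / (2 * c)) * exp (- m * Re w)"
      unfolding Z_def using w by (intro exp_minus_exp_le c) auto
    then have 3: "exp (- c * Z) * D \<le> exp (m\<^sup>2 / (2 * c)) * exp (- m * Re w) * D"
      by (intro mult_right_mono D)
    have "arm (Im w) ?f - arm_sum \<kappa> N w = (arm (Im w) ?f - prim ?f t1) + (prim ?f t1 - prim ?f t0) + (prim ?f t0 - arm_sum \<kappa> N w)"
      by simp
    also have "norm \<dots> \<le> exp (- c * Z) * exp (k * A) + exp (- c * Z) * (exp (k * B) * (2 * B)) + C * exp (- m * Re w)"
      by (intro norm_triangle_le add_mono 1 2 loc \<theta>) (use w in auto)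
    also have "\<dots> \<le> (C + exp (m\<^sup>2 / (2 * c)) * D) * exp (- m * Re w)"
      using 3 by (simp add: k_B_D_def(3) algebra_simps)
    finally show "norm (arm (Im w) ?f - arm_sum \<kappa> N w) \<le> (C + exp (m\<^sup>2 / (2 * c)) * D) * exp (- m * Re w)" .
  qed
qed

section \<open>The real part of the phase, and elementary hyperbolic inequalities\<close>

lemma Re_saddle_phase:
  "Re (cis \<theta> * (sinh (Complex (- x) y) - Complex (- x) y)) =
     cos \<theta> * (x - sinh x * cos y) - sin \<theta> * (cosh x * sin y - y)"
proof -
  have "sinh (Complex (- x) y) = Complex (- sinh x * cos y) (cosh x * sin y)"
    by (simp add: sinh_field_def cosh_field_def complex_eq_iff Re_exp Im_exp field_simps)
  then show ?thesis by (simp add: algebra_simps)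
qed

text \<open>Applied in nested fashion, it differentiates until the sign is evident.\<close>

lemma strict_increasing_from_0:
  fixes f f' :: "real \<Rightarrow> real"
  assumes "x > 0" and "f 0 = 0" and "\<And>y. (f has_real_derivative f' y) (at y)"
    and "\<And>y. 0 < y \<Longrightarrow> y < x \<Longrightarrow> f' y > 0"
  shows "f x > 0"
proof -
  have "f 0 < f x"
    using assms by (intro DERIV_pos_imp_increasing_open[OF assms(1)])
      (auto intro!: continuous_at_imp_continuous_on DERIV_isCont)
  then show ?thesis using assms(2) by simp
qed

lemma cosh_real_gt_1: "x > 0 \<Longrightarrow> cosh x > (1 :: real)"
  using cosh_real_nonneg_less_iff[of 0 x] by simp

lemma sinh_real_gt:
  assumes "x > 0"
  shows "sinh x > (x :: real)"
proof -
  have "sinh x - x > 0"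
    by (rule strict_increasing_from_0[OF assms, where f' = "\<lambda>y. cosh y - 1"])
       (auto intro!: derivative_eq_intros simp: cosh_real_gt_1)
  then show ?thesis by simp
qed

lemma cosh_real_gt_quadratic:
  assumes "x > 0"
  shows "cosh x > 1 + x\<^sup>2 / (2 :: real)"
proof -
  have "cosh x - 1 - x\<^sup>2 / 2 > 0"
    by (rule strict_increasing_from_0[OF assms, where f' = "\<lambda>y. sinh y - y"])
       (auto intro!: derivative_eq_intros simp: sinh_real_gt)
  then show ?thesis by simp
qed

lemma sinh_real_ge_cubic:
  assumes "(x :: real) \<ge> 0"
  shows "sinh x \<ge> x + x ^ 3 / 6"
proof (cases "x = 0")
  case False
  with assms have "x > 0" by simp
  then have "sinh x - x - x ^ 3 / 6 > 0"
  proof (rule strict_increasing_from_0[where f' = "\<lambda>y. cosh y - 1 - y\<^sup>2 / 2"])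
    fix y :: real assume "y > 0"
    then show "cosh y - 1 - y\<^sup>2 / 2 > 0" using cosh_real_gt_quadratic[of y] by simp
  qed (auto intro!: derivative_eq_intros)
  then show ?thesis by simp
qed simp

text \<open>On the negative axis \<open>sinh t - t\<close> is real and at most -x^3 / 6, and
  \<open>cos \<theta> \<ge> sin \<eta>\<close> for the phases in question.\<close>

lemma descent_real_axis:
  assumes \<eta>: "0 < \<eta>" "\<eta> \<le> pi / 2" and \<rho>: "0 < \<rho>" "\<rho> \<le> 1"
  shows "descent {- (pi / 2 - \<eta>)..pi / 2 - \<eta>} (of_real \<rho> * cis pi)"
\<comment> \<open>The split point 1 is a convenience. The 12 instead of 6 pays for
  \<open>1 + x \<le> 2 * x\<close> on the ray.\<close>
proof (rule descentI[where c = "sin \<eta> * \<rho> ^ 3 / 12" and a = "\<lambda>_. 1" and \<alpha> = "\<lambda>_. 0" and A = 1])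
  have s: "sin \<eta> > 0" using \<eta> by (intro sin_gt_zero) auto
  then show "sin \<eta> * \<rho> ^ 3 / 12 > 0" using \<rho> by simp
  have le: "Re (cis \<theta> * (sinh (Complex (- x) 0) - Complex (- x) 0)) \<le> - (sin \<eta> * (x ^ 3 / 6))"
    if \<theta>: "\<theta> \<in> {- (pi / 2 - \<eta>)..pi / 2 - \<eta>}" and x: "x \<ge> 0" for \<theta> x
  proof -
    have "cos (pi / 2 - \<eta>) \<le> cos \<bar>\<theta>\<bar>" using \<theta> \<eta> by (intro cos_monotone_0_pi_le) auto
    then have c: "sin \<eta> \<le> cos \<theta>" by (simp add: cos_diff)
    have "sin \<eta> * (x ^ 3 / 6) \<le> cos \<theta> * (sinh x - x)"
      using sinh_real_ge_cubic[OF x] x s c by (intro mult_mono) auto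
    then show ?thesis unfolding Re_saddle_phase by (simp add: algebra_simps)
  qed
  fix \<theta> :: real assume \<theta>: "\<theta> \<in> {- (pi / 2 - \<eta>)..pi / 2 - \<eta>}"
  then show "0 \<le> (1::real) \<and> (1::real) \<le> 1 \<and> \<bar>0::real\<bar> \<le> 1 \<and> \<bar>0 - \<theta>\<bar> < pi / 2" using \<eta> by auto
  {
    fix t assume "t \<in> closed_segment (of_real \<rho> * cis pi) (Complex (- 1) 0)"
    then obtain u where u: "0 \<le> u" "u \<le> 1" "t = (1 - u) *\<^sub>R (of_real \<rho> * cis pi) + u *\<^sub>R Complex (- 1) 0"
      by (auto simp: in_segment)
    define x where "x = (1 - u) * \<rho> + u"
    have t: "t = Complex (- x) 0" unfolding u(3) by (simp add: x_def complex_eq_iff)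
    have x: "\<rho> \<le> x"
    proof -
      have "u * \<rho> \<le> u * 1" using u \<rho> by (intro mult_left_mono) auto
      then show ?thesis by (simp add: x_def algebra_simps)
    qed
    then have "\<rho> ^ 3 \<le> x ^ 3" using \<rho> by (intro power_mono) auto
    moreover have "\<rho> ^ 3 \<ge> 0" using \<rho> by simp
    ultimately have "\<rho> ^ 3 / 12 \<le> x ^ 3 / 6" by linarith
    then have "sin \<eta> * (\<rho> ^ 3 / 12) \<le> sin \<eta> * (x ^ 3 / 6)" using s by (intro mult_left_mono) auto
    with le[OF \<theta>, of x] x \<rho> show "Re (cis \<theta> * (sinh t - t)) \<le> - (sin \<eta> * \<rho> ^ 3 / 12)"
      unfolding t by simp
  }
  fix x :: real assume x: "1 \<le> x"
  have "\<rho> ^ 3 / 12 * (1 + x) \<le> x ^ 3 / 6"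
  proof -
    have "\<rho> ^ 3 \<le> 1" using \<rho> by (intro power_le_one) auto
    then have "\<rho> ^ 3 * (1 + x) \<le> 1 * (1 + x)" using x by (intro mult_right_mono) auto
    also have "\<dots> \<le> 2 * x ^ 1" using x by simp
    also have "\<dots> \<le> 2 * x ^ 3" using x by (intro mult_left_mono power_increasing) auto
    finally show ?thesis by (simp add: mult.commute)
  qed
  then have *: "sin \<eta> * (\<rho> ^ 3 / 12 * (1 + x)) \<le> sin \<eta> * (x ^ 3 / 6)" using s by (intro mult_left_mono) auto
  have "Re (cis \<theta> * (sinh (Complex (- x) 0) - Complex (- x) 0)) \<le> - (sin \<eta> * (x ^ 3 / 6))"
    using x by (intro le \<theta>) simp
  also have "\<dots> \<le> - (sin \<eta> * (\<rho> ^ 3 / 12 * (1 + x)))" by (rule le_imp_neg_le[OF *])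
  also have "\<dots> = - (sin \<eta> * \<rho> ^ 3 / 12) * (1 + x)" by simp
  finally show "Re (cis \<theta> * (sinh (Complex (- x) 0) - Complex (- x) 0)) \<le> - (sin \<eta> * \<rho> ^ 3 / 12) * (1 + x)" .
qed simp

text \<open>At \<i> y the real part of the phase is sin \<theta> (y - sin y), negative because sin
  \<theta> is. The path climbs to height \<open>\<theta>\<close> itself, where the exponentially
  growing terms of the phase have the favourable sign.\<close>

lemma descent_imaginary_axis:
  assumes \<eta>: "0 < \<eta>" "\<eta> \<le> pi / 2" and \<rho>: "0 < \<rho>" "\<rho> \<le> 1"
  shows "descent {pi + \<eta>..2 * pi - \<eta>} (of_real \<rho> * cis (pi / 2))"
proof -
  define s where "s = sin \<eta>"
  have s: "s > 0" "s \<le> 1" unfolding s_def using \<eta> by (auto intro!: sin_gt_zero)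
  define c where "c = min (s * (\<rho> - sin \<rho>)) (s / 6)"
  have mono: "y - sin y \<ge> \<rho> - sin \<rho>" if "y \<ge> \<rho>" for y
    by (rule DERIV_nonneg_imp_nondecreasing[OF that])
       (auto intro!: exI[of _ "1 - cos _"] derivative_eq_intros)
  have \<rho>s: "\<rho> - sin \<rho> > 0"
  proof (rule strict_increasing_from_0[OF \<rho>(1), where f' = "\<lambda>y. 1 - cos y"])
    fix y assume "0 < y" "y < \<rho>"
    then show "1 - cos y > 0" using cos_monotone_0_pi[of 0 y] \<rho> pi_gt3 by simp
  qed (auto intro!: derivative_eq_intros)
  have sin_le: "sin \<theta> \<le> - s" if \<theta>: "\<theta> \<in> {pi + \<eta>..2 * pi - \<eta>}" for \<theta>
  proof (cases "\<theta> - pi \<le> pi / 2")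
    case True
    then have "sin \<eta> \<le> sin (\<theta> - pi)" using \<theta> \<eta> by (intro sin_monotone_2pi_le) auto
    then show ?thesis by (simp add: s_def sin_diff)
  next
    case False
    then have "sin \<eta> \<le> sin (2 * pi - \<theta>)" using \<theta> \<eta> by (intro sin_monotone_2pi_le) auto
    then show ?thesis by (simp add: s_def sin_diff)
  qed
  show ?thesis
  proof (rule descentI[where c = c and a = "\<lambda>_. 0" and \<alpha> = "\<lambda>\<theta>. \<theta>" and A = "2 * pi"])
    show "c > 0" using s \<rho>s by (simp add: c_def)
    fix \<theta> assume \<theta>: "\<theta> \<in> {pi + \<eta>..2 * pi - \<eta>}"
    then show "0 \<le> (0::real) \<and> 0 \<le> 2 * pi \<and> \<bar>\<theta>\<bar> \<le> 2 * pi \<and> \<bar>\<theta> - \<theta>\<bar> < pi / 2"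
      using \<eta> pi_gt_zero by auto
    have \<theta>3: "\<theta> \<ge> 3" using \<theta> \<eta> pi_gt3 by simp
    {
      fix t assume "t \<in> closed_segment (of_real \<rho> * cis (pi / 2)) (Complex (- 0) \<theta>)"
      then obtain u where u: "0 \<le> u" "u \<le> 1" "t = (1 - u) *\<^sub>R (of_real \<rho> * cis (pi / 2)) + u *\<^sub>R Complex (- 0) \<theta>"
        by (auto simp: in_segment)
      define y where "y = (1 - u) * \<rho> + u * \<theta>"
      have t: "t = Complex (- 0) y" unfolding u(3) by (simp add: y_def complex_eq_iff)
      have "u * \<rho> \<le> u * \<theta>" using u \<rho> \<theta>3 by (intro mult_left_mono) auto
      then have y: "\<rho> \<le> y" by (simp add: y_def algebra_simps)
      have "s * (\<rho> - sin \<rho>) \<le> (- sin \<theta>) * (y - sin y)"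
        using sin_le[OF \<theta>] s \<rho>s mono[OF y] by (intro mult_mono) auto
      then show "Re (cis \<theta> * (sinh t - t)) \<le> - c"
        unfolding t Re_saddle_phase by (simp add: c_def algebra_simps min_def)
    }
    fix x :: real assume x: "0 \<le> x"
    have "cos \<theta> * x \<le> 1 * x" using x by (intro mult_right_mono) auto
    \<comment> \<open>At height \<open>\<theta>\<close> the cosine and sine meet their own factors
      as squares, so nothing is lost when cosh is lowered to sinh.\<close>
    moreover have "sinh x * (cos \<theta>)\<^sup>2 + cosh x * (sin \<theta>)\<^sup>2 \<ge> sinh x"
    proof -
      have "sinh x * (sin \<theta>)\<^sup>2 \<le> cosh x * (sin \<theta>)\<^sup>2"
        by (intro mult_right_mono) (auto simp: sinh_le_cosh_real less_imp_le)
      moreover have "sinh x * (cos \<theta>)\<^sup>2 + sinh x * (sin \<theta>)\<^sup>2 = sinh x"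
        by (simp add: distrib_left[symmetric])
      ultimately show ?thesis by linarith
    qed
    moreover have "\<theta> * sin \<theta> \<le> - s"
    proof -
      have "1 * s \<le> \<theta> * (- sin \<theta>)" using sin_le[OF \<theta>] s \<theta>3 by (intro mult_mono) auto
      then show ?thesis by simp
    qed
    moreover have "Re (cis \<theta> * (sinh (Complex (- x) \<theta>) - Complex (- x) \<theta>)) =
        cos \<theta> * x - (sinh x * (cos \<theta>)\<^sup>2 + cosh x * (sin \<theta>)\<^sup>2) + \<theta> * sin \<theta>"
      unfolding Re_saddle_phase by (simp add: algebra_simps power2_eq_square)
    ultimately have "Re (cis \<theta> * (sinh (Complex (- x) \<theta>) - Complex (- x) \<theta>)) \<le> - (x ^ 3 / 6) - s"
      using sinh_real_ge_cubic[OF x] by argo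
    also have "\<dots> \<le> - (s / 6) * (1 + x)"
    proof (cases "x \<le> 1")
      case True
      then have "s * x \<le> s * 1" "0 \<le> x ^ 3" using s x by (auto intro!: mult_left_mono)
      moreover have "(s / 6) * (1 + x) = s / 6 + s * x / 6" by (simp add: algebra_simps)
      ultimately show ?thesis using s by argo
    next
      case False
      have "x ^ 1 \<le> x ^ 3" using False by (intro power_increasing) auto
      moreover have "s * x \<le> 1 * x" using s x by (intro mult_right_mono) auto
      ultimately show ?thesis using s by (simp add: algebra_simps)
    qed
    also have "\<dots> \<le> - c * (1 + x)"
      using x by (intro mult_right_mono) (auto simp: c_def)
    finally show "Re (cis \<theta> * (sinh (Complex (- x) \<theta>) - Complex (- x) \<theta>)) \<le> - c * (1 + x)" .
  qed simp
qed

text \<open>The two quantities are the real and imaginary parts of \<open>sinh t - t\<close> at t =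
  x (-1 + \<i>). Their positivity places it in the open first quadrant, which a rotation by pi/2 up
  to pi sends into the left half plane.\<close>

lemma diagonal_phase_pos:
  fixes x :: real
  assumes x: "0 < x" "x \<le> 2 * pi / 3"
  shows "x - sinh x * cos x > 0" "cosh x * sin x - x > 0"
proof -
  have cc: "1 - cosh y * cos y > 0" if "0 < y" "y < pi" for y :: real
  proof (rule strict_increasing_from_0[OF that(1), where f' = "\<lambda>y. cosh y * sin y - sinh y * cos y"])
    fix z assume z: "0 < z" "z < y"
    show "cosh z * sin z - sinh z * cos z > 0"
    proof (rule strict_increasing_from_0[OF z(1), where f' = "\<lambda>y. 2 * (sinh y * sin y)"])
      fix v assume "0 < v" "v < z"
      then show "2 * (sinh v * sin v) > 0" using z that by (simp add: sin_gt_zero)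
    qed (auto intro!: derivative_eq_intros)
  qed (auto intro!: derivative_eq_intros)
  show "x - sinh x * cos x > 0"
  proof (rule strict_increasing_from_0[OF x(1), where f' = "\<lambda>y. (1 - cosh y * cos y) + sinh y * sin y"])
    fix y assume y: "0 < y" "y < x"
    then have "y < pi" using x by simp
    then show "(1 - cosh y * cos y) + sinh y * sin y > 0"
      using cc[of y] y by (intro add_pos_pos) (auto simp: sin_gt_zero)
  qed (auto intro!: derivative_eq_intros)
  show "cosh x * sin x - x > 0"
  proof (cases "x \<le> pi / 2")
    case True
    show ?thesis
    proof (rule strict_increasing_from_0[OF x(1), where f' = "\<lambda>y. sinh y * sin y + cosh y * cos y - 1"])
      fix y assume y: "0 < y" "y < x"
      show "sinh y * sin y + cosh y * cos y - 1 > 0"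
      proof (rule strict_increasing_from_0[OF y(1), where f' = "\<lambda>y. 2 * (sinh y * cos y)"])
        fix v assume "0 < v" "v < y"
        then show "2 * (sinh v * cos v) > 0" using y True by (simp add: cos_gt_zero_pi)
      qed (auto intro!: derivative_eq_intros)
    qed (auto intro!: derivative_eq_intros)
  next
    case False
    \<comment> \<open>Past pi/2 the second derivative changes sign, so a direct bound replaces
      monotonicity: sin x stays above 4/5, and (4/5) (1 + x^2 / 2) - x has no real root.\<close>
    have "cos (pi / 6) \<le> cos (x - pi / 2)" using False x by (intro cos_monotone_0_pi_le) auto
    then have "sqrt 3 / 2 \<le> sin x" by (simp add: cos_diff cos_30)
    moreover have "sqrt 3 \<ge> 8 / 5" by (rule real_le_rsqrt) (simp add: power2_eq_square)
    ultimately have s: "4 / 5 \<le> sin x" by simp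
    have "x < (1 + x\<^sup>2 / 2) * (4 / 5)"
    proof -
      have "0 \<le> (x - 5 / 4)\<^sup>2" by simp
      then show ?thesis by (simp add: power2_eq_square algebra_simps)
    qed
    also have "\<dots> \<le> cosh x * sin x"
      using cosh_real_gt_quadratic[OF x(1)] s by (intro mult_mono) (auto intro: add_nonneg_nonneg)
    finally show ?thesis by simp
  qed
qed

text \<open>At height 2 pi/3 the cosine is negative and the sine positive, so both components grow.
  The height is also less than pi/2 away from all phases between pi/2 - 1/4 and pi + 1/4. The factor
  6 bounds the slope in both directions.\<close>

lemma horizontal_phase_bounds:
  fixes x :: real
  assumes x: "x \<ge> 2 * pi / 3"
  defines "P \<equiv> x - sinh x * cos (2 * pi / 3)" and "Q \<equiv> cosh x * sin (2 * pi / 3) - 2 * pi / 3"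
  shows "P \<ge> (1 + x) / 4" "Q \<ge> (1 + x) / 4" "P \<le> 6 * Q" "Q \<le> 6 * P"
proof -
  have x2: "x \<ge> 2" using x pi_gt3 by simp
  have P: "P = x + sinh x / 2" by (simp add: P_def cos_120)
  have Q: "Q = cosh x * (sqrt 3 / 2) - 2 * pi / 3" by (simp add: Q_def sin_120)
  have sh: "sinh x \<ge> x" using sinh_real_gt[of x] x2 by simp
  have shc: "sinh x \<le> cosh x" by (rule sinh_le_cosh_real)
  \<comment> \<open>The quadratic Taylor bound is too weak near 2; the quartic one with x^2 >= 2 x
    and x^4 >= 8 x gives x + x / 3.\<close>
  have ch: "cosh x \<ge> 1 + 4 * x / 3"
  proof -
    have "x > 0" using x2 by simp
    then have "cosh x - 1 - x\<^sup>2 / 2 - x ^ 4 / 24 > 0"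
    proof (rule strict_increasing_from_0[where f' = "\<lambda>y. sinh y - y - y ^ 3 / 6"])
      fix y :: real assume y: "0 < y"
      show "sinh y - y - y ^ 3 / 6 > 0"
      proof (rule strict_increasing_from_0[OF y, where f' = "\<lambda>y. cosh y - 1 - y\<^sup>2 / 2"])
        fix z :: real assume "z > 0"
        then show "cosh z - 1 - z\<^sup>2 / 2 > 0" using cosh_real_gt_quadratic[of z] by simp
      qed (auto intro!: derivative_eq_intros)
    qed (auto intro!: derivative_eq_intros)
    moreover have "x\<^sup>2 \<ge> 2 * x" using x2 by (simp add: power2_eq_square)
    moreover have "x ^ 4 \<ge> 8 * x"
    proof -
      have "2 ^ 3 * x \<le> x ^ 3 * x" using x2 by (intro mult_right_mono power_mono) auto
      also have "x ^ 3 * x = x ^ 4" by (simp add: power3_eq_cube power4_eq_xxxx)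
      finally show ?thesis by simp
    qed
    ultimately show ?thesis by argo
  qed
  have "sqrt 3 \<ge> 17 / 10" by (rule real_le_rsqrt) (simp add: power2_eq_square)
  then have "cosh x * (17 / 20) \<le> cosh x * (sqrt 3 / 2)" by (intro mult_left_mono) auto
  moreover have pi: "pi < 63 / 20" using pi_approx by simp
  ultimately have Q1: "Q \<ge> 17 / 20 * cosh x - 21 / 10" unfolding Q by argo
  have "sqrt 3 / 2 \<le> 1" by (simp add: real_le_lsqrt)
  then have "cosh x * (sqrt 3 / 2) \<le> cosh x * 1" by (intro mult_left_mono) auto
  then have Q2: "Q \<le> cosh x" unfolding Q using pi_gt_zero by argo
  show "P \<ge> (1 + x) / 4" unfolding P using sh x2 by argo
  show "Q \<ge> (1 + x) / 4" using Q1 ch x2 by argo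
  show "P \<le> 6 * Q" using Q1 ch x2 sh shc unfolding P by argo
  have "cosh x = sinh x + exp (- x)" by (simp add: sinh_def cosh_def field_simps)
  moreover have "exp (- x) \<le> 1" using x2 by simp
  ultimately show "Q \<le> 6 * P" using Q2 sh x2 unfolding P by argo
qed

text \<open>P + \<i> Q has slope between 1 / T and T, so it can be turned slightly too little or too
  far and still land in the left half plane. At the ends \<open>sin \<eta> * T \<le> 1 / 4\<close>
  competes with \<open>cos \<eta> \<ge> 1 / 2\<close>, leaving a quarter; in between, the moduli of
  cosine and sine add up to at least 1.\<close>

lemma rotated_phase_le:
  fixes P Q T \<eta> \<theta> :: real
  assumes PQ: "P \<ge> m" "Q \<ge> m" "m \<ge> 0" "P \<le> T * Q" "Q \<le> T * P" and T: "T \<ge> 1"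
    and \<eta>: "0 \<le> \<eta>" "\<eta> \<le> 1 / (4 * T)" and \<theta>: "\<theta> \<in> {pi / 2 - \<eta>..pi + \<eta>}"
  shows "cos \<theta> * P - sin \<theta> * Q \<le> - (m / 4)"
proof -
  have "1 / (4 * T) \<le> 1 / 4" using T by (simp add: field_simps)
  then have \<eta>1: "\<eta> \<le> 1 / 4" using \<eta> by simp
  have s: "sin \<eta> * T \<le> 1 / 4" "sin \<eta> \<ge> 0"
  proof -
    have "sin \<eta> * T \<le> \<eta> * T" using T \<eta> sin_x_le_x[of \<eta>] by (intro mult_right_mono) auto
    also have "\<dots> \<le> 1 / 4" using \<eta> T by (simp add: field_simps)
    finally show "sin \<eta> * T \<le> 1 / 4" .
    show "sin \<eta> \<ge> 0" using \<eta> \<eta>1 pi_gt3 by (intro sin_ge_zero) auto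
  qed
  have c: "cos \<eta> \<ge> 1 / 2"
  proof -
    have "cos (pi / 3) \<le> cos \<eta>" using \<eta> \<eta>1 pi_gt3 by (intro cos_monotone_0_pi_le) auto
    then show ?thesis by (simp add: cos_60)
  qed
  have key: "sin \<eta> * V - cos \<eta> * U \<le> - (m / 4)" if "U \<ge> m" "V \<le> T * U" for U V
  proof -
    have "sin \<eta> * V \<le> sin \<eta> * (T * U)" using s that by (intro mult_left_mono) auto
    also have "\<dots> = (sin \<eta> * T) * U" by simp
    also have "\<dots> \<le> 1 / 4 * U" using s that PQ by (intro mult_right_mono) auto
    finally have "sin \<eta> * V \<le> 1 / 4 * U" .
    moreover have "1 / 2 * U \<le> cos \<eta> * U" using c that PQ by (intro mult_right_mono) auto
    ultimately show ?thesis using that by argo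
  qed
  consider "\<theta> \<le> pi / 2" | "pi / 2 \<le> \<theta>" "\<theta> \<le> pi" | "pi \<le> \<theta>" by linarith
  then show ?thesis
  proof cases
    case 1
    define \<beta> where "\<beta> = pi / 2 - \<theta>"
    have \<beta>: "0 \<le> \<beta>" "\<beta> \<le> \<eta>" using 1 \<theta> by (auto simp: \<beta>_def)
    have "cos \<theta> = sin \<beta>" "sin \<theta> = cos \<beta>" by (simp_all add: \<beta>_def sin_diff cos_diff)
    moreover have "sin \<beta> * P \<le> sin \<eta> * P"
      using \<beta> \<eta>1 pi_gt3 PQ by (intro mult_right_mono sin_monotone_2pi_le) auto
    moreover have "cos \<eta> * Q \<le> cos \<beta> * Q"
      using \<beta> \<eta>1 pi_gt3 PQ by (intro mult_right_mono cos_monotone_0_pi_le) auto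
    moreover have "cos \<theta> * P - sin \<theta> * Q = sin \<beta> * P - cos \<beta> * Q" by (simp only: calculation(1,2))
    ultimately show ?thesis using key[OF PQ(2,4)] by argo
  next
    case 2
    define a b where "a = - cos \<theta>" "b = sin \<theta>"
    have "cos (pi - \<theta>) \<ge> 0" using 2 by (intro cos_ge_zero) auto
    then have a: "a \<ge> 0" by (simp add: a_b_def cos_diff)
    have b: "b \<ge> 0" unfolding a_b_def using 2 pi_gt_zero by (intro sin_ge_zero) linarith+
    have "1 \<le> (a + b)\<^sup>2"
    proof -
      have "a\<^sup>2 + b\<^sup>2 = 1" by (simp add: a_b_def)
      then have "(a + b)\<^sup>2 = 1 + 2 * (a * b)" by (simp add: power2_sum)
      then show ?thesis using a b by simp
    qed
    then have "1 \<le> a + b" using a b by (metis abs_le_square_iff abs_of_nonneg abs_one add_nonneg_nonneg one_power2)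
    then have "1 * m \<le> (a + b) * m" using PQ by (intro mult_right_mono) auto
    moreover have "a * m \<le> a * P" "b * m \<le> b * Q" using a b PQ by (auto intro!: mult_left_mono)
    ultimately have "m \<le> a * P + b * Q" by (simp add: distrib_right)
    then show ?thesis using PQ unfolding a_b_def by (simp add: algebra_simps)
  next
    case 3
    define \<beta> where "\<beta> = \<theta> - pi"
    have \<beta>: "0 \<le> \<beta>" "\<beta> \<le> \<eta>" using 3 \<theta> by (auto simp: \<beta>_def)
    have "cos \<theta> = - cos \<beta>" "sin \<theta> = - sin \<beta>" by (simp_all add: \<beta>_def sin_diff cos_diff)
    moreover have "sin \<beta> * Q \<le> sin \<eta> * Q"
      using \<beta> \<eta>1 pi_gt3 PQ by (intro mult_right_mono sin_monotone_2pi_le) auto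
    moreover have "cos \<eta> * P \<le> cos \<beta> * P"
      using \<beta> \<eta>1 pi_gt3 PQ by (intro mult_right_mono cos_monotone_0_pi_le) auto
    ultimately show ?thesis using key[OF PQ(1,5)] by (simp add: algebra_simps)
  qed
qed

text \<open>Phases near \<open>{pi / 2..pi}\<close>: along the path through \<open>(2 pi / 3)(- 1 + \<i>)\<close>, \<open>sinh t - t\<close> stays in a closed
  subsector of the open first quadrant, which leaves room for a small excess of \<open>\<theta>\<close> on both sides.\<close>

lemma descent_diagonal:
  assumes \<rho>: "0 < \<rho>" "\<rho> \<le> 1"
  obtains \<eta> where "0 < \<eta>" "\<eta> \<le> 1 / 4" "descent {pi / 2 - \<eta>..pi + \<eta>} (of_real \<rho> * cis (3 * pi / 4))"
proof -
  define X x0 where "X = 2 * pi / 3" "x0 = \<rho> * sqrt 2 / 2"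
  define P Q where "P = (\<lambda>x::real. x - sinh x * cos x)" "Q = (\<lambda>x::real. cosh x * sin x - x)"
  have sq: "sqrt 2 \<le> 2" by (rule real_le_lsqrt) auto
  have x0: "0 < x0" "x0 \<le> X"
  proof -
    show "0 < x0" using \<rho> by (simp add: X_x0_def)
    have "\<rho> * sqrt 2 \<le> 1 * 2" using \<rho> sq by (intro mult_mono) auto
    then have "x0 \<le> 1" by (simp add: X_x0_def)
    then show "x0 \<le> X" using pi_gt3 unfolding X_x0_def by linarith
  qed
  have pos: "P x > 0" "Q x > 0" if "x \<in> {x0..X}" for x
    using diagonal_phase_pos[of x] that x0 by (auto simp: P_Q_def X_x0_def)
  have cont: "continuous_on {x0..X} P" "continuous_on {x0..X} Q"
    unfolding P_Q_def by (auto intro!: continuous_intros)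
  have ne: "{x0..X} \<noteq> {}" using x0 by simp
  obtain p where p: "p \<in> {x0..X}" "\<And>x. x \<in> {x0..X} \<Longrightarrow> P p \<le> P x"
    using continuous_attains_inf[OF compact_Icc ne cont(1)] by blast
  obtain q where q: "q \<in> {x0..X}" "\<And>x. x \<in> {x0..X} \<Longrightarrow> Q q \<le> Q x"
    using continuous_attains_inf[OF compact_Icc ne cont(2)] by blast
  obtain p' where p': "p' \<in> {x0..X}" "\<And>x. x \<in> {x0..X} \<Longrightarrow> P x \<le> P p'"
    using continuous_attains_sup[OF compact_Icc ne cont(1)] by blast
  obtain q' where q': "q' \<in> {x0..X}" "\<And>x. x \<in> {x0..X} \<Longrightarrow> Q x \<le> Q q'"
    using continuous_attains_sup[OF compact_Icc ne cont(2)] by blast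
  \<comment> \<open>The slope bound \<open>T\<close> combines 6 from the horizontal ray with
    \<open>M / m\<close> from the compact diagonal. Capping \<open>m\<close> at 1 lets the constant
    \<open>m / 16\<close> serve the ray as well, where the descent is (1 + x) / 16.\<close>
  define m M T \<eta> where "m = min 1 (min (P p) (Q q))" "M = max (P p') (Q q')" "T = max 6 (M / m)" "\<eta> = 1 / (4 * T)"
  have m: "m > 0" "m \<le> 1" using pos p(1) q(1) by (auto simp: m_M_T_\<eta>_def)
  have T: "T \<ge> 6" by (simp add: m_M_T_\<eta>_def)
  have mT: "M \<le> T * m"
  proof -
    have "M / m \<le> T" by (simp add: m_M_T_\<eta>_def)
    then show ?thesis using m by (simp add: field_simps)
  qed
  show ?thesis
  proof (rule that[of \<eta>])
    show "0 < \<eta>" "\<eta> \<le> 1 / 4" using T by (auto simp: m_M_T_\<eta>_def(4) field_simps)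
    then have \<eta>: "0 \<le> \<eta>" "\<eta> \<le> 1 / (4 * T)" "\<eta> \<le> 1 / 4" by (auto simp: m_M_T_\<eta>_def(4))
    show "descent {pi / 2 - \<eta>..pi + \<eta>} (of_real \<rho> * cis (3 * pi / 4))"
    proof (rule descentI[where c = "m / 16" and a = "\<lambda>_. X" and \<alpha> = "\<lambda>_. X" and A = X])
      show "m / 16 > 0" "X \<ge> 0" using m by (auto simp: X_x0_def)
      fix \<theta> assume \<theta>: "\<theta> \<in> {pi / 2 - \<eta>..pi + \<eta>}"
      then show "0 \<le> X \<and> X \<le> X \<and> \<bar>X\<bar> \<le> X \<and> \<bar>X - \<theta>\<bar> < pi / 2"
        using \<eta>(3) pi_gt3 by (auto simp: X_x0_def abs_if)
      {
        fix t assume "t \<in> closed_segment (of_real \<rho> * cis (3 * pi / 4)) (Complex (- X) X)"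
        then obtain u where u: "0 \<le> u" "u \<le> 1"
          "t = (1 - u) *\<^sub>R (of_real \<rho> * cis (3 * pi / 4)) + u *\<^sub>R Complex (- X) X"
          by (auto simp: in_segment)
        have cs: "cos (3 * pi / 4) = - (sqrt 2 / 2)" "sin (3 * pi / 4) = sqrt 2 / 2"
          using cos_diff[of pi "pi / 4"] sin_diff[of pi "pi / 4"] by (simp_all add: cos_45 sin_45)
        define x where "x = (1 - u) * x0 + u * X"
        have d: "cis (3 * pi / 4) = Complex (- (sqrt 2 / 2)) (sqrt 2 / 2)"
          by (simp add: complex_eq_iff cs)
        have t: "t = Complex (- x) x"
          unfolding u(3) d by (simp add: x_def complex_eq_iff X_x0_def(2) field_simps)
        have x: "x \<in> {x0..X}"
        proof -
          have "u * x0 \<le> u * X" "(1 - u) * x0 \<le> (1 - u) * X" using u x0 by (auto intro!: mult_left_mono)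
          then show ?thesis by (simp add: x_def algebra_simps)
        qed
        have "P x \<ge> m" "Q x \<ge> m" "P x \<le> M" "Q x \<le> M"
          using p(2)[OF x] q(2)[OF x] p'(2)[OF x] q'(2)[OF x] by (auto simp: m_M_T_\<eta>_def)
        moreover from this have "P x \<le> T * Q x" "Q x \<le> T * P x"
          using mT T by (meson mult_left_mono order_trans zero_le_numeral)+
        ultimately have "cos \<theta> * P x - sin \<theta> * Q x \<le> - (m / 4)"
          using m T \<eta> \<theta> by (intro rotated_phase_le[where T = T and \<eta> = \<eta>]) auto
        also have "\<dots> \<le> - (m / 16)" using m by simp
        finally show "Re (cis \<theta> * (sinh t - t)) \<le> - (m / 16)"
          unfolding t Re_saddle_phase P_Q_def .
      }
      fix x assume x: "X \<le> x"
      have x': "x \<ge> 2 * pi / 3" using x by (simp add: X_x0_def)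
      note b = horizontal_phase_bounds[OF x']
      let ?P = "x - sinh x * cos X" and ?Q = "cosh x * sin X - X"
      have "?P \<le> T * ?Q" "?Q \<le> T * ?P"
      proof -
        have "0 \<le> (1 + x) / 4" using x x0 by simp
        then have "0 \<le> ?Q" "0 \<le> ?P" using b(1,2) unfolding X_x0_def(1) by linarith+
        then have "6 * ?Q \<le> T * ?Q" "6 * ?P \<le> T * ?P" using T by (intro mult_right_mono; simp)+
        then show "?P \<le> T * ?Q" "?Q \<le> T * ?P" using b(3,4) by (auto simp: X_x0_def)
      qed
      then have "cos \<theta> * ?P - sin \<theta> * ?Q \<le> - ((1 + x) / 4 / 4)"
        using b(1,2) T \<eta> \<theta> x x0 by (intro rotated_phase_le[where T = T and \<eta> = \<eta>]) (auto simp: X_x0_def)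
      also have "\<dots> \<le> - (m / 16) * (1 + x)"
      proof -
        have "m * (1 + x) \<le> 1 * (1 + x)" using m x x0 by (intro mult_right_mono) auto
        then show ?thesis by (simp add: algebra_simps)
      qed
      finally show "Re (cis \<theta> * (sinh (Complex (- x) X) - Complex (- x) X)) \<le> - (m / 16) * (1 + x)"
        unfolding Re_saddle_phase .
    qed
  qed
qed

section \<open>The expansion\<close>

lemma arm_expansion_subset: "arm_expansion_on \<kappa> N \<Theta> \<Longrightarrow> \<Theta>' \<subseteq> \<Theta> \<Longrightarrow> arm_expansion_on \<kappa> N \<Theta>'"
  unfolding arm_expansion_on_def by (meson subsetD)

lemma arm_expansion_Un:
  assumes "arm_expansion_on \<kappa> N \<Theta>" "arm_expansion_on \<kappa> N \<Theta>'"
  shows "arm_expansion_on \<kappa> N (\<Theta> \<union> \<Theta>')"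
proof -
  let ?P = "\<lambda>w C. norm (arm (Im w) (bker (exp w - \<kappa>) w) - arm_sum \<kappa> N w) \<le> C * exp (- (real (N + 1) / 3) * Re w)"
  obtain C X where 1: "\<And>w. X \<le> Re w \<Longrightarrow> Im w \<in> \<Theta> \<Longrightarrow> ?P w C"
    using assms(1) unfolding arm_expansion_on_def by blast
  obtain C' X' where 2: "\<And>w. X' \<le> Re w \<Longrightarrow> Im w \<in> \<Theta>' \<Longrightarrow> ?P w C'"
    using assms(2) unfolding arm_expansion_on_def by blast
  have mono: "?P w (max C C')" if "?P w C \<or> ?P w C'" for w
    using that by (auto elim!: order_trans intro!: mult_right_mono)
  show ?thesis
    unfolding arm_expansion_on_def
  proof (intro exI allI impI)
    fix w assume "max X X' \<le> Re w" "Im w \<in> \<Theta> \<union> \<Theta>'"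
    then show "?P w (max C C')" using 1[of w] 2[of w] by (intro mono) auto
  qed
qed

text \<open>The mirrored direction is written 2 pi - \<phi> and not -\<phi>, because the local
  expansion depends on the lift of the angle: with this lift the branch condition at the opposite
  phase merely changes sign.\<close>

lemma arm_expansion_symmetric:
  assumes \<psi>: "0 \<le> \<psi>" "\<psi> < pi / 2"
  obtains \<rho> where "0 < \<rho>" "\<rho> \<le> 1" "\<And>\<Theta>. (\<And>\<theta>. \<theta> \<in> \<Theta> \<Longrightarrow> \<bar>\<theta> + 3 * \<phi> - 3 * pi\<bar> \<le> \<psi>) \<Longrightarrow>
    descent \<Theta> (of_real \<rho> * cis \<phi>) \<Longrightarrow> arm_expansion_on \<kappa> N (\<Theta> \<union> uminus ` \<Theta>)"
proof -
  let ?P = "\<lambda>\<phi> \<rho>. \<exists>C X. \<forall>w. X \<le> Re w \<longrightarrow> \<bar>Im w + 3 * \<phi> - 3 * pi\<bar> \<le> \<psi> \<longrightarrow>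
    norm (prim (bker (exp w - \<kappa>) w) (of_real \<rho> * cis \<phi>) - arm_sum \<kappa> N w) \<le> C * exp (- (real (N + 1) / 3) * Re w)"
  obtain \<rho>1 where \<rho>1: "\<rho>1 > 0" "\<And>\<rho>. 0 < \<rho> \<Longrightarrow> \<rho> \<le> \<rho>1 \<Longrightarrow> ?P \<phi> \<rho>"
    using watson_local[OF \<psi>, of \<phi> \<kappa> N] by metis
  obtain \<rho>2 where \<rho>2: "\<rho>2 > 0" "\<And>\<rho>. 0 < \<rho> \<Longrightarrow> \<rho> \<le> \<rho>2 \<Longrightarrow> ?P (2 * pi - \<phi>) \<rho>"
    using watson_local[OF \<psi>, of "2 * pi - \<phi>" \<kappa> N] by metis
  define \<rho> where "\<rho> = min 1 (min \<rho>1 \<rho>2)"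
  have \<rho>: "0 < \<rho>" "\<rho> \<le> 1" "\<rho> \<le> \<rho>1" "\<rho> \<le> \<rho>2" using \<rho>1 \<rho>2 by (auto simp: \<rho>_def)
  show ?thesis
  proof (rule that[OF \<rho>(1,2)])
    fix \<Theta> assume \<Theta>: "\<And>\<theta>. \<theta> \<in> \<Theta> \<Longrightarrow> \<bar>\<theta> + 3 * \<phi> - 3 * pi\<bar> \<le> \<psi>"
      and d: "descent \<Theta> (of_real \<rho> * cis \<phi>)"
    have 1: "arm_expansion_on \<kappa> N \<Theta>"
      by (rule arm_expansion_of_descent[OF _ d]) (use \<rho>1(2)[OF \<rho>(1,3)] \<Theta> in blast)
    have "cis (2 * pi - \<phi>) = cnj (cis \<phi>)" by (simp add: complex_eq_iff cos_diff sin_diff)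
    then have e: "cnj (of_real \<rho> * cis \<phi>) = of_real \<rho> * cis (2 * pi - \<phi>)" by simp
    have "\<bar>\<theta> + 3 * (2 * pi - \<phi>) - 3 * pi\<bar> \<le> \<psi>" if mem: "\<theta> \<in> uminus ` \<Theta>" for \<theta>
    proof -
      obtain \<theta>' where "\<theta>' \<in> \<Theta>" "\<theta> = - \<theta>'" using mem by blast
      then show ?thesis using \<Theta>[of \<theta>'] by (simp add: abs_le_iff algebra_simps)
    qed
    then have 2: "arm_expansion_on \<kappa> N (uminus ` \<Theta>)"
      using \<rho>2(2)[OF \<rho>(1,4)] by (intro arm_expansion_of_descent[OF _ descent_cnj[OF d, unfolded e]]) blast
    show "arm_expansion_on \<kappa> N (\<Theta> \<union> uminus ` \<Theta>)" by (rule arm_expansion_Un[OF 1 2])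
  qed
qed

lemma arm_expansion:
  assumes \<delta>: "0 < \<delta>"
  shows "arm_expansion_on \<kappa> N {- (2 * pi) + \<delta>..2 * pi - \<delta>}"
proof -
  \<comment> \<open>The overhang of the diagonal range depends on the radius chosen here, but never
    exceeds 1/4. Phases are thus within pi/4 + 1/4 of 3 pi/4, and 3 pi/8 can be fixed
    beforehand.\<close>
  obtain \<rho> where \<rho>: "0 < \<rho>" "\<rho> \<le> 1" and mid: "\<And>\<Theta>. (\<And>\<theta>. \<theta> \<in> \<Theta> \<Longrightarrow> \<bar>\<theta> + 3 * (3 * pi / 4) - 3 * pi\<bar> \<le> 3 * pi / 8) \<Longrightarrow>
    descent \<Theta> (of_real \<rho> * cis (3 * pi / 4)) \<Longrightarrow> arm_expansion_on \<kappa> N (\<Theta> \<union> uminus ` \<Theta>)"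
    using arm_expansion_symmetric[of "3 * pi / 8" "3 * pi / 4" \<kappa> N] pi_gt_zero by auto
  obtain \<eta>0 where \<eta>0: "0 < \<eta>0" "\<eta>0 \<le> 1 / 4" and d: "descent {pi / 2 - \<eta>0..pi + \<eta>0} (of_real \<rho> * cis (3 * pi / 4))"
    using descent_diagonal[OF \<rho>] by metis
  \<comment> \<open>Being at most \<open>\<eta>0\<close> makes the three ranges overlap, being at
    most \<open>\<delta>\<close> makes them reach the ends of the interval.\<close>
  define \<eta> where "\<eta> = min \<eta>0 \<delta>"
  have \<eta>: "0 < \<eta>" "\<eta> \<le> pi / 2" "\<eta> \<le> \<eta>0" "\<eta> \<le> \<delta>" using \<eta>0 \<delta> pi_gt3 by (auto simp: \<eta>_def)
  let ?M = "{pi / 2 - \<eta>0..pi + \<eta>0}" and ?R = "{- (pi / 2 - \<eta>)..pi / 2 - \<eta>}" and ?I = "{pi + \<eta>..2 * pi - \<eta>}"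
  have M: "arm_expansion_on \<kappa> N (?M \<union> uminus ` ?M)"
  proof (rule mid[OF _ d])
    fix \<theta> assume "\<theta> \<in> ?M"
    then have "pi / 2 - \<eta>0 \<le> \<theta>" "\<theta> \<le> pi + \<eta>0" by auto
    then show "\<bar>\<theta> + 3 * (3 * pi / 4) - 3 * pi\<bar> \<le> 3 * pi / 8"
      using \<eta>0 pi_gt3 unfolding abs_le_iff by argo
  qed
  have \<psi>: "0 \<le> pi / 2 - \<eta>" "pi / 2 - \<eta> < pi / 2" using \<eta> by auto
  have R: "arm_expansion_on \<kappa> N (?R \<union> uminus ` ?R)"
  proof -
    obtain \<rho> where "0 < \<rho>" "\<rho> \<le> 1" and *: "\<And>\<Theta>. (\<And>\<theta>. \<theta> \<in> \<Theta> \<Longrightarrow> \<bar>\<theta> + 3 * pi - 3 * pi\<bar> \<le> pi / 2 - \<eta>) \<Longrightarrow>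
        descent \<Theta> (of_real \<rho> * cis pi) \<Longrightarrow> arm_expansion_on \<kappa> N (\<Theta> \<union> uminus ` \<Theta>)"
      using arm_expansion_symmetric[OF \<psi>, of pi \<kappa> N] by metis
    then show ?thesis by (intro * descent_real_axis \<eta>) (auto simp: abs_le_iff)
  qed
  have I: "arm_expansion_on \<kappa> N (?I \<union> uminus ` ?I)"
  proof -
    obtain \<rho> where "0 < \<rho>" "\<rho> \<le> 1" and *: "\<And>\<Theta>. (\<And>\<theta>. \<theta> \<in> \<Theta> \<Longrightarrow> \<bar>\<theta> + 3 * (pi / 2) - 3 * pi\<bar> \<le> pi / 2 - \<eta>) \<Longrightarrow>
        descent \<Theta> (of_real \<rho> * cis (pi / 2)) \<Longrightarrow> arm_expansion_on \<kappa> N (\<Theta> \<union> uminus ` \<Theta>)"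
      using arm_expansion_symmetric[OF \<psi>, of "pi / 2" \<kappa> N] by metis
    then show ?thesis by (intro * descent_imaginary_axis \<eta>) (auto simp: abs_le_iff)
  qed
  show ?thesis
  proof (rule arm_expansion_subset[OF arm_expansion_Un[OF arm_expansion_Un[OF M R] I]])
    show "{- (2 * pi) + \<delta>..2 * pi - \<delta>} \<subseteq> (?M \<union> uminus ` ?M) \<union> (?R \<union> uminus ` ?R) \<union> (?I \<union> uminus ` ?I)"
    proof
      fix \<theta> assume "\<theta> \<in> {- (2 * pi) + \<delta>..2 * pi - \<delta>}"
      then have "\<bar>\<theta>\<bar> \<in> {0..2 * pi - \<eta>}" using \<eta> by (auto simp: abs_le_iff)
      then have "\<bar>\<theta>\<bar> \<in> ?M \<union> ?R \<union> ?I" using \<eta> by auto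
      moreover have "x = \<bar>x\<bar> \<or> x = - \<bar>x\<bar>" for x :: real by linarith
      ultimately show "\<theta> \<in> (?M \<union> uminus ` ?M) \<union> (?R \<union> uminus ` ?R) \<union> (?I \<union> uminus ` ?I)"
        by (metis UnE UnI1 UnI2 imageI)
    qed
  qed
qed

text \<open>\<open>B_base\<close> is even, so negating \<open>\<kappa>\<close> amounts to negating
  \<open>t\<close> in the generating function. This lets the reflected arm share the coefficients of
  the first.\<close>

lemma B_poly_uminus: "B_poly n (- \<kappa>) = (-1) ^ n * B_poly n \<kappa>"
proof -
  obtain r where r: "r > 0" and q: "\<And>t. t \<in> ball 0 r \<Longrightarrow> qfun t \<notin> \<real>\<^sub>\<le>\<^sub>0"
    using qfun_near_0[of 1] by (metis zero_less_one)
  define f where "f = (\<lambda>t. exp (\<kappa> * t) * B_base t powr (of_nat (n + 1) / 3))"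
  have inv: "1 / qfun t \<notin> \<real>\<^sub>\<le>\<^sub>0" if "t \<in> ball 0 r" for t
    using q[OF that] by (metis inverse_eq_divide nonpos_Reals_inverse_iff)
  have q0: "qfun t \<noteq> 0" if "t \<in> ball 0 r" for t using q[OF that] by auto
  have f: "f holomorphic_on ball 0 r"
    unfolding f_def B_base_eq by (intro holomorphic_intros inv q0) auto
  have even: "B_base (- t) = B_base t" for t
  proof -
    have "(- t) ^ 3 = - (t ^ 3)" "sinh (- t) - - t = - (sinh t - t)" by simp_all
    then show ?thesis unfolding B_base_def by (simp only: minus_divide_divide neg_equal_0_iff_equal)
  qed
  have "(\<lambda>t. exp (- \<kappa> * t) * B_base t powr (of_nat (n + 1) / 3)) = (\<lambda>t. f (- 1 * t))"
    by (simp add: f_def even fun_eq_iff)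
  moreover have "(deriv ^^ n) (\<lambda>t. f (- 1 * t)) 0 = (- 1) ^ n * (deriv ^^ n) f (- 1 * 0)"
    by (rule higher_deriv_compose_linear[OF f open_ball[of 0 r] open_ball]) (use r in auto)
  ultimately show ?thesis by (simp add: B_poly_def f_def)
qed

text \<open>With E = exp (\<sigma> \<i> x), x = (n+1) pi/3, the cube of E is the sign of
  \<open>arm_const\<close>, and the two arms add up to E^3 - E, which is E^2 (E - 1/E), a multiple
  of E^2 sin x.\<close>

lemma arm_sums_eq:
  assumes \<sigma>: "\<sigma> = 1 \<or> \<sigma> = -1" and w': "w' = w - \<sigma> * \<i> * of_real pi"
  shows "\<sigma> * \<i> / of_real pi * (arm_sum \<kappa> N w + arm_sum (- \<kappa>) N w') =
    - (2 / (3 * of_real pi)) *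
      (\<Sum>n<N. 6 powr (of_nat (n + 1) / 3) * B_poly n \<kappa>
         * exp (\<sigma> * (2 * of_nat (n + 1) * of_real pi * \<i> / 3))
         * sin (of_nat (n + 1) * of_real pi / 3)
         * (Gamma (of_nat (n + 1) / 3) / surf_powr w (of_nat (n + 1) / 3)))"
proof -
  have "\<sigma> * \<i> / of_real pi * (B_poly n \<kappa> * (arm_const n * exp (- (of_nat (n + 1) / 3) * w)) +
        B_poly n (- \<kappa>) * (arm_const n * exp (- (of_nat (n + 1) / 3) * w'))) =
      - (2 / (3 * of_real pi)) * (6 powr (of_nat (n + 1) / 3) * B_poly n \<kappa>
         * exp (\<sigma> * (2 * of_nat (n + 1) * of_real pi * \<i> / 3))
         * sin (of_nat (n + 1) * of_real pi / 3)
         * (Gamma (of_nat (n + 1) / 3) / surf_powr w (of_nat (n + 1) / 3)))" for n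
  proof -
    define s x E W where "s = (of_nat (n + 1) / 3 :: complex)" "x = (of_nat (n + 1) * of_real pi / 3 :: complex)"
      "E = exp (\<sigma> * \<i> * x)" "W = exp (- s * w)"
    have \<sigma>2: "\<sigma> * \<sigma> = 1" using \<sigma> by auto
    have E0: "E \<noteq> 0" by (simp add: s_x_E_W_def)
    have "of_nat 3 * (\<sigma> * \<i> * x) = of_nat (n + 1) * (\<sigma> * \<i> * of_real pi)"
      by (simp add: s_x_E_W_def(2))
    then have "E ^ 3 = exp (of_nat (n + 1) * (\<sigma> * \<i> * of_real pi))"
      unfolding s_x_E_W_def(3) exp_of_nat_mult[of 3, symmetric] by (rule arg_cong)
    also have "\<dots> = (-1) ^ (n + 1)"
      unfolding exp_of_nat_mult using \<sigma> by (auto simp: exp_minus mult.commute[of \<i>])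
    finally have E3: "E ^ 3 = (-1) ^ (n + 1)" .
    have xs: "x = s * of_real pi" by (simp add: s_x_E_W_def)
    have "- s * w' = - s * w + \<sigma> * \<i> * x" by (simp add: w' xs algebra_simps)
    then have W': "exp (- s * w') = W * E" by (simp only: exp_add s_x_E_W_def(3,4))
    have E2: "exp (\<sigma> * (2 * of_nat (n + 1) * of_real pi * \<i> / 3)) = E ^ 2"
      unfolding s_x_E_W_def exp_of_nat_mult[symmetric] by (simp add: algebra_simps)
    have sin: "sin x = \<sigma> * (E - 1 / E) / (2 * \<i>)"
      using \<sigma> by (auto simp: sin_exp_eq s_x_E_W_def exp_minus divide_simps)
    have sp: "1 / surf_powr w s = W" by (simp add: surf_powr_def s_x_E_W_def exp_minus divide_simps)
    define b p g where "b = B_poly n \<kappa>" "p = (6 :: complex) powr s" "g = Gamma s"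
    have pi0: "of_real pi \<noteq> (0 :: complex)" by simp
    have "\<sigma> * \<i> / of_real pi * (b * (E ^ 3 * p * g / 3 * W) + (- 1) ^ n * b * (E ^ 3 * p * g / 3 * (W * E)))
        = \<sigma> * \<i> / (3 * of_real pi) * (b * p * g * W) * (E ^ 3 + ((- 1) ^ n * E ^ 3) * E)"
      by (simp add: field_simps)
    also have "(- 1) ^ n * E ^ 3 = (-1 :: complex)"
      by (simp add: E3 power_mult_distrib[symmetric])
    also have "\<sigma> * \<i> / (3 * of_real pi) * (b * p * g * W) * (E ^ 3 + -1 * E)
        = - (2 / (3 * of_real pi)) * (p * b * E\<^sup>2 * (\<sigma> * (E - 1 / E) / (2 * \<i>)) * (g * W))"
      using E0 pi0 by (simp add: field_simps power2_eq_square power3_eq_cube)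
    finally have "\<sigma> * \<i> / of_real pi * (b * (E ^ 3 * p * g / 3 * W) + (- 1) ^ n * b * (E ^ 3 * p * g / 3 * (W * E)))
        = - (2 / (3 * of_real pi)) * (p * b * E\<^sup>2 * sin x * (g * W))" unfolding sin .
    moreover have "Gamma s / surf_powr w s = g * W" using sp by (simp add: b_p_g_def divide_inverse)
    ultimately show ?thesis
      unfolding B_poly_uminus arm_const_def E2 s_x_E_W_def(1)[symmetric] s_x_E_W_def(2)[symmetric] W'
        s_x_E_W_def(4)[symmetric] E3[symmetric] b_p_g_def[symmetric] by simp
  qed
  then show ?thesis
    by (simp only: arm_sum_def sum.distrib[symmetric] sum_distrib_left)
qed

text \<open>The condition on \<open>{a..b}\<close> says that the arguments of both arms, \<theta>
  and \<theta> - \<sigma> pi, lie in the range where the single-arm expansion is uniform.\<close>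

lemma hankel_expansion:
  assumes \<delta>: "0 < \<delta>" and \<sigma>: "\<sigma> = 1 \<or> \<sigma> = -1"
    and ab: "\<And>\<theta>. \<theta> \<in> {a..b} \<Longrightarrow> \<bar>\<theta>\<bar> \<le> 2 * pi - \<delta> \<and> \<bar>\<theta> - \<sigma> * pi\<bar> \<le> 2 * pi - \<delta>"
  defines "s \<equiv> complex_of_real \<sigma>"
  shows "(\<lambda>w. (bessel_J (surf_proj w - \<kappa>) w + s * \<i> * bessel_Y (surf_proj w - \<kappa>) w) -
      (- (2 / (3 * of_real pi)) *
        (\<Sum>n<N. 6 powr (of_nat (n + 1) / 3) * B_poly n \<kappa>
           * exp (s * (2 * of_nat (n + 1) * of_real pi * \<i> / 3))
           * sin (of_nat (n + 1) * of_real pi / 3)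
           * (Gamma (of_nat (n + 1) / 3) / surf_powr w (of_nat (n + 1) / 3)))))
    \<in> O[sector_at_infinity a b](\<lambda>w. of_real (1 / norm (surf_proj w) powr (real (N + 1) / 3)))"
proof -
  define m where "m = real (N + 1) / 3"
  let ?R = "\<lambda>\<kappa> w. arm (Im w) (bker (exp w - \<kappa>) w) - arm_sum \<kappa> N w"
  have s: "s = 1 \<or> s = -1" using \<sigma> by (auto simp: s_def)
  obtain C X where 1: "\<And>w. X \<le> Re w \<Longrightarrow> Im w \<in> {- (2 * pi) + \<delta>..2 * pi - \<delta>} \<Longrightarrow> norm (?R \<kappa> w) \<le> C * exp (- m * Re w)"
    using arm_expansion[OF \<delta>, of \<kappa> N] unfolding arm_expansion_on_def m_def by blast
  obtain C' X' where 2: "\<And>w. X' \<le> Re w \<Longrightarrow> Im w \<in> {- (2 * pi) + \<delta>..2 * pi - \<delta>} \<Longrightarrow> norm (?R (- \<kappa>) w) \<le> C' * exp (- m * Re w)"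
    using arm_expansion[OF \<delta>, of "- \<kappa>" N] unfolding arm_expansion_on_def m_def by blast
  have main: "norm ((bessel_J (surf_proj w - \<kappa>) w + s * \<i> * bessel_Y (surf_proj w - \<kappa>) w) -
      (- (2 / (3 * of_real pi)) *
        (\<Sum>n<N. 6 powr (of_nat (n + 1) / 3) * B_poly n \<kappa>
           * exp (s * (2 * of_nat (n + 1) * of_real pi * \<i> / 3))
           * sin (of_nat (n + 1) * of_real pi / 3)
           * (Gamma (of_nat (n + 1) / 3) / surf_powr w (of_nat (n + 1) / 3)))))
      \<le> (C + C') / pi * exp (- m * Re w)"
    if w: "max X X' \<le> Re w" "Im w \<in> {a..b}" for w
  proof -
    define w' where "w' = w - s * \<i> * of_real pi"
    have w'_parts: "Re w' = Re w" "Im w' = Im w - \<sigma> * pi" by (simp_all add: w'_def s_def)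
    have e: "exp w' = - exp w" using s by (auto simp: w'_def exp_diff exp_add exp_minus mult.commute[of \<i>])
    \<comment> \<open>Since the half turn negates z, the reflected order again has the form z' minus
      a constant, now with constant \<open>- \<kappa>\<close>.\<close>
    have \<nu>: "- (exp w - \<kappa>) = exp w' - (- \<kappa>)" by (simp add: e)
    have "(bessel_J (surf_proj w - \<kappa>) w + s * \<i> * bessel_Y (surf_proj w - \<kappa>) w) -
        s * \<i> / of_real pi * (arm_sum \<kappa> N w + arm_sum (- \<kappa>) N w') = s * \<i> / of_real pi * (?R \<kappa> w + ?R (- \<kappa>) w')"
      unfolding surf_proj_def hankel_eq_arms[OF s w'_def] \<nu> by (simp only: right_diff_distrib distrib_left) simp
    also have "norm \<dots> = norm (?R \<kappa> w + ?R (- \<kappa>) w') / pi"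
      using s by (auto simp: norm_mult norm_divide)
    also have "\<dots> \<le> (C * exp (- m * Re w) + C' * exp (- m * Re w')) / pi"
    proof (intro divide_right_mono norm_triangle_le add_mono 1 2)
      show "X \<le> Re w" "X' \<le> Re w'" using w(1) w'_parts by auto
      show "Im w \<in> {- (2 * pi) + \<delta>..2 * pi - \<delta>}" "Im w' \<in> {- (2 * pi) + \<delta>..2 * pi - \<delta>}"
        using ab[OF w(2)] unfolding w'_parts by (auto simp: abs_le_iff)
    qed simp
    also have "\<dots> = (C + C') / pi * exp (- m * Re w)" by (simp add: w'_parts distrib_right)
    finally show ?thesis unfolding arm_sums_eq[OF s w'_def] .
  qed
  have powr: "norm (complex_of_real (1 / norm (surf_proj w) powr m)) = exp (- m * Re w)" for w
    by (simp add: surf_proj_def powr_def exp_minus divide_inverse norm_inverse)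
  show ?thesis
    unfolding m_def[symmetric]
  proof (rule bigoI[where c = "(C + C') / pi"])
    show "\<forall>\<^sub>F w in sector_at_infinity a b. norm ((bessel_J (surf_proj w - \<kappa>) w + s * \<i> * bessel_Y (surf_proj w - \<kappa>) w) -
      (- (2 / (3 * of_real pi)) *
        (\<Sum>n<N. 6 powr (of_nat (n + 1) / 3) * B_poly n \<kappa>
           * exp (s * (2 * of_nat (n + 1) * of_real pi * \<i> / 3))
           * sin (of_nat (n + 1) * of_real pi / 3)
           * (Gamma (of_nat (n + 1) / 3) / surf_powr w (of_nat (n + 1) / 3)))))
      \<le> (C + C') / pi * norm (complex_of_real (1 / norm (surf_proj w) powr m))"
      unfolding sector_at_infinity_def eventually_inf_principal eventually_filtercomap_at_top_linorder powr
    proof (intro exI[of _ "exp (max X X')"] allI impI)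
      fix w assume "exp (max X X') \<le> norm (surf_proj w)" "w \<in> {w. a \<le> surf_arg w \<and> surf_arg w \<le> b}"
      then show "norm ((bessel_J (surf_proj w - \<kappa>) w + s * \<i> * bessel_Y (surf_proj w - \<kappa>) w) -
        (- (2 / (3 * of_real pi)) *
          (\<Sum>n<N. 6 powr (of_nat (n + 1) / 3) * B_poly n \<kappa>
             * exp (s * (2 * of_nat (n + 1) * of_real pi * \<i> / 3))
             * sin (of_nat (n + 1) * of_real pi / 3)
             * (Gamma (of_nat (n + 1) / 3) / surf_powr w (of_nat (n + 1) / 3)))))
        \<le> (C + C') / pi * exp (- m * Re w)"
        by (intro main) (auto simp: surf_proj_def surf_arg_def)
    qed
  qed
qed

theorem mainTheorem6:
  fixes \<kappa> :: complex and N :: nat and \<delta> :: real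
  assumes "0 < \<delta>" and "\<delta> \<le> pi"
  shows
    "(\<lambda>w. hankel_H1 (surf_proj w - \<kappa>) w -
        (- (2 / (3 * of_real pi)) *
          (\<Sum>n<N. 6 powr (of_nat (n + 1) / 3) * B_poly n \<kappa>
             * exp (2 * of_nat (n + 1) * of_real pi * \<i> / 3)
             * sin (of_nat (n + 1) * of_real pi / 3)
             * (Gamma (of_nat (n + 1) / 3) / surf_powr w (of_nat (n + 1) / 3)))))
      \<in> O[sector_at_infinity (- pi + \<delta>) (2 * pi - \<delta>)](\<lambda>w. of_real (1 / norm (surf_proj w) powr (real (N + 1) / 3)))
     \<and>
     (\<lambda>w. hankel_H2 (surf_proj w - \<kappa>) w -
        (- (2 / (3 * of_real pi)) *
          (\<Sum>n<N. 6 powr (of_nat (n + 1) / 3) * B_poly n \<kappa>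
             * exp (- (2 * of_nat (n + 1) * of_real pi * \<i> / 3))
             * sin (of_nat (n + 1) * of_real pi / 3)
             * (Gamma (of_nat (n + 1) / 3) / surf_powr w (of_nat (n + 1) / 3)))))
      \<in> O[sector_at_infinity (- 2 * pi + \<delta>) (pi - \<delta>)](\<lambda>w. of_real (1 / norm (surf_proj w) powr (real (N + 1) / 3)))"
proof (intro conjI)
  have "\<bar>\<theta>\<bar> \<le> 2 * pi - \<delta> \<and> \<bar>\<theta> - 1 * pi\<bar> \<le> 2 * pi - \<delta>" if "\<theta> \<in> {- pi + \<delta>..2 * pi - \<delta>}" for \<theta>
    using that assms by (auto simp: abs_le_iff)
  from hankel_expansion[OF assms(1) _ this, where \<kappa> = \<kappa> and N = N]
  show "(\<lambda>w. hankel_H1 (surf_proj w - \<kappa>) w -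
        (- (2 / (3 * of_real pi)) *
          (\<Sum>n<N. 6 powr (of_nat (n + 1) / 3) * B_poly n \<kappa>
             * exp (2 * of_nat (n + 1) * of_real pi * \<i> / 3)
             * sin (of_nat (n + 1) * of_real pi / 3)
             * (Gamma (of_nat (n + 1) / 3) / surf_powr w (of_nat (n + 1) / 3)))))
      \<in> O[sector_at_infinity (- pi + \<delta>) (2 * pi - \<delta>)](\<lambda>w. of_real (1 / norm (surf_proj w) powr (real (N + 1) / 3)))"
    by (simp only: hankel_H1_def of_real_1 mult_1_left simp_thms)
  have "\<bar>\<theta>\<bar> \<le> 2 * pi - \<delta> \<and> \<bar>\<theta> - (- 1) * pi\<bar> \<le> 2 * pi - \<delta>" if "\<theta> \<in> {- 2 * pi + \<delta>..pi - \<delta>}" for \<theta>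
    using that assms by (auto simp: abs_le_iff)
  from hankel_expansion[OF assms(1) _ this, where \<kappa> = \<kappa> and N = N]
  show "(\<lambda>w. hankel_H2 (surf_proj w - \<kappa>) w -
        (- (2 / (3 * of_real pi)) *
          (\<Sum>n<N. 6 powr (of_nat (n + 1) / 3) * B_poly n \<kappa>
             * exp (- (2 * of_nat (n + 1) * of_real pi * \<i> / 3))
             * sin (of_nat (n + 1) * of_real pi / 3)
             * (Gamma (of_nat (n + 1) / 3) / surf_powr w (of_nat (n + 1) / 3)))))
      \<in> O[sector_at_infinity (- 2 * pi + \<delta>) (pi - \<delta>)](\<lambda>w. of_real (1 / norm (surf_proj w) powr (real (N + 1) / 3)))"
    by (simp only: hankel_H2_def of_real_minus of_real_1 mult_minus_left mult_1_left simp_thms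
        add_uminus_conv_diff)
qed

end
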